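(* Let $d\ge2$, $D=\{1,\dots,d\}$, $X=L^2((0,1)^d)$, $s>0$. For each $\nu\in D$ let $(U_{\nu,m})_{m\ge1}$ be subspaces of $L^2(0,1)$ with $\dim U_{\nu,m}=m$ such that, for a constant $M$, $$E(u,U_{\nu,m})_{L^2(0,1)}\le M\,m^{-s}\|u\|_{H^s(0,1)}\quad\text{for all }u\in H^s(0,1),\ m\ge1,$$ and for $n=(n_1,\dots,n_d)$ let $U_n=U_{1,n_1}\otimes\cdots\otimes U_{d,n_d}$. For $f\in H^s((0,1)^d)$ and $0<\varepsilon<1$, let $N(f,\varepsilon,d)$ be the minimal complexity $N(T,r,U_n)$ (over admissible ranks $r$ and tuples $n$) such that $$e^T_{r,U_n}(f)_X\le\varepsilon\|f\|_{H^s}.$$ Then for any dimension partition tree $T$ over $D$ there exists a constant $C$ depending on $d$ (and on the fixed $s$ and $M$, but not on $f$ or $\varepsilon$) such that $$N(f,\varepsilon,d)\le C\,\varepsilon^{-d/s}.$$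
   Context: A dimension partition tree $T$ over $D$ is a rooted tree whose nodes are nonempty subsets of $D$, with root $D$, such that each node $\alpha$ is either a leaf (set of sons $S(\alpha)=\emptyset$) or has a set of sons $S(\alpha)$ forming a partition of $\alpha$ with $\#S(\alpha)\ge2$; the leaves are exactly the singletons $\{1\},\dots,\{d\}$. $\mathcal{I}(T)$ is the set of interior nodes. $H^s$ denotes the standard (fractional) Sobolev space and $E(u,V)_Y=\inf_{v\in V}\|u-v\|_Y$. For nonempty $\alpha\subsetneq D$ and $\alpha^c=D\setminus\alpha$, $\mathrm{rank}_\alpha(v)$ of $v\in X$ is the minimal $k$ (possibly infinite) such that $v(x)=\sum_{i=1}^k u_i(x_\alpha)w_i(x_{\alpha^c})$ with $L^2$ functions $u_i,w_i$; for $\alpha=D$ one takes $r_D=1$ and the constraint is vacuous. For $r=(r_\alpha)_{\alpha\in T}$ and a subspace $U=U_1\otimes\cdots\otimes U_d$ of $X$, $\mathcal{T}_r^T(U)=\{v\in U:\mathrm{rank}_\alpha(v)\le r_\alpha,\ \alpha\in T\}$ and $e^T_{r,U}(f)_X=\inf_{v\in\mathcal{T}_r^T(U)}\|f-v\|_X$; $r$ is admissible if $\mathcal{T}_r^T(X)\neq\emptyset$. The complexity is $$N(T,r,U)=\sum_{\alpha\in\mathcal{I}(T)}r_\alpha\prod_{\beta\in S(\alpha)}r_\beta+\sum_{\nu=1}^d r_\nu\dim(U_\nu),$$ where $r_\nu=r_{\{\nu\}}$. *)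

theory Defs
  imports "HOL-Analysis.Analysis"
begin

section \<open>The Hilbert space of square integrable functions on the unit cube\<close>

text \<open>Since \<open>One\<close> is the sum of the basis vectors, \<open>box 0 One\<close> is \<open>(0,1)\<close> for type \<^typ>\<open>real\<close>
  and \<open>(0,1)\<^sup>d\<close> for type \<^typ>\<open>real ^ 'n\<close> with \<open>d = CARD('n)\<close>.\<close>

definition unit_cube :: "'a::euclidean_space measure" where
  "unit_cube = restrict_space lborel (box 0 One)"

definition square_integrable :: "'b measure \<Rightarrow> ('b \<Rightarrow> real) \<Rightarrow> bool" where
  "square_integrable M f \<longleftrightarrow> f \<in> borel_measurable M \<and> integrable M (\<lambda>x. (f x)\<^sup>2)"

lemma square_integrable_measurable:
  "square_integrable M f \<Longrightarrow> f \<in> borel_measurable M"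
  by (simp add: square_integrable_def)

lemma square_integrable_mult:
  assumes "square_integrable M f" "square_integrable M g"
  shows "integrable M (\<lambda>x. f x * g x)"
proof (rule Bochner_Integration.integrable_bound)
  show "integrable M (\<lambda>x. (f x)\<^sup>2 + (g x)\<^sup>2)"
    using assms by (auto simp: square_integrable_def)
  show "(\<lambda>x. f x * g x) \<in> borel_measurable M"
    using assms by (auto simp: square_integrable_def)
  show "AE x in M. norm (f x * g x) \<le> norm ((f x)\<^sup>2 + (g x)\<^sup>2)"
  proof (rule AE_I2)
    fix x
    have "2 * \<bar>f x\<bar> * \<bar>g x\<bar> \<le> \<bar>f x\<bar>\<^sup>2 + \<bar>g x\<bar>\<^sup>2"
      by (rule sum_squares_bound)
    then have "2 * (\<bar>f x\<bar> * \<bar>g x\<bar>) \<le> (f x)\<^sup>2 + (g x)\<^sup>2"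
      by simp
    moreover have "0 \<le> \<bar>f x\<bar> * \<bar>g x\<bar>"
      by simp
    ultimately have "\<bar>f x\<bar> * \<bar>g x\<bar> \<le> (f x)\<^sup>2 + (g x)\<^sup>2"
      by linarith
    then show "norm (f x * g x) \<le> norm ((f x)\<^sup>2 + (g x)\<^sup>2)"
      by (simp add: abs_mult)
  qed
qed

lemma square_integrable_zero: "square_integrable M (\<lambda>x. 0)"
  by (simp add: square_integrable_def)

lemma square_integrable_add:
  assumes "square_integrable M f" "square_integrable M g"
  shows "square_integrable M (\<lambda>x. f x + g x)"
proof -
  have "integrable M (\<lambda>x. (f x)\<^sup>2 + (g x)\<^sup>2 + 2 * (f x * g x))"
    using assms square_integrable_mult[OF assms] by (auto simp: square_integrable_def)
  then show ?thesis
    using assms by (auto simp: square_integrable_def power2_sum mult.assoc)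
qed

lemma square_integrable_scale:
  assumes "square_integrable M f"
  shows "square_integrable M (\<lambda>x. c * f x)"
  using assms by (auto simp: square_integrable_def power_mult_distrib)

lemma square_integrable_minus:
  assumes "square_integrable M f"
  shows "square_integrable M (\<lambda>x. - f x)"
  using assms by (auto simp: square_integrable_def)

lemma square_integrable_diff:
  assumes "square_integrable M f" "square_integrable M g"
  shows "square_integrable M (\<lambda>x. f x - g x)"
  using square_integrable_add[OF assms(1) square_integrable_minus[OF assms(2)]] by simp

definition l2_rel :: "('a::euclidean_space \<Rightarrow> real) \<Rightarrow> ('a \<Rightarrow> real) \<Rightarrow> bool" where
  "l2_rel f g \<longleftrightarrow> square_integrable unit_cube f \<and> square_integrable unit_cube g \<and>
     (AE x in unit_cube. f x = g x)"

quotient_type (overloaded) 'a cube_L2 = "'a::euclidean_space \<Rightarrow> real" / partial: l2_rel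
proof (rule part_equivpI)
  show "\<exists>f :: 'a \<Rightarrow> real. l2_rel f f"
    using square_integrable_zero by (auto simp: l2_rel_def)
  show "symp (l2_rel :: ('a \<Rightarrow> real) \<Rightarrow> _)"
  proof (rule sympI)
    fix f g :: "'a \<Rightarrow> real"
    assume "l2_rel f g"
    moreover have "AE x in unit_cube. g x = f x" if "AE x in unit_cube. f x = g x"
      using that by eventually_elim simp
    ultimately show "l2_rel g f"
      by (auto simp: l2_rel_def)
  qed
  show "transp (l2_rel :: ('a \<Rightarrow> real) \<Rightarrow> _)"
  proof (rule transpI)
    fix f g h :: "'a \<Rightarrow> real"
    assume "l2_rel f g" "l2_rel g h"
    moreover have "AE x in unit_cube. f x = h x"
      if "AE x in unit_cube. f x = g x" "AE x in unit_cube. g x = h x"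
      using that by eventually_elim simp
    ultimately show "l2_rel f h"
      by (auto simp: l2_rel_def)
  qed
qed

lemma l2_rel_inner:
  assumes "l2_rel f f'" "l2_rel g g'"
  shows "(\<integral>x. f x * g x \<partial>unit_cube) = (\<integral>x. f' x * g' x \<partial>unit_cube)"
proof (rule integral_cong_AE)
  show "AE x in unit_cube. f x * g x = f' x * g' x"
    using assms unfolding l2_rel_def by auto
qed (use assms in \<open>auto simp: l2_rel_def square_integrable_def\<close>)

instantiation cube_L2 :: (euclidean_space) real_vector
begin

lift_definition zero_cube_L2 :: "'a cube_L2" is "\<lambda>x. 0"
  by (simp add: l2_rel_def square_integrable_zero)

lift_definition plus_cube_L2 :: "'a cube_L2 \<Rightarrow> 'a cube_L2 \<Rightarrow> 'a cube_L2"
  is "\<lambda>f g x. f x + g x"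
  by (auto simp: l2_rel_def square_integrable_add)

lift_definition scaleR_cube_L2 :: "real \<Rightarrow> 'a cube_L2 \<Rightarrow> 'a cube_L2"
  is "\<lambda>c f x. c * f x"
  by (auto simp: l2_rel_def square_integrable_scale)

lift_definition uminus_cube_L2 :: "'a cube_L2 \<Rightarrow> 'a cube_L2"
  is "\<lambda>f x. - f x"
  by (auto simp: l2_rel_def square_integrable_minus)

lift_definition minus_cube_L2 :: "'a cube_L2 \<Rightarrow> 'a cube_L2 \<Rightarrow> 'a cube_L2"
  is "\<lambda>f g x. f x - g x"
  by (auto simp: l2_rel_def square_integrable_diff)

instance
proof
  fix u v w :: "'a cube_L2" and a b :: real
  show "u + v + w = u + (v + w)"
    by transfer (auto simp: l2_rel_def algebra_simps intro!: square_integrable_add)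
  show "u + v = v + u"
    by transfer (auto simp: l2_rel_def algebra_simps intro!: square_integrable_add)
  show "0 + u = u"
    by transfer (auto simp: l2_rel_def)
  show "- u + u = 0"
    by transfer (auto simp: l2_rel_def square_integrable_zero)
  show "u - v = u + - v"
    by transfer (auto simp: l2_rel_def intro!: square_integrable_diff)
  show "a *\<^sub>R (u + v) = a *\<^sub>R u + a *\<^sub>R v"
    by transfer (auto simp: l2_rel_def distrib_left intro!: square_integrable_add square_integrable_scale)
  show "(a + b) *\<^sub>R u = a *\<^sub>R u + b *\<^sub>R u"
    by transfer (auto simp: l2_rel_def distrib_right intro!: square_integrable_add square_integrable_scale)
  show "a *\<^sub>R b *\<^sub>R u = (a * b) *\<^sub>R u"
    by transfer (auto simp: l2_rel_def mult.assoc intro!: square_integrable_scale)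
  show "1 *\<^sub>R u = u"
    by transfer (auto simp: l2_rel_def)
qed

end

instantiation cube_L2 :: (euclidean_space) real_inner
begin

lift_definition inner_cube_L2 :: "'a cube_L2 \<Rightarrow> 'a cube_L2 \<Rightarrow> real"
  is "\<lambda>f g. \<integral>x. f x * g x \<partial>unit_cube"
  by (rule l2_rel_inner)

definition norm_cube_L2 :: "'a cube_L2 \<Rightarrow> real" where
  "norm_cube_L2 u = sqrt (inner u u)"

definition sgn_cube_L2 :: "'a cube_L2 \<Rightarrow> 'a cube_L2" where
  "sgn_cube_L2 u = u /\<^sub>R norm u"

definition dist_cube_L2 :: "'a cube_L2 \<Rightarrow> 'a cube_L2 \<Rightarrow> real" where
  "dist_cube_L2 u v = norm (u - v)"

definition uniformity_cube_L2 :: "('a cube_L2 \<times> 'a cube_L2) filter" where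
  "uniformity_cube_L2 = (INF e\<in>{0<..}. principal {(x, y). dist x y < e})"

definition open_cube_L2 :: "'a cube_L2 set \<Rightarrow> bool" where
  "open_cube_L2 U \<longleftrightarrow> (\<forall>x\<in>U. \<forall>\<^sub>F (x', y) in uniformity. x' = x \<longrightarrow> y \<in> U)"

instance
proof
  fix u v w :: "'a cube_L2" and a :: real
  show "sgn u = u /\<^sub>R norm u"
    by (rule sgn_cube_L2_def)
  show "dist u v = norm (u - v)"
    by (rule dist_cube_L2_def)
  show "(uniformity :: ('a cube_L2 \<times> 'a cube_L2) filter) =
      (INF e\<in>{0<..}. principal {(x, y). dist x y < e})"
    by (rule uniformity_cube_L2_def)
  show "open U \<longleftrightarrow> (\<forall>x\<in>U. \<forall>\<^sub>F (x', y) in uniformity. x' = x \<longrightarrow> y \<in> U)" for U :: "'a cube_L2 set"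
    by (rule open_cube_L2_def)
  show "inner u v = inner v u"
    by transfer (simp add: mult.commute)
  show "inner (u + v) w = inner u w + inner v w"
  proof transfer
    fix f g h :: "'a \<Rightarrow> real"
    assume "l2_rel f f" "l2_rel g g" "l2_rel h h"
    then show "(\<integral>x. (f x + g x) * h x \<partial>unit_cube) =
        (\<integral>x. f x * h x \<partial>unit_cube) + (\<integral>x. g x * h x \<partial>unit_cube)"
      by (simp add: l2_rel_def distrib_right square_integrable_mult)
  qed
  show "inner (a *\<^sub>R u) v = a * inner u v"
    by transfer (simp add: mult.assoc)
  show "0 \<le> inner u u"
    by transfer (simp add: integral_nonneg_AE)
  show "inner u u = 0 \<longleftrightarrow> u = 0"
  proof transfer
    fix f :: "'a \<Rightarrow> real"
    assume f: "l2_rel f f"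
    then have "integrable unit_cube (\<lambda>x. f x * f x)"
      by (simp add: l2_rel_def square_integrable_mult)
    then have "(\<integral>x. f x * f x \<partial>unit_cube) = 0 \<longleftrightarrow> (AE x in unit_cube. f x * f x = 0)"
      by (rule integral_nonneg_eq_0_iff_AE) simp
    then show "(\<integral>x. f x * f x \<partial>unit_cube) = 0 \<longleftrightarrow> l2_rel f (\<lambda>x. 0)"
      using f by (simp add: l2_rel_def square_integrable_zero)
  qed
  show "norm u = sqrt (inner u u)"
    by (rule norm_cube_L2_def)
qed

end

text \<open>\<open>rep u\<close> is some representative of the class \<open>u\<close>; every definition below that mentions it is
  invariant under changes of the representative on null sets.\<close>

abbreviation rep :: "'a::euclidean_space cube_L2 \<Rightarrow> 'a \<Rightarrow> real" where
  "rep \<equiv> rep_cube_L2"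

lemma square_integrable_rep: "square_integrable unit_cube (rep u)"
  using Quotient3_rep_reflp[OF Quotient3_cube_L2, of u] by (simp add: l2_rel_def)

lemma rep_abs:
  assumes "square_integrable unit_cube f"
  shows "AE x in unit_cube. rep (abs_cube_L2 f) x = f x"
  using rep_abs_rsp_left[OF Quotient3_cube_L2, of f f] assms by (simp add: l2_rel_def)

lemma cube_L2_eq_iff: "u = v \<longleftrightarrow> (AE x in unit_cube. rep u x = rep v x)"
  using Quotient3_rel_rep[OF Quotient3_cube_L2, of u v]
  by (auto simp: l2_rel_def square_integrable_rep)

lemma norm_cube_L2_rep: "norm u = sqrt (\<integral>x. (rep u x)\<^sup>2 \<partial>unit_cube)"
  by (simp add: norm_cube_L2_def inner_cube_L2.rep_eq power2_eq_square)


section \<open>Fractional Sobolev spaces\<close>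

definition partial_deriv :: "'a::euclidean_space \<Rightarrow> ('a \<Rightarrow> real) \<Rightarrow> 'a \<Rightarrow> real" where
  "partial_deriv b \<phi> x = frechet_derivative \<phi> (at x) b"

definition smooth :: "('a::euclidean_space \<Rightarrow> real) \<Rightarrow> bool" where
  "smooth \<phi> \<longleftrightarrow> (\<forall>bs\<in>lists Basis. \<forall>x. foldr partial_deriv bs \<phi> differentiable at x)"

definition test_function :: "('a::euclidean_space \<Rightarrow> real) \<Rightarrow> bool" where
  "test_function \<phi> \<longleftrightarrow> smooth \<phi> \<and> compact (closure {x. \<phi> x \<noteq> 0}) \<and>
     closure {x. \<phi> x \<noteq> 0} \<subseteq> box 0 One"

text \<open>Multi-indices are functions supported on \<open>Basis\<close>. The order in which the partial derivatives
  are taken is fixed but arbitrary, which is immaterial for smooth functions.\<close>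

definition multi_indices :: "nat \<Rightarrow> ('a::euclidean_space \<Rightarrow> nat) set" where
  "multi_indices k = {\<beta>. (\<forall>b. b \<notin> Basis \<longrightarrow> \<beta> b = 0) \<and> sum \<beta> Basis = k}"

lemma finite_multi_indices: "finite (multi_indices k :: ('a::euclidean_space \<Rightarrow> nat) set)"
proof (rule finite_subset)
  show "multi_indices k \<subseteq>
      {\<beta> :: 'a \<Rightarrow> nat. \<forall>b. (b \<in> Basis \<longrightarrow> \<beta> b \<in> {..k}) \<and> (b \<notin> Basis \<longrightarrow> \<beta> b = 0)}"
    by (auto simp: multi_indices_def intro: member_le_sum)
  show "finite {\<beta> :: 'a \<Rightarrow> nat. \<forall>b. (b \<in> Basis \<longrightarrow> \<beta> b \<in> {..k}) \<and> (b \<notin> Basis \<longrightarrow> \<beta> b = 0)}"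
    by (rule finite_set_of_finite_funs) auto
qed

definition basis_list :: "'a::euclidean_space list" where
  "basis_list = (SOME bs. distinct bs \<and> set bs = Basis)"

definition multi_deriv :: "('a::euclidean_space \<Rightarrow> nat) \<Rightarrow> ('a \<Rightarrow> real) \<Rightarrow> 'a \<Rightarrow> real" where
  "multi_deriv \<beta> \<phi> = foldr (\<lambda>b. partial_deriv b ^^ \<beta> b) basis_list \<phi>"

definition is_weak_deriv ::
  "('a::euclidean_space \<Rightarrow> nat) \<Rightarrow> 'a cube_L2 \<Rightarrow> 'a cube_L2 \<Rightarrow> bool" where
  "is_weak_deriv \<beta> u v \<longleftrightarrow>
     (\<forall>\<phi>. test_function \<phi> \<longrightarrow>
        (\<integral>x. rep u x * multi_deriv \<beta> \<phi> x \<partial>unit_cube) =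
        (-1) ^ sum \<beta> Basis * (\<integral>x. rep v x * \<phi> x \<partial>unit_cube))"

text \<open>A weak derivative is unique as an element of \<open>cube_L2\<close> whenever it exists.\<close>

definition weak_deriv :: "('a::euclidean_space \<Rightarrow> nat) \<Rightarrow> 'a cube_L2 \<Rightarrow> 'a cube_L2" where
  "weak_deriv \<beta> u = (SOME v. is_weak_deriv \<beta> u v)"

definition gagliardo :: "real \<Rightarrow> 'a::euclidean_space cube_L2 \<Rightarrow> ennreal" where
  "gagliardo \<sigma> u =
     (\<integral>\<^sup>+x. \<integral>\<^sup>+y. ennreal ((rep u x - rep u y)\<^sup>2 / norm (x - y) powr (real DIM('a) + 2 * \<sigma>))
        \<partial>unit_cube \<partial>unit_cube)"

text \<open>The Sobolev--Slobodeckij space \<open>H\<^sup>s\<close> of the unit cube, for \<open>s = k + \<sigma>\<close> with \<open>k\<close> a natural number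
  and \<open>0 \<le> \<sigma> < 1\<close>. If \<open>\<sigma> = 0\<close> there is no Gagliardo term.\<close>

definition sobolev :: "real \<Rightarrow> 'a::euclidean_space cube_L2 set" where
  "sobolev s = {u.
     (\<forall>j\<le>nat \<lfloor>s\<rfloor>. \<forall>\<beta>\<in>multi_indices j. \<exists>v. is_weak_deriv \<beta> u v) \<and>
     (frac s \<noteq> 0 \<longrightarrow> (\<forall>\<beta>\<in>multi_indices (nat \<lfloor>s\<rfloor>). gagliardo (frac s) (weak_deriv \<beta> u) < \<infinity>))}"

definition sobolev_norm :: "real \<Rightarrow> 'a::euclidean_space cube_L2 \<Rightarrow> real" where
  "sobolev_norm s u = sqrt (
     (\<Sum>j\<le>nat \<lfloor>s\<rfloor>. \<Sum>\<beta>\<in>multi_indices j. (norm (weak_deriv \<beta> u))\<^sup>2) +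
     (if frac s = 0 then 0
      else \<Sum>\<beta>\<in>multi_indices (nat \<lfloor>s\<rfloor>). enn2real (gagliardo (frac s) (weak_deriv \<beta> u))))"


section \<open>Tree tensor networks\<close>

text \<open>The set \<open>D\<close> is the universe of the finite index type \<^typ>\<open>'n\<close>. A tree is given by its set \<open>T\<close>
  of nodes and its map \<open>S\<close> from nodes to sets of sons. Sons are proper subsets of their parent, so
  there are no cycles, and a unique parent for every node other than \<open>UNIV\<close> makes this a tree rooted
  at \<open>UNIV\<close>.\<close>

definition dimension_partition_tree :: "'n::finite set set \<Rightarrow> ('n set \<Rightarrow> 'n set set) \<Rightarrow> bool" where
  "dimension_partition_tree T S \<longleftrightarrow>
     UNIV \<in> T \<and> {} \<notin> T \<and>
     (\<forall>\<alpha>\<in>T. S \<alpha> \<subseteq> T \<and> (S \<alpha> = {} \<or> partition_on \<alpha> (S \<alpha>) \<and> 2 \<le> card (S \<alpha>))) \<and>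
     (\<forall>\<beta>\<in>T - {UNIV}. \<exists>!\<alpha>. \<alpha> \<in> T \<and> \<beta> \<in> S \<alpha>) \<and>
     {\<alpha>\<in>T. S \<alpha> = {}} = range (\<lambda>\<nu>. {\<nu>})"

definition interior_nodes :: "'n::finite set set \<Rightarrow> ('n set \<Rightarrow> 'n set set) \<Rightarrow> 'n set set" where
  "interior_nodes T S = {\<alpha>\<in>T. S \<alpha> \<noteq> {}}"

text \<open>Functions of \<open>x\<^sub>\<alpha>\<close> are functions on \<open>PiM \<alpha>\<close>, i.e. on \<open>(0,1)\<^sup>\<alpha>\<close>, evaluated at the restriction
  of the coordinate map of \<open>x\<close> to \<open>\<alpha>\<close>.\<close>

definition separated :: "'n::finite set \<Rightarrow> (real ^ 'n) cube_L2 \<Rightarrow> nat \<Rightarrow> bool" where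
  "separated \<alpha> v k \<longleftrightarrow>
     (\<exists>u w :: nat \<Rightarrow> ('n \<Rightarrow> real) \<Rightarrow> real.
        (\<forall>i<k. square_integrable (PiM \<alpha> (\<lambda>_. unit_cube)) (u i)) \<and>
        (\<forall>i<k. square_integrable (PiM (- \<alpha>) (\<lambda>_. unit_cube)) (w i)) \<and>
        (AE x in unit_cube.
           rep v x = (\<Sum>i<k. u i (restrict (($) x) \<alpha>) * w i (restrict (($) x) (- \<alpha>)))))"

definition tensor_rank :: "'n::finite set \<Rightarrow> (real ^ 'n) cube_L2 \<Rightarrow> enat" where
  "tensor_rank \<alpha> v = (INF k\<in>{k. separated \<alpha> v k}. enat k)"

definition tensor_space ::
  "('n::finite \<Rightarrow> real cube_L2 set) \<Rightarrow> (real ^ 'n) cube_L2 set" where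
  "tensor_space U = span {v. \<exists>u. (\<forall>\<nu>. u \<nu> \<in> U \<nu>) \<and>
     (AE x in unit_cube. rep v x = (\<Prod>\<nu>\<in>UNIV. rep (u \<nu>) (x $ \<nu>)))}"

definition tree_tensors ::
  "'n::finite set set \<Rightarrow> ('n set \<Rightarrow> nat) \<Rightarrow> (real ^ 'n) cube_L2 set \<Rightarrow> (real ^ 'n) cube_L2 set" where
  "tree_tensors T r V = {v\<in>V. \<forall>\<alpha>\<in>T - {UNIV}. tensor_rank \<alpha> v \<le> enat (r \<alpha>)}"

definition admissible :: "'n::finite set set \<Rightarrow> ('n set \<Rightarrow> nat) \<Rightarrow> bool" where
  "admissible T r \<longleftrightarrow> r UNIV = 1 \<and> tree_tensors T r UNIV \<noteq> {}"

definition complexity ::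
  "'n::finite set set \<Rightarrow> ('n set \<Rightarrow> 'n set set) \<Rightarrow> ('n set \<Rightarrow> nat) \<Rightarrow> ('n \<Rightarrow> real cube_L2 set) \<Rightarrow> nat"
  where
  "complexity T S r U =
     (\<Sum>\<alpha>\<in>interior_nodes T S. r \<alpha> * (\<Prod>\<beta>\<in>S \<alpha>. r \<beta>)) + (\<Sum>\<nu>\<in>UNIV. r {\<nu>} * dim (U \<nu>))"

text \<open>The best approximation errors are given by \<^const>\<open>infdist\<close>; the sets in question contain
  \<open>0\<close>, so the value of \<^const>\<open>infdist\<close> on the empty set plays no role. The infimum in \<open>enat\<close> is a minimum, or \<open>\<infinity>\<close> if no
  \<open>r\<close> and \<open>n\<close> reach the accuracy.\<close>

definition min_complexity ::
  "real \<Rightarrow> 'n::finite set set \<Rightarrow> ('n set \<Rightarrow> 'n set set) \<Rightarrow> ('n \<Rightarrow> nat \<Rightarrow> real cube_L2 set) \<Rightarrow>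
   (real ^ 'n) cube_L2 \<Rightarrow> real \<Rightarrow> enat" where
  "min_complexity s T S U f \<epsilon> =
     (INF (r, n) \<in> {(r, n). admissible T r \<and> (\<forall>\<nu>. 1 \<le> n \<nu>) \<and>
          infdist f (tree_tensors T r (tensor_space (\<lambda>\<nu>. U \<nu> (n \<nu>)))) \<le> \<epsilon> * sobolev_norm s f}.
        enat (complexity T S r (\<lambda>\<nu>. U \<nu> (n \<nu>))))"

end

theory Submission
  imports Defs
begin

text \<open>The approximant of \<open>f\<close> is its orthogonal projection onto \<open>U\<^sub>n\<close> with the same
  \<open>n = O(\<epsilon>\<^bsup>-1/s\<^esup>)\<close> in every direction, obtained by projecting in one coordinate after the other.

  \<^emph>\<open>Error.\<close> The coordinate projections are contractions, so the error of their composition is at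
  most the sum of their individual errors (\<open>norm_diff_coord_projs_le\<close>). By Fubini's theorem, the
  squared error in the direction \<open>\<nu>\<close> is the integral, over the lines parallel to the \<open>\<nu>\<close>-axis, of the
  squared distance between \<open>U\<^bsub>\<nu>,n\<^esub>\<close> and the restriction of \<open>f\<close> to the line. The hypothesis bounds
  this distance for restrictions in \<open>H\<^sup>s(0,1)\<close>. So everything rests on \<open>sobolev_slice\<close>: almost all
  restrictions lie in \<open>H\<^sup>s(0,1)\<close>, and their squared norms have an integral of at most a constant times
  the squared norm of \<open>f\<close>. Two things have to be shown for this. The weak derivative of almost every
  restriction is the restriction of the weak derivative (\<open>AE_slice_weak_deriv\<close>): for a single test
  function on the line this follows by testing against tensor products, and a countable family of
  test functions that is dense in a sufficiently strong sense moves the exceptional null set outside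
  the quantifier over test functions. The Gagliardo seminorms of the restrictions are controlled by
  the seminorm of the function on the cube (\<open>slice_gagliardo_le\<close>): the difference of the values at two
  points of a line is averaged over points of the cube that are near both.

  \<^emph>\<open>Ranks.\<close> The approximant is a linear combination of products of basis functions, at most \<open>n\<close> for
  each coordinate. Collecting the factors with coordinates in \<open>\<alpha>\<close>, or those with coordinates outside
  \<open>\<alpha>\<close>, shows that its \<open>\<alpha>\<close>-rank is at most \<open>n\<close> to the power \<open>min #\<alpha> (d - #\<alpha>)\<close>
  (\<open>tensor_rank_tensor_sum\<close>).

  \<^emph>\<open>Complexity.\<close> With these ranks every interior node contributes at most
  \<open>n\<^bsup>d - #\<alpha>\<^esup> \<cdot> n\<^bsup>#\<alpha>\<^esup> = n\<^sup>d\<close>, because the sons partition \<open>\<alpha>\<close>, and every leaf contributes at most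
  \<open>n\<^sup>2 \<le> n\<^sup>d\<close> (\<open>complexity_full_ranks_le\<close>). The number of nodes is bounded in terms of \<open>d\<close>, so the
  total is \<open>O(n\<^sup>d) = O(\<epsilon>\<^bsup>-d/s\<^esup>)\<close>.

  The lines parallel to a coordinate axis are parametrised redundantly by all points \<open>x\<close> of the
  cube: \<open>slice b f x\<close> is \<open>f\<close> with the coordinate \<open>b\<close> of \<open>x\<close> left free. As the cube has measure \<open>1\<close>,
  integrating over all \<open>x\<close> is the same as integrating over the lines (\<open>distr_set_coord\<close>), so that all
  functions of several variables live on the same cube.\<close>


section \<open>The unit cube as a probability space\<close>

lemma space_unit_cube [simp]: "space unit_cube = box 0 One"
  by (simp add: unit_cube_def space_restrict_space)

lemma One_inner [simp]: "b \<in> Basis \<Longrightarrow> (One :: 'a::euclidean_space) \<bullet> b = 1"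
  by (simp add: inner_sum_left inner_Basis if_distrib sum.delta cong: if_cong)

lemma emeasure_unit_cube: "emeasure (unit_cube :: 'a::euclidean_space measure) (box 0 One) = 1"
  by (simp add: unit_cube_def emeasure_restrict_space emeasure_lborel_box_eq)

lemma finite_measure_unit_cube: "finite_measure (unit_cube :: 'a::euclidean_space measure)"
  by (rule finite_measureI) (simp add: emeasure_unit_cube)

lemma sigma_finite_unit_cube: "sigma_finite_measure (unit_cube :: 'a::euclidean_space measure)"
  by (rule finite_measure.axioms(1)[OF finite_measure_unit_cube])

lemma pair_sigma_finite_unit_cube:
  "pair_sigma_finite (unit_cube :: 'a::euclidean_space measure) (unit_cube :: 'b::euclidean_space measure)"
  by (intro pair_sigma_finite.intro sigma_finite_unit_cube)

lemma integral_unit_cube_const [simp]: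
  "(\<integral>x. c \<partial>(unit_cube :: 'a::euclidean_space measure)) = (c :: real)"
  by (simp add: measure_def emeasure_unit_cube)

lemma nn_integral_unit_cube:
  "(\<integral>\<^sup>+x. f x \<partial>(unit_cube :: 'a::euclidean_space measure)) =
     (\<integral>\<^sup>+x. f x * indicator (box 0 One) x \<partial>lborel)"
  unfolding unit_cube_def by (subst nn_integral_restrict_space) auto

lemma id_measurable_unit_cube [measurable]: "(\<lambda>x. x) \<in> unit_cube \<rightarrow>\<^sub>M borel"
  unfolding unit_cube_def by (intro measurable_restrict_space1) simp

lemma measurable_into_unit_cube:
  "f \<in> M \<rightarrow>\<^sub>M borel \<Longrightarrow> (\<And>x. x \<in> space M \<Longrightarrow> f x \<in> box 0 One) \<Longrightarrow> f \<in> M \<rightarrow>\<^sub>M unit_cube"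
  unfolding unit_cube_def by (rule measurable_restrict_space2) auto

lemma borel_measurable_unit_cube:
  "f \<in> borel \<rightarrow>\<^sub>M N \<Longrightarrow> f \<in> unit_cube \<rightarrow>\<^sub>M N"
  unfolding unit_cube_def by (rule measurable_restrict_space1) simp

lemma rep_measurable [measurable]: "rep u \<in> borel_measurable unit_cube"
  using square_integrable_rep square_integrable_measurable by blast

lemma unit_cube_coord: "x \<in> box 0 (One :: 'a::euclidean_space) \<Longrightarrow> b \<in> Basis \<Longrightarrow> 0 < x \<bullet> b \<and> x \<bullet> b < 1"
  by (simp add: mem_box)

lemma in_unit_interval: "t \<in> box 0 (One :: real) \<longleftrightarrow> 0 < t \<and> t < 1"
  by (auto simp: mem_box)

section \<open>Replacing a coordinate\<close>

definition set_coord :: "'a::euclidean_space \<Rightarrow> 'a \<Rightarrow> real \<Rightarrow> 'a" where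
  "set_coord b x t = x + (t - x \<bullet> b) *\<^sub>R b"

lemma set_coord_inner: "b \<in> Basis \<Longrightarrow> c \<in> Basis \<Longrightarrow> set_coord b x t \<bullet> c = (if c = b then t else x \<bullet> c)"
  by (simp add: set_coord_def inner_add_left inner_Basis)

lemma set_coord_set_coord [simp]: "b \<in> Basis \<Longrightarrow> set_coord b (set_coord b x s) t = set_coord b x t"
  by (simp add: set_coord_def inner_add_left flip: scaleR_left_distrib)

lemma set_coord_same [simp]: "b \<in> Basis \<Longrightarrow> set_coord b x (x \<bullet> b) = x"
  by (simp add: set_coord_def)

lemma set_coord_commute:
  "b \<in> Basis \<Longrightarrow> c \<in> Basis \<Longrightarrow> b \<noteq> c \<Longrightarrow> set_coord b (set_coord c x s) t = set_coord c (set_coord b x t) s"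
  by (simp add: set_coord_def inner_add_left inner_Basis)

lemma set_coord_in_unit_cube:
  assumes "b \<in> Basis" "x \<in> box 0 (One :: 'a::euclidean_space)" "t \<in> box 0 (One :: real)"
  shows "set_coord b x t \<in> box 0 One"
  using assms by (auto simp: mem_box set_coord_inner)

lemma set_coord_measurable_borel [measurable]:
  "(\<lambda>(x, t). set_coord b x t) \<in> borel \<Otimes>\<^sub>M borel \<rightarrow>\<^sub>M borel"
  unfolding set_coord_def by (simp add: split_beta')

lemma set_coord_measurable [measurable (raw)]:
  assumes "b \<in> Basis" "f \<in> M \<rightarrow>\<^sub>M unit_cube" "g \<in> M \<rightarrow>\<^sub>M (unit_cube :: real measure)"
  shows "(\<lambda>z. set_coord b (f z) (g z)) \<in> M \<rightarrow>\<^sub>M unit_cube"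
proof (rule measurable_into_unit_cube)
  have "(\<lambda>z. (f z, g z)) \<in> M \<rightarrow>\<^sub>M borel \<Otimes>\<^sub>M borel"
    using measurable_compose[OF assms(2) id_measurable_unit_cube]
      measurable_compose[OF assms(3) id_measurable_unit_cube] by measurable
  from measurable_compose[OF this set_coord_measurable_borel]
  show "(\<lambda>z. set_coord b (f z) (g z)) \<in> M \<rightarrow>\<^sub>M borel"
    by simp
  fix z assume "z \<in> space M"
  then show "set_coord b (f z) (g z) \<in> box 0 One"
    using measurable_space[OF assms(2)] measurable_space[OF assms(3)]
    by (auto intro: set_coord_in_unit_cube[OF assms(1)])
qed

lemma nn_integral_shift:
  fixes f :: "'a::euclidean_space \<Rightarrow> ennreal"
  assumes [measurable]: "f \<in> borel_measurable borel"
  shows "(\<integral>\<^sup>+x. f (c + x) \<partial>lborel) = (\<integral>\<^sup>+x. f x \<partial>lborel)"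
proof -
  have "(\<integral>\<^sup>+x. f x \<partial>lborel) = (\<integral>\<^sup>+x. f x \<partial>distr lborel borel ((+) c))"
    by (simp add: lborel_distr_plus)
  also have "\<dots> = (\<integral>\<^sup>+x. f (c + x) \<partial>lborel)"
    by (subst nn_integral_distr) auto
  finally show ?thesis by simp
qed

text \<open>Writing the new coordinate as \<open>t = x\<^sub>b + \<tau>\<close>, the inner integral is over translates of \<open>f\<close>,
  so that translation invariance of the Lebesgue measure moves the translation to the indicator
  function of the cube, from which \<open>\<tau>\<close> is integrated out.\<close>

lemma nn_integral_set_coord:
  fixes f :: "'a::euclidean_space \<Rightarrow> ennreal"
  assumes b: "b \<in> Basis" and f: "f \<in> borel_measurable unit_cube"
  shows "(\<integral>\<^sup>+x. \<integral>\<^sup>+t. f (set_coord b x t) \<partial>unit_cube \<partial>unit_cube) = (\<integral>\<^sup>+x. f x \<partial>unit_cube)"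
proof -
  define g where "g x = f x * indicator (box 0 One) x" for x
  have g [measurable]: "g \<in> borel_measurable borel"
    using f unfolding g_def unit_cube_def
    by (subst (asm) borel_measurable_restrict_space_iff_ennreal) auto
  have gf: "g x = f x" if "x \<in> box 0 One" for x using that by (simp add: g_def)
  let ?I = "indicator (box 0 (One :: real)) :: real \<Rightarrow> ennreal"
  let ?J = "indicator (box 0 (One :: 'a)) :: 'a \<Rightarrow> ennreal"
  have "(\<integral>\<^sup>+x. \<integral>\<^sup>+t. f (set_coord b x t) \<partial>unit_cube \<partial>unit_cube) =
      (\<integral>\<^sup>+x. \<integral>\<^sup>+t. g (set_coord b x t) \<partial>unit_cube \<partial>unit_cube)"
    by (intro nn_integral_cong) (simp add: gf set_coord_in_unit_cube b)
  also have "\<dots> = (\<integral>\<^sup>+x. (\<integral>\<^sup>+t. g (set_coord b x t) * ?I t \<partial>lborel) * ?J x \<partial>lborel)"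
    by (simp add: nn_integral_unit_cube)
  also have "\<dots> = (\<integral>\<^sup>+x. \<integral>\<^sup>+t. g (set_coord b x t) * ?I t * ?J x \<partial>lborel \<partial>lborel)"
    by (intro nn_integral_cong, subst nn_integral_multc) (auto simp: set_coord_def)
  also have "\<dots> = (\<integral>\<^sup>+x. \<integral>\<^sup>+\<tau>. g (x + \<tau> *\<^sub>R b) * ?I (x \<bullet> b + \<tau>) * ?J x \<partial>lborel \<partial>lborel)"
  proof (rule nn_integral_cong)
    fix x :: 'a
    have [measurable]: "(\<lambda>t. g (set_coord b x t) * ?I t * ?J x) \<in> borel_measurable borel"
      by (simp add: set_coord_def)
    show "(\<integral>\<^sup>+t. g (set_coord b x t) * ?I t * ?J x \<partial>lborel) =
        (\<integral>\<^sup>+\<tau>. g (x + \<tau> *\<^sub>R b) * ?I (x \<bullet> b + \<tau>) * ?J x \<partial>lborel)"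
      by (subst nn_integral_shift[of _ "x \<bullet> b", symmetric]) (auto simp: set_coord_def)
  qed
  also have "\<dots> = (\<integral>\<^sup>+\<tau>. \<integral>\<^sup>+x. g (x + \<tau> *\<^sub>R b) * ?I (x \<bullet> b + \<tau>) * ?J x \<partial>lborel \<partial>lborel)"
    by (rule lborel_pair.Fubini'[symmetric]) measurable
  also have "\<dots> = (\<integral>\<^sup>+\<tau>. \<integral>\<^sup>+y. g y * ?I (y \<bullet> b) * ?J (y - \<tau> *\<^sub>R b) \<partial>lborel \<partial>lborel)"
  proof (rule nn_integral_cong)
    fix \<tau> :: real
    show "(\<integral>\<^sup>+x. g (x + \<tau> *\<^sub>R b) * ?I (x \<bullet> b + \<tau>) * ?J x \<partial>lborel) =
        (\<integral>\<^sup>+y. g y * ?I (y \<bullet> b) * ?J (y - \<tau> *\<^sub>R b) \<partial>lborel)"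
      by (subst nn_integral_shift[of _ "\<tau> *\<^sub>R b", symmetric])
        (use b in \<open>auto simp: inner_add_left add.commute\<close>)
  qed
  also have "\<dots> = (\<integral>\<^sup>+\<tau>. \<integral>\<^sup>+y. g y * ?I (y \<bullet> b - \<tau>) \<partial>lborel \<partial>lborel)"
  proof (intro nn_integral_cong)
    fix \<tau> :: real and y :: 'a
    have "y - \<tau> *\<^sub>R b \<in> box 0 One \<longleftrightarrow> y \<bullet> b - \<tau> \<in> box 0 One" if y: "y \<in> box 0 One"
    proof -
      have "(y - \<tau> *\<^sub>R b) \<bullet> c = (if c = b then y \<bullet> b - \<tau> else y \<bullet> c)" if "c \<in> Basis" for c
        using that b by (simp add: inner_diff_left inner_Basis)
      then show ?thesis
        using y b unfolding mem_box by auto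
    qed
    then show "g y * ?I (y \<bullet> b) * ?J (y - \<tau> *\<^sub>R b) = g y * ?I (y \<bullet> b - \<tau>)"
      using unit_cube_coord[OF _ b, of y]
      by (cases "y \<in> box 0 One") (auto simp: g_def indicator_def in_unit_interval)
  qed
  also have "\<dots> = (\<integral>\<^sup>+y. \<integral>\<^sup>+\<tau>. g y * ?I (y \<bullet> b - \<tau>) \<partial>lborel \<partial>lborel)"
    by (rule lborel_pair.Fubini') measurable
  also have "\<dots> = (\<integral>\<^sup>+y. g y \<partial>lborel)"
  proof (rule nn_integral_cong)
    fix y :: 'a
    have "(\<integral>\<^sup>+\<tau>. ?I (y \<bullet> b - \<tau>) \<partial>lborel) = (\<integral>\<^sup>+\<tau>. ?I \<tau> \<partial>lborel)"
      by (subst (2) nn_integral_real_affine[of _ "-1" "y \<bullet> b"]) auto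
    also have "\<dots> = 1"
      by (simp add: emeasure_lborel_box_eq del: box_real)
    finally show "(\<integral>\<^sup>+\<tau>. g y * ?I (y \<bullet> b - \<tau>) \<partial>lborel) = g y"
      by (subst nn_integral_cmult) auto
  qed
  also have "\<dots> = (\<integral>\<^sup>+x. f x \<partial>unit_cube)"
    by (simp add: nn_integral_unit_cube g_def)
  finally show ?thesis .
qed

lemma set_coord_measurable_pair:
  "b \<in> Basis \<Longrightarrow> (\<lambda>(x, t). set_coord b x t) \<in> unit_cube \<Otimes>\<^sub>M unit_cube \<rightarrow>\<^sub>M unit_cube"
  unfolding split_beta' by (rule set_coord_measurable) auto

text \<open>A uniformly distributed point stays uniformly distributed when one of its coordinates is replaced
  by an independent uniformly distributed number. This is the form in which Fubini's theorem is used
  throughout.\<close>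

lemma distr_set_coord:
  assumes b: "b \<in> Basis"
  shows "distr (unit_cube \<Otimes>\<^sub>M unit_cube) unit_cube (\<lambda>(x, t). set_coord b x t) = unit_cube"
proof (rule measure_eqI)
  interpret sigma_finite_measure "unit_cube :: real measure" by (rule sigma_finite_unit_cube)
  note [measurable] = set_coord_measurable_pair[OF b]
  fix A assume "A \<in> sets (distr (unit_cube \<Otimes>\<^sub>M unit_cube) unit_cube (\<lambda>(x, t). set_coord b x t))"
  then have A [measurable]: "A \<in> sets unit_cube" by simp
  let ?D = "distr (unit_cube \<Otimes>\<^sub>M unit_cube) unit_cube (\<lambda>(x, t). set_coord b x t)"
  have "emeasure ?D A = (\<integral>\<^sup>+z. indicator A z \<partial>?D)"
    by simp
  also have "\<dots> = (\<integral>\<^sup>+z. indicator A (case z of (x, t) \<Rightarrow> set_coord b x t) \<partial>(unit_cube \<Otimes>\<^sub>M unit_cube))"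
    by (rule nn_integral_distr) auto
  also have "\<dots> = (\<integral>\<^sup>+x. \<integral>\<^sup>+t. indicator A (set_coord b x t) \<partial>unit_cube \<partial>unit_cube)"
    by (subst nn_integral_fst[symmetric]) auto
  also have "\<dots> = emeasure unit_cube A"
    using nn_integral_set_coord[OF b, of "indicator A"] A by simp
  finally show "emeasure ?D A = emeasure unit_cube A" .
qed simp

lemma AE_set_coord:
  fixes b :: "'a::euclidean_space"
  assumes "b \<in> Basis" "AE x in unit_cube. P x"
  shows "AE x in unit_cube. AE t in unit_cube. P (set_coord b x t)"
proof -
  interpret pair_sigma_finite "unit_cube :: 'a measure" "unit_cube :: real measure"
    by (rule pair_sigma_finite_unit_cube)
  have "AE x in distr (unit_cube \<Otimes>\<^sub>M unit_cube) unit_cube (\<lambda>(x, t). set_coord b x t). P x"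
    unfolding distr_set_coord[OF assms(1)] by (rule assms(2))
  then have "AE z in unit_cube \<Otimes>\<^sub>M unit_cube. P (case z of (x, t) \<Rightarrow> set_coord b x t)"
    by (rule AE_distrD[OF set_coord_measurable_pair[OF assms(1)]])
  then show ?thesis
    using AE_pair by fastforce
qed

lemma integral_set_coord:
  fixes f :: "'a::euclidean_space \<Rightarrow> real"
  assumes b: "b \<in> Basis" and f: "integrable unit_cube f"
  shows "(\<integral>x. \<integral>t. f (set_coord b x t) \<partial>unit_cube \<partial>unit_cube) = (\<integral>x. f x \<partial>unit_cube)"
    and "integrable unit_cube (\<lambda>x. \<integral>t. f (set_coord b x t) \<partial>unit_cube)"
    and "AE x in unit_cube. integrable unit_cube (\<lambda>t. f (set_coord b x t))"
    and "integrable (unit_cube \<Otimes>\<^sub>M unit_cube) (\<lambda>(x, t). f (set_coord b x t))"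
proof -
  interpret pair_sigma_finite "unit_cube :: 'a measure" "unit_cube :: real measure"
    by (rule pair_sigma_finite_unit_cube)
  note [measurable] = set_coord_measurable_pair[OF b]
  have f': "f \<in> borel_measurable unit_cube" using f by auto
  have "integrable (distr (unit_cube \<Otimes>\<^sub>M unit_cube) unit_cube (\<lambda>(x, t). set_coord b x t)) f"
    using f by (simp add: distr_set_coord b)
  then show int: "integrable (unit_cube \<Otimes>\<^sub>M unit_cube) (\<lambda>(x, t). f (set_coord b x t))"
    by (subst (asm) integrable_distr_eq) (use f' in \<open>auto simp: split_beta'\<close>)
  show "integrable unit_cube (\<lambda>x. \<integral>t. f (set_coord b x t) \<partial>unit_cube)"
    using integrable_fst'[OF int] by simp
  show "AE x in unit_cube. integrable unit_cube (\<lambda>t. f (set_coord b x t))"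
    using AE_integrable_fst'[OF int] by simp
  have "(\<integral>x. f x \<partial>unit_cube) =
      (\<integral>x. f x \<partial>distr (unit_cube \<Otimes>\<^sub>M unit_cube) unit_cube (\<lambda>(x, t). set_coord b x t))"
    by (simp add: distr_set_coord b)
  also have "\<dots> = (\<integral>z. f (case z of (x, t) \<Rightarrow> set_coord b x t) \<partial>(unit_cube \<Otimes>\<^sub>M unit_cube))"
    by (rule integral_distr) (use f' in auto)
  also have "\<dots> = (\<integral>x. \<integral>t. f (set_coord b x t) \<partial>unit_cube \<partial>unit_cube)"
    using integral_fst'[OF int] by (simp add: split_beta')
  finally show "(\<integral>x. \<integral>t. f (set_coord b x t) \<partial>unit_cube \<partial>unit_cube) = (\<integral>x. f x \<partial>unit_cube)" ..
qed


section \<open>One-dimensional slices of square integrable functions\<close>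

lemma square_integrable_integrable:
  fixes f :: "'a::euclidean_space \<Rightarrow> real"
  assumes "square_integrable unit_cube f"
  shows "integrable unit_cube f"
proof -
  have "square_integrable unit_cube (\<lambda>x :: 'a. 1 :: real)"
    by (simp add: square_integrable_def finite_measure.integrable_const[OF finite_measure_unit_cube])
  from square_integrable_mult[OF assms this] show ?thesis by simp
qed

lemma integrable_mult_bounded:
  fixes f g :: "'a::euclidean_space \<Rightarrow> real"
  assumes "integrable unit_cube f" "g \<in> borel_measurable unit_cube"
    "\<And>x. x \<in> box 0 One \<Longrightarrow> \<bar>g x\<bar> \<le> B"
  shows "integrable unit_cube (\<lambda>x. f x * g x)"
proof (rule Bochner_Integration.integrable_bound)
  show "integrable unit_cube (\<lambda>x. B * f x)" using assms by simp
  show "(\<lambda>x. f x * g x) \<in> borel_measurable unit_cube" using assms by auto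
  show "AE x in unit_cube. norm (f x * g x) \<le> norm (B * f x)"
  proof (rule AE_I2)
    fix x :: 'a assume "x \<in> space unit_cube"
    then have "\<bar>g x\<bar> \<le> \<bar>B\<bar>" using assms(3)[of x] by simp
    then show "norm (f x * g x) \<le> norm (B * f x)"
      using mult_right_mono[of "\<bar>g x\<bar>" "\<bar>B\<bar>" "\<bar>f x\<bar>"]
      by (simp add: abs_mult mult.commute)
  qed
qed

lemma square_integrable_iff_nn:
  assumes "f \<in> borel_measurable M"
  shows "square_integrable M f \<longleftrightarrow> (\<integral>\<^sup>+x. ennreal ((f x)\<^sup>2) \<partial>M) < \<infinity>"
  using assms by (auto simp: square_integrable_def integrable_iff_bounded)

lemma norm_abs_cube_L2:
  assumes "square_integrable unit_cube f"
  shows "(norm (abs_cube_L2 f))\<^sup>2 = (\<integral>x. (f x)\<^sup>2 \<partial>unit_cube)"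
proof -
  have "(norm (abs_cube_L2 f))\<^sup>2 = (\<integral>x. (rep (abs_cube_L2 f) x)\<^sup>2 \<partial>unit_cube)"
    by (simp add: norm_cube_L2_rep)
  also have "\<dots> = (\<integral>x. (f x)\<^sup>2 \<partial>unit_cube)"
    by (rule integral_cong_AE)
      (use assms rep_abs[OF assms] in \<open>auto simp: square_integrable_def\<close>)
  finally show ?thesis .
qed

lemma norm_abs_cube_L2_nn:
  assumes "square_integrable unit_cube f"
  shows "ennreal ((norm (abs_cube_L2 f))\<^sup>2) = (\<integral>\<^sup>+x. ennreal ((f x)\<^sup>2) \<partial>unit_cube)"
  using assms by (simp add: norm_abs_cube_L2 square_integrable_def nn_integral_eq_integral)

lemma norm_cube_L2_nn: "ennreal ((norm u)\<^sup>2) = (\<integral>\<^sup>+x. ennreal ((rep u x)\<^sup>2) \<partial>unit_cube)"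
  using square_integrable_rep[of u]
  by (simp add: norm_cube_L2_rep square_integrable_def nn_integral_eq_integral)

lemma inner_abs_cube_L2:
  assumes "square_integrable unit_cube f"
  shows "abs_cube_L2 f \<bullet> u = (\<integral>x. f x * rep u x \<partial>unit_cube)"
  unfolding inner_cube_L2.rep_eq
  by (rule integral_cong_AE)
    (use rep_abs[OF assms] square_integrable_measurable[OF assms] in auto)

definition slice :: "'a::euclidean_space \<Rightarrow> ('a \<Rightarrow> real) \<Rightarrow> 'a \<Rightarrow> real \<Rightarrow> real" where
  "slice b f x = (\<lambda>t. f (set_coord b x t))"

lemma slice_measurable:
  assumes "b \<in> Basis" "f \<in> borel_measurable unit_cube" "x \<in> box 0 One"
  shows "slice b f x \<in> borel_measurable unit_cube"
  unfolding slice_def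
  by (rule measurable_compose[OF set_coord_measurable assms(2)]) (use assms in auto)

lemma slice_measurable_pair:
  assumes "b \<in> Basis" "f \<in> borel_measurable unit_cube"
  shows "(\<lambda>(x, t). slice b f x t) \<in> borel_measurable (unit_cube \<Otimes>\<^sub>M unit_cube)"
  unfolding slice_def split_beta'
  by (rule measurable_compose[OF set_coord_measurable assms(2)]) (use assms in auto)

lemma nn_integral_slice_square:
  assumes b: "b \<in> Basis" and f: "f \<in> borel_measurable unit_cube"
  shows "(\<integral>\<^sup>+x. \<integral>\<^sup>+t. ennreal ((slice b f x t)\<^sup>2) \<partial>unit_cube \<partial>unit_cube) =
    (\<integral>\<^sup>+x. ennreal ((f x)\<^sup>2) \<partial>unit_cube)"
  unfolding slice_def
  by (rule nn_integral_set_coord[OF b, of "\<lambda>x. ennreal ((f x)\<^sup>2)"]) (use f in measurable)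

lemma AE_square_integrable_slice:
  assumes b: "b \<in> Basis" and f: "square_integrable unit_cube f"
  shows "AE x in unit_cube. square_integrable unit_cube (slice b f x)"
proof -
  interpret S: sigma_finite_measure "unit_cube :: real measure" by (rule sigma_finite_unit_cube)
  have fm: "f \<in> borel_measurable unit_cube" using f by (rule square_integrable_measurable)
  note [measurable] = slice_measurable_pair[OF b fm]
  have "(\<integral>\<^sup>+x. \<integral>\<^sup>+t. ennreal ((slice b f x t)\<^sup>2) \<partial>unit_cube \<partial>unit_cube) \<noteq> \<infinity>"
    using f by (simp add: nn_integral_slice_square[OF b fm] square_integrable_iff_nn[OF fm])
  moreover have "(\<lambda>x. \<integral>\<^sup>+t. ennreal ((slice b f x t)\<^sup>2) \<partial>unit_cube) \<in> borel_measurable unit_cube"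
    by measurable
  ultimately have "AE x in unit_cube. (\<integral>\<^sup>+t. ennreal ((slice b f x t)\<^sup>2) \<partial>unit_cube) \<noteq> \<infinity>"
    by (rule nn_integral_PInf_AE[rotated])
  moreover have "AE x in unit_cube. x \<in> box 0 One"
    by (rule AE_I2) simp
  ultimately show ?thesis
    by eventually_elim
      (simp add: square_integrable_iff_nn slice_measurable[OF b fm] less_top)
qed

lemma nn_integral_norm_slice:
  assumes b: "b \<in> Basis" and f: "square_integrable unit_cube f"
  shows "(\<integral>\<^sup>+x. ennreal ((norm (abs_cube_L2 (slice b f x)))\<^sup>2) \<partial>unit_cube) =
    (\<integral>\<^sup>+x. ennreal ((f x)\<^sup>2) \<partial>unit_cube)"
proof -
  have "(\<integral>\<^sup>+x. ennreal ((norm (abs_cube_L2 (slice b f x)))\<^sup>2) \<partial>unit_cube) =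
      (\<integral>\<^sup>+x. \<integral>\<^sup>+t. ennreal ((slice b f x t)\<^sup>2) \<partial>unit_cube \<partial>unit_cube)"
    by (rule nn_integral_cong_AE)
      (use AE_square_integrable_slice[OF assms] in eventually_elim, rule norm_abs_cube_L2_nn)
  also have "\<dots> = (\<integral>\<^sup>+x. ennreal ((f x)\<^sup>2) \<partial>unit_cube)"
    by (rule nn_integral_slice_square[OF b square_integrable_measurable[OF f]])
  finally show ?thesis .
qed

section \<open>Smooth bumps and the totality of tensor product test functions\<close>

text \<open>The smooth bump \<open>exp (- c / q)\<close> with \<open>q = (x - a) (b - x)\<close> on \<open>(a,b)\<close>, multiplied by \<open>p / q\<^sup>k\<close> for a
  polynomial \<open>p\<close>: this class is closed under differentiation, which makes all its members smooth.\<close>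

definition poly_bump :: "real \<Rightarrow> real \<Rightarrow> real \<Rightarrow> real poly \<Rightarrow> nat \<Rightarrow> real \<Rightarrow> real" where
  "poly_bump c a b p k x =
     (if a < x \<and> x < b
      then poly p x * exp (- c * inverse ((x - a) * (b - x))) * inverse ((x - a) * (b - x)) ^ k
      else 0)"

lemma power_le_fact_exp:
  assumes "0 \<le> (t::real)"
  shows "t ^ m \<le> fact m * exp t"
proof -
  have "(\<Sum>n\<in>{m}. t ^ n /\<^sub>R fact n) \<le> (\<Sum>n. t ^ n /\<^sub>R fact n)"
    by (rule sum_le_suminf) (use assms summable_exp_generic[of t] in auto)
  then have "t ^ m / fact m \<le> exp t"
    by (simp add: exp_def divide_inverse mult.commute)
  then show ?thesis
    by (simp add: divide_le_eq mult.commute)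
qed

lemma DERIV_zero_of_quadratic_bound:
  fixes f :: "real \<Rightarrow> real"
  assumes "\<And>y. \<bar>f y - f x\<bar> \<le> C * \<bar>y - x\<bar>\<^sup>2"
  shows "(f has_real_derivative 0) (at x)"
  unfolding has_field_derivative_iff
proof (rule Lim_null_comparison)
  show "\<forall>\<^sub>F y in at x. norm ((f y - f x) / (y - x)) \<le> C * \<bar>y - x\<bar>"
    unfolding eventually_at_filter
  proof (rule always_eventually, intro allI impI)
    fix y assume "y \<noteq> x"
    then show "norm ((f y - f x) / (y - x)) \<le> C * \<bar>y - x\<bar>"
      using assms[of y] by (simp add: abs_divide divide_le_eq power2_eq_square mult.assoc)
  qed
  show "((\<lambda>y. C * \<bar>y - x\<bar>) \<longlongrightarrow> 0) (at x)"
    by (auto intro!: tendsto_eq_intros)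
qed

text \<open>The exponential decay beats every power of \<open>1 / q\<close>. The spare factor \<open>q\<^sup>2\<close> makes the derivative
  vanish at the end points.\<close>

lemma poly_bump_bound:
  assumes "0 < c"
  shows "\<exists>C. \<forall>y. a < y \<and> y < b \<longrightarrow> \<bar>poly_bump c a b p k y\<bar> \<le> C * ((y - a) * (b - y))\<^sup>2"
proof -
  have "compact (poly p ` {a..b})"
    by (intro compact_continuous_image) (auto intro: continuous_intros)
  then have "bounded (poly p ` {a..b})"
    by (rule compact_imp_bounded)
  then obtain B where B: "\<And>y. y \<in> {a..b} \<Longrightarrow> \<bar>poly p y\<bar> \<le> B"
    unfolding bounded_iff by (metis imageI real_norm_def)
  let ?K = "fact (k + 2) / c ^ (k + 2)"
  have "\<bar>poly_bump c a b p k y\<bar> \<le> (B * ?K) * ((y - a) * (b - y))\<^sup>2" if y: "a < y" "y < b" for y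
  proof -
    define q where "q = (y - a) * (b - y)"
    have q: "0 < q" using y by (simp add: q_def)
    define F E where "F = (fact (k + 2) :: real)" and "E = exp (c * inverse q)"
    have E: "exp (- c * inverse q) = inverse E" "0 < E"
      by (simp_all add: E_def exp_minus)
    have "(c * inverse q) ^ (k + 2) \<le> F * E"
      unfolding F_def E_def by (rule power_le_fact_exp) (use q assms in simp)
    then have "(c * inverse q) ^ (k + 2) * q\<^sup>2 \<le> F * E * q\<^sup>2"
      by (rule mult_right_mono) simp
    also have "(c * inverse q) ^ (k + 2) * q\<^sup>2 = c ^ (k + 2) * inverse q ^ k"
      using q by (simp add: power_mult_distrib power_add power2_eq_square field_simps)
    finally have "c ^ (k + 2) * inverse q ^ k * inverse E \<le> F * E * q\<^sup>2 * inverse E"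
      by (rule mult_right_mono) (use E in simp)
    also have "F * E * q\<^sup>2 * inverse E = F * q\<^sup>2"
      using E by simp
    finally have "c ^ (k + 2) * (exp (- c * inverse q) * inverse q ^ k) \<le> F * q\<^sup>2"
      unfolding E(1) by (simp only: mult_ac)
    then have 1: "exp (- c * inverse q) * inverse q ^ k \<le> ?K * q\<^sup>2"
      using assms by (simp add: F_def field_simps del: fact_Suc power_Suc add_2_eq_Suc')
    have "\<bar>poly_bump c a b p k y\<bar> = \<bar>poly p y\<bar> * (exp (- c * inverse q) * inverse q ^ k)"
      using y q by (simp add: poly_bump_def q_def[symmetric] abs_mult)
    also have "\<dots> \<le> B * (?K * q\<^sup>2)"
      by (rule mult_mono[OF _ 1]) (use B[of y] y q assms in auto)
    finally show ?thesis by (simp add: q_def mult.assoc)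
  qed
  then show ?thesis by blast
qed

lemma poly_bump_deriv:
  assumes c: "0 < c"
  shows "\<exists>p' k'. \<forall>x. (poly_bump c a b p k has_real_derivative poly_bump c a b p' k' x) (at x)"
proof -
  define Q where "Q = [:- a, 1:] * [:b, - 1:]"
  define p' where "p' = pderiv p * Q ^ 2 + smult c (p * pderiv Q) - smult (real k) (p * pderiv Q * Q)"
  have Q: "poly Q x = (x - a) * (b - x)" for x
    by (simp add: Q_def algebra_simps)
  have "(poly_bump c a b p k has_real_derivative poly_bump c a b p' (k + 2) x) (at x)" for x
  proof (cases "a < x \<and> x < b")
    case True
    define i where "i = inverse (poly Q x)"
    have "poly Q x \<noteq> 0"
      using True by (simp add: Q)
    then have q: "poly Q x \<noteq> 0" "poly Q x * i = 1"
      by (simp_all add: i_def)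
    have k: "real k * i ^ (k - Suc 0) * i\<^sup>2 = real k * i ^ (k + 1)"
      by (cases k) (simp_all add: power2_eq_square)
    have "((\<lambda>y. poly p y * exp (- c * inverse (poly Q y)) * inverse (poly Q y) ^ k)
        has_real_derivative
        poly (pderiv p) x * exp (- c * i) * i ^ k
        + poly p x * (exp (- c * i) * (c * poly (pderiv Q) x * i\<^sup>2)) * i ^ k
        - poly p x * exp (- c * i) * (real k * i ^ (k - Suc 0) * i\<^sup>2 * poly (pderiv Q) x)) (at x)"
      by (rule derivative_eq_intros poly_DERIV refl q | simp add: i_def power2_eq_square algebra_simps q)+
    also have "poly (pderiv p) x * exp (- c * i) * i ^ k
        + poly p x * (exp (- c * i) * (c * poly (pderiv Q) x * i\<^sup>2)) * i ^ k
        - poly p x * exp (- c * i) * (real k * i ^ (k - Suc 0) * i\<^sup>2 * poly (pderiv Q) x)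
      = poly p' x * exp (- c * i) * i ^ (k + 2)"
    proof -
      have collect: "P * e * I + A * (e * (c * D * i2)) * I - A * e * (r * I1 * D) =
          (P * q\<^sup>2 + c * (A * D) - r * (A * D * q)) * e * J"
        if "I = q\<^sup>2 * J" "I1 = q * J" "i2 * I = J" for P e I A D i2 r I1 q J :: real
        using that by algebra
      have "i ^ (k + 1) = (poly Q x * i) * i ^ (k + 1)" "i ^ k = (poly Q x * i)\<^sup>2 * i ^ k"
        unfolding q(2) by simp_all
      then have "i ^ k = (poly Q x)\<^sup>2 * i ^ (k + 2)" "i ^ (k + 1) = poly Q x * i ^ (k + 2)"
          "i\<^sup>2 * i ^ k = i ^ (k + 2)"
        by (simp_all add: power_mult_distrib power2_eq_square mult_ac)
      from collect[OF this, of "poly (pderiv p) x" "exp (- c * i)" "poly p x" "poly (pderiv Q) x" "real k"]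
      show ?thesis
        unfolding k by (simp add: p'_def)
    qed
    also have "\<dots> = poly_bump c a b p' (k + 2) x"
      using True by (simp add: poly_bump_def i_def Q)
    finally have D: "((\<lambda>y. poly p y * exp (- c * inverse (poly Q y)) * inverse (poly Q y) ^ k)
        has_real_derivative poly_bump c a b p' (k + 2) x) (at x)" .
    show ?thesis
      by (rule has_field_derivative_transform_within_open[OF D, of "{a<..<b}"])
        (use True in \<open>auto simp: poly_bump_def Q\<close>)
  next
    case False
    obtain C where C: "\<And>y. a < y \<Longrightarrow> y < b \<Longrightarrow> \<bar>poly_bump c a b p k y\<bar> \<le> C * ((y - a) * (b - y))\<^sup>2"
      using poly_bump_bound[OF c] by metis
    have "\<bar>poly_bump c a b p k y - poly_bump c a b p k x\<bar> \<le> (\<bar>C\<bar> * (b - a)\<^sup>2) * \<bar>y - x\<bar>\<^sup>2" for y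
    proof (cases "a < y \<and> y < b")
      case y: True
      have "(y - a) * (b - y) \<le> (b - a) * \<bar>y - x\<bar>"
      proof (cases "x \<le> a")
        case True
        then have "(y - a) * (b - y) \<le> \<bar>y - x\<bar> * (b - a)"
          using y by (intro mult_mono) auto
        then show ?thesis by (simp add: mult.commute)
      next
        case False
        with \<open>\<not> (a < x \<and> x < b)\<close> show ?thesis
          using y by (intro mult_mono) auto
      qed
      then have "((y - a) * (b - y))\<^sup>2 \<le> ((b - a) * \<bar>y - x\<bar>)\<^sup>2"
        using y by (intro power_mono) auto
      then have "C * ((y - a) * (b - y))\<^sup>2 \<le> \<bar>C\<bar> * ((b - a) * \<bar>y - x\<bar>)\<^sup>2"
        by (intro mult_mono) auto
      moreover have "poly_bump c a b p k x = 0"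
        using False by (auto simp: poly_bump_def)
      ultimately show ?thesis
        using C[of y] y by (simp add: power_mult_distrib mult.assoc)
    next
      case False
      with \<open>\<not> (a < x \<and> x < b)\<close> show ?thesis by (auto simp: poly_bump_def)
    qed
    then have "(poly_bump c a b p k has_real_derivative 0) (at x)"
      by (rule DERIV_zero_of_quadratic_bound)
    moreover have "poly_bump c a b p' (k + 2) x = 0"
      using False by (auto simp: poly_bump_def)
    ultimately show ?thesis by simp
  qed
  then show ?thesis by blast
qed

lemma partial_deriv_real: "(f has_real_derivative D) (at x) \<Longrightarrow> partial_deriv 1 f x = D"
  unfolding partial_deriv_def has_field_derivative_def
  by (drule frechet_derivative_at) (metis mult.right_neutral)

lemma smooth_poly_bump:
  assumes c: "0 < c"
  shows "smooth (poly_bump c a b p k)"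
  unfolding smooth_def
proof (intro ballI allI)
  fix bs :: "real list" and x :: real
  assume bs: "bs \<in> lists Basis"
  have "\<exists>p' k'. foldr partial_deriv bs (poly_bump c a b p k) = poly_bump c a b p' k'"
    using bs
  proof (induction bs)
    case (Cons b' bs)
    then obtain p1 k1 where 1: "foldr partial_deriv bs (poly_bump c a b p k) = poly_bump c a b p1 k1"
      by auto
    obtain p2 k2 where 2: "\<And>x. (poly_bump c a b p1 k1 has_real_derivative poly_bump c a b p2 k2 x) (at x)"
      using poly_bump_deriv[OF c] by metis
    have "partial_deriv b' (poly_bump c a b p1 k1) = poly_bump c a b p2 k2"
      using Cons.hyps partial_deriv_real[OF 2] by auto
    then show ?case using 1 by auto
  qed auto
  then obtain p1 k1 where 1: "foldr partial_deriv bs (poly_bump c a b p k) = poly_bump c a b p1 k1"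
    by blast
  show "foldr partial_deriv bs (poly_bump c a b p k) differentiable at x"
    unfolding 1 using poly_bump_deriv[OF c, of a b p1 k1] real_differentiable_def by blast
qed

lemma test_function_poly_bump:
  assumes "0 < c" "0 < a" "b < 1"
  shows "test_function (poly_bump c a b p k)"
proof -
  have sub: "closure {x. poly_bump c a b p k x \<noteq> 0} \<subseteq> {a..b}"
    by (rule closure_minimal) (auto simp: poly_bump_def split: if_splits)
  moreover have "compact (closure {x. poly_bump c a b p k x \<noteq> 0})"
    using bounded_subset[OF _ sub] by (auto simp: compact_eq_bounded_closed)
  ultimately show ?thesis
    unfolding test_function_def using smooth_poly_bump[OF assms(1)] assms
    by (auto simp: in_unit_interval)
qed


definition tensor_fun :: "('a::euclidean_space \<Rightarrow> real \<Rightarrow> real) \<Rightarrow> 'a \<Rightarrow> real" where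
  "tensor_fun h x = (\<Prod>c\<in>Basis. h c (x \<bullet> c))"

lemma smooth_real_deriv:
  assumes "smooth (f :: real \<Rightarrow> real)"
  shows "(f has_real_derivative partial_deriv 1 f x) (at x)" and "smooth (partial_deriv 1 f)"
proof -
  have "foldr partial_deriv [] f differentiable at x"
    using assms unfolding smooth_def by blast
  then obtain D where "(f has_real_derivative D) (at x)"
    using real_differentiable_def by auto
  then show "(f has_real_derivative partial_deriv 1 f x) (at x)"
    using partial_deriv_real by metis
  show "smooth (partial_deriv 1 f)"
    unfolding smooth_def
  proof (intro ballI allI)
    fix bs :: "real list" and x :: real assume "bs \<in> lists Basis"
    then have "bs @ [1] \<in> lists Basis" by auto
    then have "foldr partial_deriv (bs @ [1]) f differentiable at x"
      using assms unfolding smooth_def by blast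
    then show "foldr partial_deriv bs (partial_deriv 1 f) differentiable at x" by simp
  qed
qed

lemma smooth_real_funpow: "smooth (f :: real \<Rightarrow> real) \<Longrightarrow> smooth ((partial_deriv 1 ^^ k) f)"
  by (induction k) (auto intro: smooth_real_deriv)

lemma smooth_continuous: "smooth \<phi> \<Longrightarrow> continuous_on A \<phi>"
proof -
  assume "smooth \<phi>"
  then have "foldr partial_deriv [] \<phi> differentiable at x" for x
    unfolding smooth_def by blast
  then show ?thesis
    by (auto intro!: continuous_at_imp_continuous_on differentiable_imp_continuous_within)
qed

lemma tensor_fun_has_derivative:
  assumes "\<And>c. c \<in> Basis \<Longrightarrow> smooth (h c)"
  shows "(tensor_fun h has_derivative
    (\<lambda>y. \<Sum>c\<in>Basis. (partial_deriv 1 (h c) (x \<bullet> c) * (y \<bullet> c)) * (\<Prod>c'\<in>Basis - {c}. h c' (x \<bullet> c')))) (at x)"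
  unfolding tensor_fun_def
proof (rule has_derivative_prod)
  fix c :: 'a assume c: "c \<in> Basis"
  have "(h c has_derivative (*) (partial_deriv 1 (h c) (x \<bullet> c))) (at (x \<bullet> c))"
    using smooth_real_deriv(1)[OF assms[OF c]] by (simp add: has_field_derivative_def)
  moreover have "((\<lambda>x. x \<bullet> c) has_derivative (\<lambda>y. y \<bullet> c)) (at x)"
    by (auto intro!: derivative_eq_intros)
  ultimately show "((\<lambda>x. h c (x \<bullet> c)) has_derivative (\<lambda>y. partial_deriv 1 (h c) (x \<bullet> c) * (y \<bullet> c))) (at x)"
    by (rule has_derivative_compose[rotated])
qed

lemma partial_deriv_tensor_fun:
  assumes "\<And>c. c \<in> Basis \<Longrightarrow> smooth (h c)" and b: "b \<in> Basis"
  shows "partial_deriv b (tensor_fun h) = tensor_fun (h(b := partial_deriv 1 (h b)))"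
proof
  fix x
  have "partial_deriv b (tensor_fun h) x =
      (\<Sum>c\<in>Basis. (partial_deriv 1 (h c) (x \<bullet> c) * (b \<bullet> c)) * (\<Prod>c'\<in>Basis - {c}. h c' (x \<bullet> c')))"
    using fun_cong[OF frechet_derivative_at[OF tensor_fun_has_derivative[OF assms(1)]], of _ _ b]
    unfolding partial_deriv_def[of b] by simp
  also have "\<dots> = (\<Sum>c\<in>Basis. if c = b then
      partial_deriv 1 (h b) (x \<bullet> b) * (\<Prod>c'\<in>Basis - {b}. h c' (x \<bullet> c')) else 0)"
    by (rule sum.cong) (use b in \<open>auto simp: inner_Basis\<close>)
  also have "\<dots> = partial_deriv 1 (h b) (x \<bullet> b) * (\<Prod>c'\<in>Basis - {b}. h c' (x \<bullet> c'))"
    using b by simp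
  also have "\<dots> = tensor_fun (h(b := partial_deriv 1 (h b))) x"
    unfolding tensor_fun_def by (subst prod.remove[OF finite_Basis b]) (auto intro!: prod.cong)
  finally show "partial_deriv b (tensor_fun h) x = tensor_fun (h(b := partial_deriv 1 (h b))) x" .
qed

lemma funpow_partial_deriv_tensor_fun:
  assumes "\<And>c. c \<in> Basis \<Longrightarrow> smooth (h c)" and b: "b \<in> Basis"
  shows "(partial_deriv b ^^ k) (tensor_fun h) = tensor_fun (h(b := (partial_deriv 1 ^^ k) (h b)))"
proof (induction k)
  case (Suc k)
  let ?h = "h(b := (partial_deriv 1 ^^ k) (h b))"
  have "smooth (?h c)" if "c \<in> Basis" for c
    using assms that by (auto intro: smooth_real_funpow)
  from partial_deriv_tensor_fun[of ?h, OF this b] Suc show ?case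
    by (simp del: fun_upd_apply) (simp add: fun_upd_def)
qed simp

lemma smooth_tensor_fun:
  fixes h :: "'a::euclidean_space \<Rightarrow> real \<Rightarrow> real"
  assumes "\<And>c. c \<in> Basis \<Longrightarrow> smooth (h c)"
  shows "smooth (tensor_fun h)"
  unfolding smooth_def
proof (intro ballI allI)
  fix bs :: "'a list" and x :: 'a
  assume bs: "bs \<in> lists Basis"
  have "\<exists>h'. (\<forall>c\<in>Basis. smooth (h' c)) \<and> foldr partial_deriv bs (tensor_fun h) = tensor_fun h'"
    using bs
  proof (induction bs)
    case Nil
    then show ?case using assms by auto
  next
    case (Cons b bs)
    then obtain h' where h': "\<forall>c\<in>Basis. smooth (h' c)"
        "foldr partial_deriv bs (tensor_fun h) = tensor_fun h'"
      by auto
    have "foldr partial_deriv (b # bs) (tensor_fun h) = tensor_fun (h'(b := partial_deriv 1 (h' b)))"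
      using h' Cons.hyps by (simp add: partial_deriv_tensor_fun)
    moreover have "\<forall>c\<in>Basis. smooth ((h'(b := partial_deriv 1 (h' b))) c)"
      using h' Cons.hyps by (auto intro: smooth_real_deriv)
    ultimately show ?case by blast
  qed
  then obtain h' where "\<forall>c\<in>Basis. smooth (h' c)"
    "foldr partial_deriv bs (tensor_fun h) = tensor_fun h'"
    by blast
  then show "foldr partial_deriv bs (tensor_fun h) differentiable at x"
    using tensor_fun_has_derivative[of h' x] unfolding differentiable_def by auto
qed

lemma test_function_tensor_fun:
  fixes h :: "'a::euclidean_space \<Rightarrow> real \<Rightarrow> real"
  assumes "\<And>c. c \<in> Basis \<Longrightarrow> test_function (h c)"
  shows "test_function (tensor_fun h)"
proof -
  let ?K = "\<Inter>c\<in>Basis. (\<lambda>x. x \<bullet> c) -` closure {t. h c t \<noteq> 0}"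
  have "{x. tensor_fun h x \<noteq> 0} \<subseteq> ?K"
    using closure_subset by (fastforce simp: tensor_fun_def)
  moreover have "closed ?K"
    by (intro closed_INT ballI closed_vimage) (auto intro: continuous_intros)
  ultimately have sub: "closure {x. tensor_fun h x \<noteq> 0} \<subseteq> ?K"
    by (rule closure_minimal)
  have K: "?K \<subseteq> box 0 One"
  proof
    fix x assume x: "x \<in> ?K"
    have "0 < x \<bullet> c \<and> x \<bullet> c < 1" if c: "c \<in> Basis" for c
    proof -
      have "x \<bullet> c \<in> closure {t. h c t \<noteq> 0}"
        using x c by auto
      then have "x \<bullet> c \<in> box 0 One"
        using assms[OF c] unfolding test_function_def by blast
      then show ?thesis by (simp add: in_unit_interval)
    qed
    then show "x \<in> box 0 One" by (simp add: mem_box)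
  qed
  have "compact (closure {x. tensor_fun h x \<noteq> 0})"
    using bounded_subset[OF bounded_box subset_trans[OF sub K]]
    by (simp add: compact_eq_bounded_closed)
  then show ?thesis
    unfolding test_function_def
    using smooth_tensor_fun[of h] assms sub K by (auto simp: test_function_def)
qed

lemma tensor_fun_measurable:
  assumes "\<And>c. c \<in> Basis \<Longrightarrow> h c \<in> borel_measurable borel"
  shows "tensor_fun h \<in> borel_measurable borel"
  unfolding tensor_fun_def
  by (rule borel_measurable_prod, rule measurable_compose[OF _ assms]) auto

text \<open>As \<open>n\<close> grows, the supports exhaust \<open>(a,b) \<inter> (0,1)\<close> from inside and the exponent tends to
  \<open>0\<close>, so these test functions converge to the indicator function of the interval.\<close>

definition bump_seq :: "real \<Rightarrow> real \<Rightarrow> nat \<Rightarrow> real \<Rightarrow> real" where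
  "bump_seq a b n =
     poly_bump (1 / real (n + 2)) (max a (1 / real (n + 2))) (min b (1 - 1 / real (n + 2))) 1 0"

lemma bump_seq_bounds: "0 \<le> bump_seq a b n x" "bump_seq a b n x \<le> 1"
  by (auto simp: bump_seq_def poly_bump_def)

lemma test_function_bump_seq: "test_function (bump_seq a b n)"
  unfolding bump_seq_def by (rule test_function_poly_bump) (auto simp: less_max_iff_disj min_less_iff_disj)

lemma test_function_measurable: "test_function (f :: real \<Rightarrow> real) \<Longrightarrow> f \<in> borel_measurable borel"
  unfolding test_function_def
  by (intro borel_measurable_continuous_onI smooth_continuous) auto

lemma bump_seq_tendsto:
  assumes x: "0 < x" "x < 1"
  shows "(\<lambda>n. bump_seq a b n x) \<longlonglongrightarrow> indicator {a<..<b} x"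
proof (cases "a < x \<and> x < b")
  case False
  then have "bump_seq a b n x = 0" for n
    by (auto simp: bump_seq_def poly_bump_def)
  then show ?thesis using False by (auto simp: indicator_def)
next
  case True
  define d where "d n = 1 / real (n + 2)" for n
  have d: "d \<longlonglongrightarrow> 0"
    unfolding d_def using LIMSEQ_ignore_initial_segment[OF lim_inverse_n', of 2] by simp
  have "(\<lambda>n. exp (- d n * inverse ((x - max a (d n)) * (min b (1 - d n) - x)))) \<longlonglongrightarrow>
      exp (- 0 * inverse ((x - max a 0) * (min b (1 - 0) - x)))"
    by (intro tendsto_intros d) (use True x in auto)
  moreover have "\<forall>\<^sub>F n in sequentially.
      exp (- d n * inverse ((x - max a (d n)) * (min b (1 - d n) - x))) = bump_seq a b n x"
  proof -
    have "\<forall>\<^sub>F n in sequentially. d n < x" "\<forall>\<^sub>F n in sequentially. d n < 1 - x"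
      using order_tendstoD(2)[OF d] x by auto
    then show ?thesis
      by eventually_elim (use True in \<open>auto simp: bump_seq_def poly_bump_def d_def\<close>)
  qed
  ultimately show ?thesis
    using True by (auto intro: Lim_transform_eventually)
qed

text \<open>Bounded pointwise approximation of the indicator functions of boxes carries the hypothesis
  over to boxes, and boxes are an intersection stable generator of the Borel sets.\<close>

lemma tensor_test_functions_total:
  fixes w :: "'a::euclidean_space \<Rightarrow> real"
  assumes w: "integrable unit_cube w"
    and zero: "\<And>h. (\<And>c. c \<in> Basis \<Longrightarrow> test_function (h c)) \<Longrightarrow>
      (\<integral>x. w x * tensor_fun h x \<partial>unit_cube) = 0"
  shows "AE x in unit_cube. w x = 0"
proof -
  have wm [measurable]: "w \<in> borel_measurable unit_cube" using w by auto
  have box: "(\<integral>x. w x * indicator (box l u) x \<partial>unit_cube) = 0" for l u :: 'a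
  proof -
    let ?h = "\<lambda>n c. bump_seq (l \<bullet> c) (u \<bullet> c) n"
    have [measurable]: "tensor_fun (?h n) \<in> borel_measurable unit_cube" for n
      by (intro borel_measurable_unit_cube tensor_fun_measurable test_function_measurable
          test_function_bump_seq)
    have indm: "(\<lambda>x. indicator (box l u) x :: real) \<in> borel_measurable unit_cube"
      by (rule borel_measurable_unit_cube) auto
    have "(\<lambda>n. \<integral>x. w x * tensor_fun (?h n) x \<partial>unit_cube) \<longlonglongrightarrow>
        (\<integral>x. w x * indicator (box l u) x \<partial>unit_cube)"
    proof (rule integral_dominated_convergence[where w = "\<lambda>x. \<bar>w x\<bar>"])
      show "(\<lambda>x. w x * indicator (box l u) x) \<in> borel_measurable unit_cube"
        using indm by auto
      show "integrable unit_cube (\<lambda>x. \<bar>w x\<bar>)" using w by simp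
      show "AE x in unit_cube. (\<lambda>n. w x * tensor_fun (?h n) x) \<longlonglongrightarrow> w x * indicator (box l u) x"
      proof (rule AE_I2)
        fix x :: 'a assume x: "x \<in> space unit_cube"
        have "(\<lambda>n. tensor_fun (?h n) x) \<longlonglongrightarrow> (\<Prod>c\<in>Basis. indicator {l \<bullet> c<..<u \<bullet> c} (x \<bullet> c))"
          unfolding tensor_fun_def
          by (intro tendsto_prod bump_seq_tendsto) (use unit_cube_coord x in auto)
        also have "(\<Prod>c\<in>Basis. indicator {l \<bullet> c<..<u \<bullet> c} (x \<bullet> c)) = (indicator (box l u) x :: real)"
        proof (cases "x \<in> box l u")
          case True
          then show ?thesis by (simp add: mem_box)
        next
          case False
          then obtain c where "c \<in> Basis" "x \<bullet> c \<notin> {l \<bullet> c<..<u \<bullet> c}"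
            by (auto simp: mem_box)
          then have "(\<Prod>c\<in>Basis. indicator {l \<bullet> c<..<u \<bullet> c} (x \<bullet> c)) = (0 :: real)"
            by (intro prod_zero) (auto intro!: bexI[of _ c])
          then show ?thesis using False by simp
        qed
        finally show "(\<lambda>n. w x * tensor_fun (?h n) x) \<longlonglongrightarrow> w x * indicator (box l u) x"
          by (intro tendsto_mult tendsto_const)
      qed
      show "AE x in unit_cube. norm (w x * tensor_fun (?h n) x) \<le> \<bar>w x\<bar>" for n
      proof (rule AE_I2)
        fix x :: 'a
        have "0 \<le> tensor_fun (?h n) x" "tensor_fun (?h n) x \<le> 1"
          unfolding tensor_fun_def using bump_seq_bounds by (auto intro: prod_nonneg prod_le_1)
        then show "norm (w x * tensor_fun (?h n) x) \<le> \<bar>w x\<bar>"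
          by (simp add: abs_mult mult_left_le)
      qed
    qed auto
    moreover have "(\<integral>x. w x * tensor_fun (?h n) x \<partial>unit_cube) = 0" for n
      by (rule zero) (rule test_function_bump_seq)
    ultimately show ?thesis
      by (simp add: LIMSEQ_const_iff)
  qed
  have all: "(\<integral>x. w x * indicator A x \<partial>unit_cube) = 0" if "A \<in> sets borel" for A :: "'a set"
  proof -
    have int: "integrable unit_cube (\<lambda>x. w x * indicator A x)" if "A \<in> sets borel" for A :: "'a set"
      by (rule integrable_mult_bounded[OF w, where B = 1])
        (use that borel_measurable_unit_cube[of "indicator A :: 'a \<Rightarrow> real"] in \<open>auto simp: indicator_def\<close>)
    have gen: "sets (borel :: 'a measure) = sigma_sets UNIV (range (\<lambda>(a, b). box a b))"
      by (subst borel_eq_box) simp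
    have "Int_stable (range (\<lambda>(a, b). box a b :: 'a set))"
      by (auto simp: Int_stable_def box_Int_box)
    moreover have "range (\<lambda>(a, b). box a b :: 'a set) \<subseteq> Pow UNIV"
      by simp
    ultimately show ?thesis
      using that[unfolded gen]
    proof (induction rule: sigma_sets_induct_disjoint)
      case (compl A)
      then have A: "A \<in> sets borel" by (simp add: gen)
      have "(\<integral>x. w x * indicator (UNIV - A) x \<partial>unit_cube) =
          (\<integral>x. w x * indicator (box 0 One) x - w x * indicator A x \<partial>unit_cube)"
        by (rule Bochner_Integration.integral_cong) (auto simp: indicator_def)
      also have "\<dots> = 0"
        using box[of 0 One] int[OF A] int[of "box 0 One"] compl by simp
      finally show ?case .
    next
      case (union A)
      then have A: "A i \<in> sets borel" for i by (auto simp: gen)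
      have "(\<lambda>n. \<integral>x. w x * indicator (\<Union>i<n. A i) x \<partial>unit_cube) \<longlonglongrightarrow>
          (\<integral>x. w x * indicator (\<Union>i. A i) x \<partial>unit_cube)"
      proof (rule integral_dominated_convergence[where w = "\<lambda>x. \<bar>w x\<bar>"])
        show "integrable unit_cube (\<lambda>x. \<bar>w x\<bar>)" using w by simp
        show "(\<lambda>x. w x * indicator (\<Union>i. A i) x) \<in> borel_measurable unit_cube"
          using int[of "\<Union>i. A i"] A by (intro borel_measurable_integrable) auto
        show "(\<lambda>x. w x * indicator (\<Union>i<n. A i) x) \<in> borel_measurable unit_cube" for n
          using int[of "\<Union>i<n. A i"] A by (intro borel_measurable_integrable) auto
        show "AE x in unit_cube. (\<lambda>n. w x * indicator (\<Union>i<n. A i) x) \<longlonglongrightarrow> w x * indicator (\<Union>i. A i) x"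
          by (intro AE_I2 tendsto_mult tendsto_const LIMSEQ_indicator_UN)
        show "AE x in unit_cube. norm (w x * indicator (\<Union>i<n. A i) x) \<le> \<bar>w x\<bar>" for n
          by (intro AE_I2) (auto simp: indicator_def)
      qed
      moreover have "(\<integral>x. w x * indicator (\<Union>i<n. A i) x \<partial>unit_cube) = 0" for n
      proof (induction n)
        case (Suc n)
        have "indicator (\<Union>i<Suc n. A i) x = indicator (\<Union>i<n. A i) x + (indicator (A n) x :: real)" for x
        proof -
          have "x \<notin> A i" if "x \<in> A n" "i < n" for i
            using union(1) that unfolding disjoint_family_on_def by (metis UNIV_I disjoint_iff less_irrefl)
          then show ?thesis by (auto simp: indicator_def lessThan_Suc)
        qed
        then have "(\<integral>x. w x * indicator (\<Union>i<Suc n. A i) x \<partial>unit_cube) =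
            (\<integral>x. w x * indicator (\<Union>i<n. A i) x + w x * indicator (A n) x \<partial>unit_cube)"
          by (simp add: distrib_left)
        also have "\<dots> = 0"
          using Suc union(3)[of n] int[OF A[of n]] int[of "\<Union>i<n. A i"] A by simp
        finally show ?case .
      qed simp
      ultimately show ?case
        by (simp add: LIMSEQ_const_iff)
    qed (use box in auto)
  qed
  show ?thesis
  proof (rule density_unique_real[OF w, of "\<lambda>x. 0"])
    fix A :: "'a set" assume "A \<in> sets unit_cube"
    then have "A \<in> sets borel"
      by (auto simp: unit_cube_def sets_restrict_space)
    from all[OF this]
    show "set_lebesgue_integral unit_cube A w = set_lebesgue_integral unit_cube A (\<lambda>x. 0)"
      by (simp add: set_lebesgue_integral_def mult.commute)
  qed simp
qed


section \<open>Weak derivatives of slices\<close>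

definition single_index :: "'a \<Rightarrow> nat \<Rightarrow> 'a \<Rightarrow> nat" where
  "single_index b k = (\<lambda>c. if c = b then k else 0)"

lemma sum_single_index [simp]: "b \<in> Basis \<Longrightarrow> sum (single_index b k) Basis = k"
  by (simp add: single_index_def)

lemma single_index_in_multi_indices: "b \<in> Basis \<Longrightarrow> single_index b k \<in> multi_indices k"
  by (auto simp: multi_indices_def) (auto simp: single_index_def)

lemma multi_indices_real: "(multi_indices k :: (real \<Rightarrow> nat) set) = {single_index 1 k}"
  by (auto simp: multi_indices_def single_index_def)

lemma multi_deriv_single_index:
  fixes b :: "'a::euclidean_space"
  assumes b: "b \<in> Basis"
  shows "multi_deriv (single_index b k) \<phi> = (partial_deriv b ^^ k) \<phi>"
proof -
  have fold: "foldr (\<lambda>c. partial_deriv c ^^ single_index b k c) bs \<phi> =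
      (if b \<in> set bs then (partial_deriv b ^^ k) \<phi> else \<phi>)" if "distinct bs" for bs :: "'a list"
    using that by (induction bs) (auto simp: single_index_def)
  have "\<exists>bs :: 'a list. distinct bs \<and> set bs = Basis"
    using finite_distinct_list[OF finite_Basis] by auto
  then have "distinct (basis_list :: 'a list) \<and> set (basis_list :: 'a list) = Basis"
    unfolding basis_list_def by (rule someI_ex)
  then show ?thesis
    unfolding multi_deriv_def using fold[of basis_list] b by simp
qed

lemma continuous_bounded_on_cube:
  fixes \<phi> :: "'a::euclidean_space \<Rightarrow> real"
  assumes "continuous_on UNIV \<phi>"
  obtains B where "\<And>x. x \<in> box 0 One \<Longrightarrow> \<bar>\<phi> x\<bar> \<le> B"
proof -
  have "bounded (\<phi> ` cbox 0 One)"
    using assms by (intro compact_imp_bounded compact_continuous_image) (auto intro: continuous_on_subset)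
  then obtain B where B: "\<And>x. x \<in> cbox 0 One \<Longrightarrow> \<bar>\<phi> x\<bar> \<le> B"
    unfolding bounded_iff by (metis imageI real_norm_def)
  show ?thesis
    by (rule that[of B]) (use B box_subset_cbox in blast)
qed

lemma integrable_mult_continuous:
  fixes f \<phi> :: "'a::euclidean_space \<Rightarrow> real"
  assumes "integrable unit_cube f" "continuous_on UNIV \<phi>"
  shows "integrable unit_cube (\<lambda>x. f x * \<phi> x)"
proof -
  obtain B where "\<And>x. x \<in> box 0 One \<Longrightarrow> \<bar>\<phi> x\<bar> \<le> B"
    using continuous_bounded_on_cube[OF assms(2)] by blast
  then show ?thesis
    by (intro integrable_mult_bounded[OF assms(1)] borel_measurable_unit_cube
        borel_measurable_continuous_onI assms(2))
qed

lemma test_function_continuous: "test_function \<phi> \<Longrightarrow> continuous_on A \<phi>"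
  by (simp add: test_function_def smooth_continuous)

lemma integrable_rep: "integrable unit_cube (rep u)"
  by (rule square_integrable_integrable[OF square_integrable_rep])

lemma weak_deriv_unique:
  assumes "is_weak_deriv \<beta> u v" "is_weak_deriv \<beta> u v'"
  shows "v = v'"
proof -
  have "AE x in unit_cube. rep v x - rep v' x = 0"
  proof (rule tensor_test_functions_total)
    show "integrable unit_cube (\<lambda>x. rep v x - rep v' x)"
      by (simp add: integrable_rep)
    fix h :: "'a \<Rightarrow> real \<Rightarrow> real" assume "\<And>c. c \<in> Basis \<Longrightarrow> test_function (h c)"
    then have t: "test_function (tensor_fun h)"
      by (rule test_function_tensor_fun)
    have "(\<integral>x. rep v x * tensor_fun h x \<partial>unit_cube) = (\<integral>x. rep v' x * tensor_fun h x \<partial>unit_cube)"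
      using assms t unfolding is_weak_deriv_def by force
    then show "(\<integral>x. (rep v x - rep v' x) * tensor_fun h x \<partial>unit_cube) = 0"
      using t by (simp add: left_diff_distrib integrable_mult_continuous integrable_rep
          test_function_continuous)
  qed
  then show ?thesis by (simp add: cube_L2_eq_iff)
qed

lemma weak_deriv_eqI: "is_weak_deriv \<beta> u v \<Longrightarrow> weak_deriv \<beta> u = v"
  unfolding weak_deriv_def by (rule some_equality) (auto intro: weak_deriv_unique)

lemma tensor_fun_split:
  assumes "b \<in> Basis"
  shows "tensor_fun h x = h b (x \<bullet> b) * (\<Prod>c\<in>Basis - {b}. h c (x \<bullet> c))"
  unfolding tensor_fun_def by (rule prod.remove) (use assms in auto)

text \<open>The difference of the two sides is a function \<open>w\<close> of \<open>x\<close> that does not depend on the coordinate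
  \<open>b\<close>. Testing the weak derivative on the cube against \<open>\<phi>(x\<^sub>b) \<Prod>\<^sub>c h\<^sub>c(x\<^sub>c)\<close>, where \<open>c\<close> runs over the
  other coordinates, shows that \<open>w\<close> is orthogonal to \<open>\<Prod>\<^sub>c h\<^sub>c(x\<^sub>c)\<close>, and hence to all tensor products of
  test functions.\<close>

lemma AE_slice_weak_deriv_test:
  fixes u v :: "'a::euclidean_space cube_L2"
  assumes b: "b \<in> Basis" and wd: "is_weak_deriv (single_index b k) u v"
    and \<phi>: "test_function (\<phi> :: real \<Rightarrow> real)"
  shows "AE x in unit_cube.
    (\<integral>t. slice b (rep u) x t * (partial_deriv 1 ^^ k) \<phi> t \<partial>unit_cube) =
    (-1) ^ k * (\<integral>t. slice b (rep v) x t * \<phi> t \<partial>unit_cube)"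
proof -
  let ?\<phi>k = "(partial_deriv 1 ^^ k) \<phi>"
  have c: "continuous_on A ?\<phi>k" "continuous_on A \<phi>" for A
    using \<phi> by (auto simp: test_function_def intro!: smooth_continuous smooth_real_funpow)
  have cb: "continuous_on UNIV (\<lambda>x :: 'a. ?\<phi>k (x \<bullet> b))" "continuous_on UNIV (\<lambda>x :: 'a. \<phi> (x \<bullet> b))"
    by (rule continuous_on_compose2[OF c(1)[of UNIV]] continuous_on_compose2[OF c(2)[of UNIV]];
        auto intro!: continuous_intros)+
  define g where "g x = rep u x * ?\<phi>k (x \<bullet> b) - (-1) ^ k * (rep v x * \<phi> (x \<bullet> b))" for x
  define w where "w x = (\<integral>t. g (set_coord b x t) \<partial>unit_cube)" for x
  have g: "integrable unit_cube g"
    unfolding g_def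
    by (intro Bochner_Integration.integrable_diff integrable_mult_right integrable_mult_continuous
        integrable_rep cb)
  have w: "integrable unit_cube w"
    unfolding w_def by (rule integral_set_coord(2)[OF b g])
  have w_upd: "w (set_coord b x t) = w x" for x t
    by (simp add: w_def b)
  have "AE x in unit_cube. w x = 0"
  proof (rule tensor_test_functions_total[OF w])
    fix h :: "'a \<Rightarrow> real \<Rightarrow> real" assume h: "\<And>c. c \<in> Basis \<Longrightarrow> test_function (h c)"
    define E where "E x = (\<Prod>c\<in>Basis - {b}. h c (x \<bullet> c))" for x
    have E_upd: "E (set_coord b x t) = E x" for x t
      unfolding E_def by (intro prod.cong) (auto simp: set_coord_inner b)
    have hc: "continuous_on UNIV (\<lambda>x :: 'a. h c (x \<bullet> c))" if "c \<in> Basis" for c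
      by (rule continuous_on_compose2[OF test_function_continuous[OF h[OF that], of UNIV]])
        (auto intro!: continuous_intros)
    have E: "continuous_on UNIV E"
      unfolding E_def by (intro continuous_on_prod hc) auto
    have th: "continuous_on UNIV (tensor_fun h)"
      unfolding tensor_fun_def by (intro continuous_on_prod hc) auto
    have t1: "test_function (tensor_fun (h(b := \<phi>)))"
      by (rule test_function_tensor_fun) (use h \<phi> in auto)
    have s: "tensor_fun (h(b := f)) x = f (x \<bullet> b) * E x" for f x
      unfolding tensor_fun_split[OF b] E_def by (auto intro!: prod.cong)
    have md: "multi_deriv (single_index b k) (tensor_fun (h(b := \<phi>))) x = ?\<phi>k (x \<bullet> b) * E x" for x
    proof -
      have "smooth ((h(b := \<phi>)) c)" if "c \<in> Basis" for c
        using h[OF that] \<phi> by (auto simp: test_function_def)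
      from funpow_partial_deriv_tensor_fun[of "h(b := \<phi>)", OF this b, of k]
      show ?thesis unfolding multi_deriv_single_index[OF b] using s[of ?\<phi>k x] by simp
    qed
    have gE: "integrable unit_cube (\<lambda>x. g x * E x)"
      by (rule integrable_mult_continuous[OF g E])
    have "(\<integral>x. w x * E x \<partial>unit_cube) = (\<integral>x. \<integral>t. g (set_coord b x t) * E (set_coord b x t) \<partial>unit_cube \<partial>unit_cube)"
      by (simp add: w_def E_upd)
    also have "\<dots> = (\<integral>x. g x * E x \<partial>unit_cube)"
      by (rule integral_set_coord(1)[OF b gE])
    also have "\<dots> = (\<integral>x. rep u x * (?\<phi>k (x \<bullet> b) * E x) - (-1) ^ k * (rep v x * (\<phi> (x \<bullet> b) * E x)) \<partial>unit_cube)"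
      by (rule Bochner_Integration.integral_cong) (auto simp: g_def algebra_simps)
    also have "\<dots> = (\<integral>x. rep u x * (?\<phi>k (x \<bullet> b) * E x) \<partial>unit_cube) -
        (-1) ^ k * (\<integral>x. rep v x * (\<phi> (x \<bullet> b) * E x) \<partial>unit_cube)"
      by (subst Bochner_Integration.integral_diff)
        (auto intro!: integrable_mult_right integrable_mult_continuous integrable_rep continuous_on_mult cb E)
    also have "\<dots> = 0"
      using wd[unfolded is_weak_deriv_def, rule_format, OF t1] b by (simp add: md s)
    finally have 0: "(\<integral>x. w x * E x \<partial>unit_cube) = 0" .
    have "(\<integral>x. w x * tensor_fun h x \<partial>unit_cube) =
        (\<integral>x. \<integral>t. w (set_coord b x t) * tensor_fun h (set_coord b x t) \<partial>unit_cube \<partial>unit_cube)"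
      by (rule integral_set_coord(1)[symmetric, OF b integrable_mult_continuous[OF w th]])
    also have "\<dots> = (\<integral>x. \<integral>t. (w x * E x) * h b t \<partial>unit_cube \<partial>unit_cube)"
    proof -
      have "tensor_fun h (set_coord b x t) = h b t * E x" for x t
        using s[of "h b" "set_coord b x t"] b by (simp add: E_upd set_coord_inner)
      then show ?thesis by (simp add: w_upd mult_ac)
    qed
    also have "\<dots> = (\<integral>x. w x * E x \<partial>unit_cube) * (\<integral>t. h b t \<partial>unit_cube)"
      by simp
    finally show "(\<integral>x. w x * tensor_fun h x \<partial>unit_cube) = 0" using 0 by simp
  qed
  then show ?thesis
    using AE_square_integrable_slice[OF b square_integrable_rep[of u]]
      AE_square_integrable_slice[OF b square_integrable_rep[of v]]
  proof eventually_elim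
    case (elim x)
    have "w x = (\<integral>t. slice b (rep u) x t * ?\<phi>k t - (-1) ^ k * (slice b (rep v) x t * \<phi> t) \<partial>unit_cube)"
      by (simp add: w_def g_def slice_def b set_coord_inner)
    also have "\<dots> = (\<integral>t. slice b (rep u) x t * ?\<phi>k t \<partial>unit_cube) -
        (-1) ^ k * (\<integral>t. slice b (rep v) x t * \<phi> t \<partial>unit_cube)"
      using elim(2,3)[THEN square_integrable_integrable]
      by (subst Bochner_Integration.integral_diff)
        (auto intro!: integrable_mult_right integrable_mult_continuous c)
    finally show ?case using elim by simp
  qed
qed

definition rat_bernstein :: "rat list \<Rightarrow> real \<Rightarrow> real" where
  "rat_bernstein qs t =
     (\<Sum>k\<le>length qs - 1. of_rat (qs ! k) * Bernstein (length qs - 1) k t)"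

text \<open>Since the Bernstein polynomials of a fixed degree are nonnegative on \<open>[0,1]\<close> with sum \<open>1\<close>, rounding
  the coefficients to rational numbers changes the values by no more than the rounding error.\<close>

lemma rat_bernstein_dense:
  assumes f: "continuous_on {0..1} f" and e: "0 < (e :: real)"
  shows "\<exists>qs. \<forall>t\<in>{0..1}. \<bar>f t - rat_bernstein qs t\<bar> < e"
proof -
  obtain n where n: "\<And>t. t \<in> {0..1} \<Longrightarrow> \<bar>f t - (\<Sum>k\<le>n. f (real k / real n) * Bernstein n k t)\<bar> < e / 2"
    using Bernstein_Weierstrass[OF f, of "e / 2"] e by auto
  have "\<exists>q. \<bar>f (real k / real n) - of_rat q\<bar> \<le> e / 2" for k
  proof -
    obtain q where "f (real k / real n) < of_rat q" "of_rat q < f (real k / real n) + e / 2"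
      using of_rat_dense[of "f (real k / real n)" "f (real k / real n) + e / 2"] e by auto
    then show ?thesis by (intro exI[of _ q]) auto
  qed
  then obtain q where q: "\<And>k. \<bar>f (real k / real n) - of_rat (q k)\<bar> \<le> e / 2" by metis
  have "\<bar>f t - rat_bernstein (map q [0..<Suc n]) t\<bar> < e" if t: "t \<in> {0..1}" for t
  proof -
    have r: "rat_bernstein (map q [0..<Suc n]) t = (\<Sum>k\<le>n. of_rat (q k) * Bernstein n k t)"
      unfolding rat_bernstein_def by (auto intro!: sum.cong simp del: upt_Suc)
    have "\<bar>(\<Sum>k\<le>n. f (real k / real n) * Bernstein n k t) - (\<Sum>k\<le>n. of_rat (q k) * Bernstein n k t)\<bar> =
        \<bar>\<Sum>k\<le>n. (f (real k / real n) - of_rat (q k)) * Bernstein n k t\<bar>"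
      by (simp add: sum_subtractf left_diff_distrib)
    also have "\<dots> \<le> (\<Sum>k\<le>n. \<bar>(f (real k / real n) - of_rat (q k)) * Bernstein n k t\<bar>)"
      by (rule sum_abs)
    also have "\<dots> \<le> (\<Sum>k\<le>n. e / 2 * Bernstein n k t)"
    proof (rule sum_mono)
      fix k
      show "\<bar>(f (real k / real n) - of_rat (q k)) * Bernstein n k t\<bar> \<le> e / 2 * Bernstein n k t"
        using mult_right_mono[OF q[of k] Bernstein_nonneg, of t n k] t
        by (simp add: abs_mult Bernstein_nonneg)
    qed
    also have "\<dots> = e / 2"
      using sum_Bernstein[of n t] by (simp only: sum_distrib_left[symmetric])
    finally show ?thesis using n[OF t] unfolding r by linarith
  qed
  then show ?thesis by blast
qed

text \<open>A function and its derivative have to be approximated by the same member of the family. A subset of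
  a separable metric space is separable: for each pair of polynomials with rational data and each
  tolerance, one member of \<open>\<Gamma>\<close> near the pair is picked, if there is one.\<close>

lemma countable_uniformly_dense_pairs:
  fixes \<Gamma> :: "'b set" and F G :: "'b \<Rightarrow> real \<Rightarrow> real"
  assumes "\<And>\<gamma>. \<gamma> \<in> \<Gamma> \<Longrightarrow> continuous_on {0..1} (F \<gamma>)" "\<And>\<gamma>. \<gamma> \<in> \<Gamma> \<Longrightarrow> continuous_on {0..1} (G \<gamma>)"
  obtains \<Phi> where "countable \<Phi>" "\<Phi> \<subseteq> \<Gamma>"
    "\<And>\<gamma> e. \<gamma> \<in> \<Gamma> \<Longrightarrow> 0 < e \<Longrightarrow>
      \<exists>\<gamma>'\<in>\<Phi>. \<forall>t\<in>{0..1}. \<bar>F \<gamma> t - F \<gamma>' t\<bar> < e \<and> \<bar>G \<gamma> t - G \<gamma>' t\<bar> < e"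
proof -
  define near where "near p q n \<gamma> \<longleftrightarrow> \<gamma> \<in> \<Gamma> \<and> (\<forall>t\<in>{0..1}.
      \<bar>F \<gamma> t - rat_bernstein p t\<bar> < 1 / real (Suc n) \<and> \<bar>G \<gamma> t - rat_bernstein q t\<bar> < 1 / real (Suc n))"
    for p q n \<gamma>
  define \<Phi> where "\<Phi> = (\<lambda>(p, q, n). SOME \<gamma>. near p q n \<gamma>) ` {(p, q, n). \<exists>\<gamma>. near p q n \<gamma>}"
  show ?thesis
  proof
    show "countable \<Phi>" unfolding \<Phi>_def by (intro countable_image) simp
    have pick: "near p q n (SOME \<gamma>. near p q n \<gamma>)" if "\<exists>\<gamma>. near p q n \<gamma>" for p q n
      using that by (rule someI_ex)
    then show "\<Phi> \<subseteq> \<Gamma>"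
      unfolding \<Phi>_def near_def by fastforce
    fix \<gamma> and e :: real assume \<gamma>: "\<gamma> \<in> \<Gamma>" and e: "0 < e"
    obtain n where n: "1 / real (Suc n) < e / 2"
      using nat_approx_posE[of "e / 2"] e by auto
    obtain p where p: "\<forall>t\<in>{0..1}. \<bar>F \<gamma> t - rat_bernstein p t\<bar> < 1 / real (Suc n)"
      using rat_bernstein_dense[OF assms(1)[OF \<gamma>], of "1 / real (Suc n)"] by auto
    obtain q where q: "\<forall>t\<in>{0..1}. \<bar>G \<gamma> t - rat_bernstein q t\<bar> < 1 / real (Suc n)"
      using rat_bernstein_dense[OF assms(2)[OF \<gamma>], of "1 / real (Suc n)"] by auto
    have ex: "\<exists>\<gamma>. near p q n \<gamma>"
      unfolding near_def using p q \<gamma> by blast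
    have "(SOME \<gamma>. near p q n \<gamma>) \<in> \<Phi>"
      unfolding \<Phi>_def using ex by (intro image_eqI[of _ _ "(p, q, n)"]) auto
    then obtain \<gamma>' where \<gamma>': "\<gamma>' \<in> \<Phi>" "near p q n \<gamma>'"
      using pick[OF ex] by blast
    moreover have "\<bar>F \<gamma> t - F \<gamma>' t\<bar> < e \<and> \<bar>G \<gamma> t - G \<gamma>' t\<bar> < e" if t: "t \<in> {0..1}" for t
      using \<gamma>'(2)[unfolded near_def, THEN conjunct2, rule_format, OF t]
        p[rule_format, OF t] q[rule_format, OF t] n by linarith
    ultimately show "\<exists>\<gamma>'\<in>\<Phi>. \<forall>t\<in>{0..1}. \<bar>F \<gamma> t - F \<gamma>' t\<bar> < e \<and> \<bar>G \<gamma> t - G \<gamma>' t\<bar> < e"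
      by blast
  qed
qed

lemma integral_mult_uniform_diff:
  fixes u \<phi> \<psi> :: "real \<Rightarrow> real"
  assumes u: "integrable unit_cube u" and c: "continuous_on UNIV \<phi>" "continuous_on UNIV \<psi>"
    and e: "\<And>t. t \<in> {0..1} \<Longrightarrow> \<bar>\<phi> t - \<psi> t\<bar> < e"
  shows "\<bar>(\<integral>t. u t * \<phi> t \<partial>unit_cube) - (\<integral>t. u t * \<psi> t \<partial>unit_cube)\<bar> \<le> e * (\<integral>t. \<bar>u t\<bar> \<partial>unit_cube)"
proof -
  have "\<bar>(\<integral>t. u t * \<phi> t \<partial>unit_cube) - (\<integral>t. u t * \<psi> t \<partial>unit_cube)\<bar> =
      \<bar>\<integral>t. u t * (\<phi> t - \<psi> t) \<partial>unit_cube\<bar>"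
    using u c by (simp add: right_diff_distrib integrable_mult_continuous)
  also have "\<dots> \<le> (\<integral>t. e * \<bar>u t\<bar> \<partial>unit_cube)"
  proof (rule order.trans[OF integral_abs_bound], rule integral_mono)
    show "integrable unit_cube (\<lambda>t. \<bar>u t * (\<phi> t - \<psi> t)\<bar>)"
      using u c by (intro integrable_abs integrable_mult_continuous) (auto intro: continuous_intros)
    fix t :: real assume "t \<in> space unit_cube"
    then have "\<bar>\<phi> t - \<psi> t\<bar> \<le> e"
      using e[of t] by (simp add: in_unit_interval less_imp_le)
    then show "\<bar>u t * (\<phi> t - \<psi> t)\<bar> \<le> e * \<bar>u t\<bar>"
      using mult_right_mono[of "\<bar>\<phi> t - \<psi> t\<bar>" e "\<bar>u t\<bar>"] by (simp add: abs_mult mult.commute)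
  qed (use u in simp)
  finally show ?thesis by simp
qed

text \<open>Outside one null set, the defining identity holds for all members of a countable family. Both of its
  sides are continuous in the test function with respect to uniform convergence of the test
  function and of its \<open>k\<close>-th derivative, so it extends to all test functions.\<close>

lemma AE_slice_weak_deriv:
  fixes u v :: "'a::euclidean_space cube_L2"
  assumes b: "b \<in> Basis" and wd: "is_weak_deriv (single_index b k) u v"
  shows "AE x in unit_cube. is_weak_deriv (single_index 1 k)
    (abs_cube_L2 (slice b (rep u) x)) (abs_cube_L2 (slice b (rep v) x))"
proof -
  let ?\<Gamma> = "{\<phi> :: real \<Rightarrow> real. test_function \<phi>}"
  let ?D = "\<lambda>\<phi> :: real \<Rightarrow> real. (partial_deriv 1 ^^ k) \<phi>"
  have c: "continuous_on A \<phi>" "continuous_on A (?D \<phi>)" if "test_function \<phi>" for A \<phi>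
    using that by (auto simp: test_function_def intro!: smooth_continuous smooth_real_funpow)
  obtain \<Phi> where \<Phi>: "countable \<Phi>" "\<Phi> \<subseteq> ?\<Gamma>"
    "\<And>\<gamma> e. \<gamma> \<in> ?\<Gamma> \<Longrightarrow> 0 < e \<Longrightarrow>
      \<exists>\<gamma>'\<in>\<Phi>. \<forall>t\<in>{0..1}. \<bar>?D \<gamma> t - ?D \<gamma>' t\<bar> < e \<and> \<bar>\<gamma> t - \<gamma>' t\<bar> < e"
    by (rule countable_uniformly_dense_pairs[of ?\<Gamma> ?D "\<lambda>\<phi>. \<phi>"]) (auto intro: c)
  have "AE x in unit_cube. \<forall>\<phi>\<in>\<Phi>.
      (\<integral>t. slice b (rep u) x t * ?D \<phi> t \<partial>unit_cube) =
      (-1) ^ k * (\<integral>t. slice b (rep v) x t * \<phi> t \<partial>unit_cube)"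
    using \<Phi>(2) by (intro AE_ball_countable' AE_slice_weak_deriv_test[OF b wd] \<Phi>(1)) auto
  then show ?thesis
    using AE_square_integrable_slice[OF b square_integrable_rep[of u]]
      AE_square_integrable_slice[OF b square_integrable_rep[of v]]
  proof eventually_elim
    case (elim x)
    let ?u = "slice b (rep u) x" and ?v = "slice b (rep v) x"
    have u: "integrable unit_cube ?u" and v: "integrable unit_cube ?v"
      using elim by (auto intro: square_integrable_integrable)
    have eq: "(\<integral>t. ?u t * ?D \<phi> t \<partial>unit_cube) = (-1) ^ k * (\<integral>t. ?v t * \<phi> t \<partial>unit_cube)"
      if \<phi>: "test_function \<phi>" for \<phi>
    proof -
      define I where "I = (\<integral>t. \<bar>?u t\<bar> \<partial>unit_cube) + (\<integral>t. \<bar>?v t\<bar> \<partial>unit_cube)"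
      have I: "0 \<le> I" by (simp add: I_def)
      define d where "d = \<bar>(\<integral>t. ?u t * ?D \<phi> t \<partial>unit_cube) - (-1) ^ k * (\<integral>t. ?v t * \<phi> t \<partial>unit_cube)\<bar>"
      have dI: "d \<le> e * I" if e: "0 < e" for e
      proof -
        obtain \<psi> where \<psi>: "\<psi> \<in> \<Phi>" "\<And>t. t \<in> {0..1} \<Longrightarrow> \<bar>?D \<phi> t - ?D \<psi> t\<bar> < e"
            "\<And>t. t \<in> {0..1} \<Longrightarrow> \<bar>\<phi> t - \<psi> t\<bar> < e"
          using \<Phi>(3)[of \<phi> e] \<phi> e by blast
        have t\<psi>: "test_function \<psi>" using \<psi>(1) \<Phi>(2) by auto
        have 1: "\<bar>(\<integral>t. ?u t * ?D \<phi> t \<partial>unit_cube) - (\<integral>t. ?u t * ?D \<psi> t \<partial>unit_cube)\<bar>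
            \<le> e * (\<integral>t. \<bar>?u t\<bar> \<partial>unit_cube)"
          by (rule integral_mult_uniform_diff[OF u c(2)[OF \<phi>] c(2)[OF t\<psi>] \<psi>(2)])
        have "\<bar>(\<integral>t. ?v t * \<phi> t \<partial>unit_cube) - (\<integral>t. ?v t * \<psi> t \<partial>unit_cube)\<bar>
            \<le> e * (\<integral>t. \<bar>?v t\<bar> \<partial>unit_cube)"
          by (rule integral_mult_uniform_diff[OF v c(1)[OF \<phi>] c(1)[OF t\<psi>] \<psi>(3)])
        then have 2: "\<bar>(-1) ^ k * (\<integral>t. ?v t * \<phi> t \<partial>unit_cube) - (-1) ^ k * (\<integral>t. ?v t * \<psi> t \<partial>unit_cube)\<bar>
            \<le> e * (\<integral>t. \<bar>?v t\<bar> \<partial>unit_cube)"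
          by (simp add: abs_mult power_abs flip: right_diff_distrib)
        have 3: "(\<integral>t. ?u t * ?D \<psi> t \<partial>unit_cube) = (-1) ^ k * (\<integral>t. ?v t * \<psi> t \<partial>unit_cube)"
          using elim \<psi>(1) by blast
        show ?thesis
          using 1 2 3 unfolding d_def I_def distrib_left by linarith
      qed
      have "d \<le> 0"
      proof (rule field_le_epsilon)
        fix e :: real assume e: "0 < e"
        then have "d \<le> e / (I + 1) * I" using I by (intro dI) simp
        also have "\<dots> \<le> e"
          using I e by (simp add: divide_le_eq)
        finally show "d \<le> 0 + e" by simp
      qed
      then show ?thesis by (simp add: d_def)
    qed
    show ?case
      unfolding is_weak_deriv_def
    proof (intro allI impI)
      fix \<phi> :: "real \<Rightarrow> real" assume \<phi>: "test_function \<phi>"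
      have one: "(1 :: real) \<in> Basis" by simp
      have [measurable]: "\<phi> \<in> borel_measurable unit_cube" "?D \<phi> \<in> borel_measurable unit_cube"
        by (intro borel_measurable_unit_cube borel_measurable_continuous_onI c \<phi>)+
      have [measurable]: "?u \<in> borel_measurable unit_cube" "?v \<in> borel_measurable unit_cube"
        using u v by auto
      have "(\<integral>t. rep (abs_cube_L2 ?u) t * ?D \<phi> t \<partial>unit_cube) = (\<integral>t. ?u t * ?D \<phi> t \<partial>unit_cube)"
        by (rule integral_cong_AE) (use rep_abs[of ?u] elim in auto)
      moreover have "(\<integral>t. rep (abs_cube_L2 ?v) t * \<phi> t \<partial>unit_cube) = (\<integral>t. ?v t * \<phi> t \<partial>unit_cube)"
        by (rule integral_cong_AE) (use rep_abs[of ?v] elim in auto)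
      ultimately show "(\<integral>t. rep (abs_cube_L2 ?u) t * multi_deriv (single_index 1 k) \<phi> t \<partial>unit_cube) =
          (-1) ^ sum (single_index (1 :: real) k) Basis * (\<integral>t. rep (abs_cube_L2 ?v) t * \<phi> t \<partial>unit_cube)"
        using eq[OF \<phi>] by (simp only: multi_deriv_single_index[OF one] sum_single_index[OF one])
    qed
  qed
qed


section \<open>The Gagliardo seminorm of slices\<close>

text \<open>The integral over the line that remains after exchanging the order of integration in
  \<open>slice_gagliardo_le\<close>; it lowers the order of the singularity by one.\<close>

lemma nn_integral_powr_tail:
  fixes s \<rho> p :: real
  assumes p: "0 < p" and \<rho>: "0 < \<rho>"
  shows "(\<integral>\<^sup>+t. (if \<rho> \<le> \<bar>s - t\<bar> then ennreal (\<bar>s - t\<bar> powr (- 1 - p)) else 0) \<partial>lborel)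
    = ennreal (2 / p * \<rho> powr (- p))"
proof -
  define f where "f \<tau> = ennreal (\<tau> powr (- 1 - p)) * indicator {\<rho>..} \<tau>" for \<tau> :: real
  have [measurable]: "f \<in> borel_measurable borel"
    unfolding f_def by measurable
  have "((\<lambda>\<tau>. - (\<tau> powr (- p)) / p) \<longlongrightarrow> - 0 / p) at_top"
    by (intro tendsto_intros tendsto_neg_powr filterlim_ident) (use p in auto)
  then have lim: "((\<lambda>\<tau>. - (\<tau> powr (- p)) / p) \<longlongrightarrow> 0) at_top" by simp
  have e: "- p - 1 = - 1 - p" by simp
  have "(\<integral>\<^sup>+\<tau>. f \<tau> \<partial>lborel) = ennreal (0 - (- (\<rho> powr (- p)) / p))"
    unfolding f_def
    by (rule nn_integral_FTC_atLeast[OF _ _ _ lim])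
      (use p \<rho> in \<open>auto intro!: derivative_eq_intros simp: e\<close>)
  then have f: "(\<integral>\<^sup>+\<tau>. f \<tau> \<partial>lborel) = ennreal (\<rho> powr (- p) / p)" by simp
  have "(\<integral>\<^sup>+t. (if \<rho> \<le> \<bar>s - t\<bar> then ennreal (\<bar>s - t\<bar> powr (- 1 - p)) else 0) \<partial>lborel) =
      (\<integral>\<^sup>+t. f (- s + t) + f (s + (- 1) * t) \<partial>lborel)"
    using \<rho> by (intro nn_integral_cong) (auto simp: f_def indicator_def abs_if)
  also have "\<dots> = (\<integral>\<^sup>+t. f (- s + t) \<partial>lborel) + (\<integral>\<^sup>+t. f (s + (- 1) * t) \<partial>lborel)"
    by (rule nn_integral_add) auto
  also have "(\<integral>\<^sup>+t. f (- s + t) \<partial>lborel) = (\<integral>\<^sup>+\<tau>. f \<tau> \<partial>lborel)"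
    by (rule nn_integral_shift) auto
  also have "(\<integral>\<^sup>+t. f (s + (- 1) * t) \<partial>lborel) = (\<integral>\<^sup>+\<tau>. f \<tau> \<partial>lborel)"
    using nn_integral_real_affine[of f "- 1" s] by simp
  finally show ?thesis
    using p by (simp add: f flip: ennreal_plus) 
qed

text \<open>The points \<open>x\<close> and \<open>set_coord b x t\<close> have distance \<open>h\<close>. In each coordinate other than \<open>b\<close>, an
  interval of length \<open>h / 2\<close> that starts at the coordinate of \<open>x\<close> and points towards the middle of
  \<open>(0,1)\<close> stays inside \<open>(0,1)\<close>; in the coordinate \<open>b\<close>, such an interval fits between the two points.
  The product of these intervals is a cube whose points are near both.\<close>

lemma cube_near_both:
  fixes x :: "'a::euclidean_space" and t h :: real
  assumes b: "b \<in> Basis" and x: "x \<in> box 0 One" and t: "t \<in> box 0 (One :: real)"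
  defines "h \<equiv> \<bar>x \<bullet> b - t\<bar>"
  shows "\<exists>l. box l (l + (h / 2) *\<^sub>R One) \<subseteq>
    {z \<in> box 0 One. norm (z - x) \<le> real DIM('a) * h \<and> norm (z - set_coord b x t) \<le> real DIM('a) * h}"
proof -
  define m where "m c = (if c = b then min (x \<bullet> b) t else if x \<bullet> c \<le> 1 / 2 then x \<bullet> c else x \<bullet> c - h / 2)" for c
  define l where "l = (\<Sum>c\<in>Basis. m c *\<^sub>R c)"
  have l: "l \<bullet> c = m c" if "c \<in> Basis" for c
    using that by (simp add: l_def)
  have xb: "0 < x \<bullet> c" "x \<bullet> c < 1" if "c \<in> Basis" for c
    using unit_cube_coord[OF x that] by auto
  have t01: "0 < t" "t < 1" using t by (auto simp: in_unit_interval)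
  have h1: "h < 1" using xb[OF b] t01 by (auto simp: h_def)
  have "z \<in> box 0 One \<and> norm (z - x) \<le> real DIM('a) * h \<and> norm (z - set_coord b x t) \<le> real DIM('a) * h"
    if z: "z \<in> box l (l + (h / 2) *\<^sub>R One)" for z
  proof -
    have zc: "m c < z \<bullet> c \<and> z \<bullet> c < m c + h / 2" if "c \<in> Basis" for c
      using z that by (auto simp: mem_box inner_add_left l)
    have 0: "0 < z \<bullet> c \<and> z \<bullet> c < 1" if c: "c \<in> Basis" for c
    proof -
      have "0 \<le> m c \<and> m c + h / 2 \<le> 1"
      proof (cases "c = b")
        case True
        have "0 \<le> min (x \<bullet> b) t \<and> min (x \<bullet> b) t + \<bar>x \<bullet> b - t\<bar> / 2 \<le> 1"
          using xb[OF b] t01 by (cases "x \<bullet> b \<le> t") (simp_all add: min_def field_simps)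
        then show ?thesis using True by (simp add: m_def h_def)
      next
        case False
        then show ?thesis
          using xb[OF c] h1 by (cases "x \<bullet> c \<le> 1 / 2") (simp_all add: m_def)
      qed
      then show ?thesis using zc[OF c] by linarith
    qed
    have "\<bar>z \<bullet> c - x \<bullet> c\<bar> \<le> h \<and> \<bar>z \<bullet> c - set_coord b x t \<bullet> c\<bar> \<le> h" if c: "c \<in> Basis" for c
    proof (cases "c = b")
      case True
      have close: "\<bar>r - s\<bar> \<le> \<bar>s - t\<bar> \<and> \<bar>r - t\<bar> \<le> \<bar>s - t\<bar>"
        if "min s t < r" "r < min s t + \<bar>s - t\<bar> / 2" for r s t :: real
      proof (cases "s \<le> t")
        case True
        then have "min s t = s" "\<bar>s - t\<bar> = t - s" by auto
        then show ?thesis using that by (simp add: abs_le_iff field_simps)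
      next
        case False
        then have "min s t = t" "\<bar>s - t\<bar> = s - t" by auto
        then show ?thesis using that by (simp add: abs_le_iff field_simps)
      qed
      show ?thesis
        using zc[OF c] close[of "x \<bullet> b" t "z \<bullet> b"] True by (simp add: m_def h_def set_coord_inner b)
    next
      case False
      have "0 \<le> h" by (simp add: h_def)
      then have "\<bar>z \<bullet> c - x \<bullet> c\<bar> \<le> h"
        using zc[OF c] False by (cases "x \<bullet> c \<le> 1 / 2") (simp_all add: m_def)
      then show ?thesis using False by (simp add: set_coord_inner b c)
    qed
    then have 1: "\<bar>(z - x) \<bullet> c\<bar> \<le> h" and 2: "\<bar>(z - set_coord b x t) \<bullet> c\<bar> \<le> h" if "c \<in> Basis" for c
      using that by (simp_all add: inner_diff_left)
    have "norm (z - x) \<le> (\<Sum>c\<in>Basis. \<bar>(z - x) \<bullet> c\<bar>)" by (rule norm_le_l1)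
    also have "\<dots> \<le> real DIM('a) * h" using 1 by (rule sum_bounded_above)
    finally have 3: "norm (z - x) \<le> real DIM('a) * h" .
    have "norm (z - set_coord b x t) \<le> (\<Sum>c\<in>Basis. \<bar>(z - set_coord b x t) \<bullet> c\<bar>)" by (rule norm_le_l1)
    also have "\<dots> \<le> real DIM('a) * h" using 2 by (rule sum_bounded_above)
    finally show ?thesis using 0 3 by (simp add: mem_box)
  qed
  then show ?thesis by blast
qed

definition local_osc :: "('a::euclidean_space \<Rightarrow> real) \<Rightarrow> 'a \<Rightarrow> real \<Rightarrow> ennreal" where
  "local_osc V x h =
     (\<integral>\<^sup>+z. (if norm (z - x) \<le> real DIM('a) * h then ennreal ((V x - V z)\<^sup>2) else 0) \<partial>unit_cube)"

lemma local_osc_measurable [measurable (raw)]: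
  fixes V :: "'a::euclidean_space \<Rightarrow> real"
  assumes V [measurable]: "V \<in> borel_measurable unit_cube"
    and f [measurable]: "f \<in> M \<rightarrow>\<^sub>M unit_cube" and g [measurable]: "g \<in> borel_measurable M"
  shows "(\<lambda>w. local_osc V (f w) (g w)) \<in> borel_measurable M"
proof -
  interpret sigma_finite_measure "unit_cube :: 'a measure" by (rule sigma_finite_unit_cube)
  have [measurable]: "f \<in> borel_measurable M"
    using measurable_compose[OF f id_measurable_unit_cube] .
  have [measurable]: "(\<lambda>w. V (f w)) \<in> borel_measurable M"
    using measurable_compose[OF f V] .
  show ?thesis unfolding local_osc_def by measurable
qed

lemma square_diff_le: "(a - c)\<^sup>2 \<le> 2 * (a - b)\<^sup>2 + 2 * (c - b)\<^sup>2" for a b c :: real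
proof -
  have "0 \<le> ((a - b) + (c - b))\<^sup>2" by simp
  then show ?thesis by (simp add: power2_eq_square algebra_simps)
qed

text \<open>For every \<open>z\<close> in the common neighbourhood, \<open>(V x - V y)\<^sup>2 \<le> 2 (V x - V z)\<^sup>2 + 2 (V y - V z)\<^sup>2\<close>;
  the factor on the left is the measure of the cube over which this is integrated.\<close>

lemma difference_le_local_osc:
  fixes x :: "'a::euclidean_space" and t h :: real
  assumes V [measurable]: "V \<in> borel_measurable unit_cube"
    and b: "b \<in> Basis" and x: "x \<in> box 0 One" and t: "t \<in> box 0 (One :: real)"
  defines "h \<equiv> \<bar>x \<bullet> b - t\<bar>" and "y \<equiv> set_coord b x t"
  shows "ennreal ((h / 2) ^ DIM('a)) * ennreal ((V x - V y)\<^sup>2) \<le> 2 * (local_osc V x h + local_osc V y h)"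
proof -
  obtain l where l: "box l (l + (h / 2) *\<^sub>R One) \<subseteq>
      {z \<in> box 0 One. norm (z - x) \<le> real DIM('a) * h \<and> norm (z - y) \<le> real DIM('a) * h}"
    using cube_near_both[OF b x t] unfolding h_def y_def by blast
  let ?B = "box l (l + (h / 2) *\<^sub>R One)"
  have B [measurable]: "?B \<in> sets unit_cube"
    using l by (auto simp: unit_cube_def sets_restrict_space_iff)
  have "emeasure unit_cube ?B = emeasure lborel ?B"
    unfolding unit_cube_def by (rule emeasure_restrict_space) (use l in auto)
  also have "\<dots> = ennreal ((h / 2) ^ DIM('a))"
    by (subst emeasure_lborel_box) (auto simp: inner_add_left h_def)
  finally have "ennreal ((h / 2) ^ DIM('a)) * ennreal ((V x - V y)\<^sup>2) =
      (\<integral>\<^sup>+z. ennreal ((V x - V y)\<^sup>2) * indicator ?B z \<partial>unit_cube)"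
    by (subst nn_integral_cmult_indicator) (auto simp: mult.commute)
  also have "\<dots> \<le> (\<integral>\<^sup>+z. 2 * ((if norm (z - x) \<le> real DIM('a) * h then ennreal ((V x - V z)\<^sup>2) else 0)
      + (if norm (z - y) \<le> real DIM('a) * h then ennreal ((V y - V z)\<^sup>2) else 0)) \<partial>unit_cube)"
  proof (rule nn_integral_mono)
    fix z :: 'a
    show "ennreal ((V x - V y)\<^sup>2) * indicator ?B z \<le>
        2 * ((if norm (z - x) \<le> real DIM('a) * h then ennreal ((V x - V z)\<^sup>2) else 0)
          + (if norm (z - y) \<le> real DIM('a) * h then ennreal ((V y - V z)\<^sup>2) else 0))"
    proof (cases "z \<in> ?B")
      case True
      have "ennreal ((V x - V y)\<^sup>2) \<le> ennreal (2 * (V x - V z)\<^sup>2 + 2 * (V y - V z)\<^sup>2)"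
        by (rule ennreal_leI[OF square_diff_le])
      also have "\<dots> = 2 * (ennreal ((V x - V z)\<^sup>2) + ennreal ((V y - V z)\<^sup>2))"
        by (simp add: ennreal_plus ennreal_mult distrib_left)
      finally show ?thesis using True l by auto
    qed simp
  qed
  also have "\<dots> = 2 * (local_osc V x h + local_osc V y h)"
    unfolding local_osc_def
    by (subst nn_integral_cmult, measurable, subst nn_integral_add) auto
  finally show ?thesis .
qed

definition slice_gagliardo :: "real \<Rightarrow> 'a::euclidean_space \<Rightarrow> ('a \<Rightarrow> real) \<Rightarrow> 'a \<Rightarrow> ennreal" where
  "slice_gagliardo \<sigma> b V x =
     (\<integral>\<^sup>+t. \<integral>\<^sup>+t'. ennreal ((slice b V x t - slice b V x t')\<^sup>2 / \<bar>t - t'\<bar> powr (1 + 2 * \<sigma>))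
        \<partial>unit_cube \<partial>unit_cube)"

lemma slice_gagliardo_measurable:
  assumes b [measurable]: "b \<in> Basis" and V: "V \<in> borel_measurable unit_cube"
  shows "slice_gagliardo \<sigma> b V \<in> borel_measurable unit_cube"
proof -
  interpret sigma_finite_measure "unit_cube :: real measure" by (rule sigma_finite_unit_cube)
  have [measurable]: "(\<lambda>z. slice b V (f z) (g z)) \<in> borel_measurable M"
    if "f \<in> M \<rightarrow>\<^sub>M unit_cube" "g \<in> M \<rightarrow>\<^sub>M unit_cube" for f g and M :: "'z measure"
    unfolding slice_def by (rule measurable_compose[OF set_coord_measurable[OF b that] V])
  show ?thesis
    unfolding slice_gagliardo_def[abs_def] by measurable
qed

lemma gagliardo_abs_slice:
  assumes "square_integrable unit_cube (slice b V x)"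
  shows "gagliardo \<sigma> (abs_cube_L2 (slice b V x)) = slice_gagliardo \<sigma> b V x"
proof -
  note ae = rep_abs[OF assms]
  have "AE t in unit_cube.
      (\<integral>\<^sup>+t'. ennreal ((rep (abs_cube_L2 (slice b V x)) t - rep (abs_cube_L2 (slice b V x)) t')\<^sup>2
        / norm (t - t') powr (real DIM(real) + 2 * \<sigma>)) \<partial>unit_cube) =
      (\<integral>\<^sup>+t'. ennreal ((slice b V x t - slice b V x t')\<^sup>2 / \<bar>t - t'\<bar> powr (1 + 2 * \<sigma>)) \<partial>unit_cube)"
    using ae
  proof eventually_elim
    case (elim t)
    show ?case
      by (rule nn_integral_cong_AE) (use ae in eventually_elim, simp add: elim)
  qed
  then show ?thesis
    unfolding gagliardo_def slice_gagliardo_def by (rule nn_integral_cong_AE)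
qed

text \<open>By \<open>difference_le_local_osc\<close> the integrand is at most a multiple of
  \<open>\<bar>t - t'\<bar>\<^bsup>- 1 - p\<^esup>\<close> times local oscillations, which are integrals over points \<open>z\<close> with
  \<open>norm (z - x) \<le> d \<bar>t - t'\<bar>\<close>. With \<open>x\<close> and \<open>z\<close> fixed, the remaining integral over \<open>t'\<close> yields
  the kernel \<open>norm (x - z)\<^bsup>- p\<^esup>\<close> of the seminorm on the cube, up to a constant.\<close>

lemma slice_gagliardo_le:
  fixes v :: "'a::euclidean_space cube_L2"
  assumes b: "b \<in> Basis" and \<sigma>: "0 < \<sigma>"
  defines "p \<equiv> real DIM('a) + 2 * \<sigma>"
  shows "(\<integral>\<^sup>+x. slice_gagliardo \<sigma> b (rep v) x \<partial>unit_cube) \<le>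
    ennreal (2 ^ (DIM('a) + 3) / p * DIM('a) powr p) * gagliardo \<sigma> v"
proof -
  define V where "V = rep v"
  define d where "d = DIM('a)"
  define W where "W x t = ennreal (\<bar>x \<bullet> b - t\<bar> powr (- 1 - p)) * local_osc V x \<bar>x \<bullet> b - t\<bar>" for x t
  have p: "0 < p" and d: "0 < d" using \<sigma> by (simp_all add: p_def d_def add_pos_pos)
  interpret sigma_finite_measure "unit_cube :: real measure" by (rule sigma_finite_unit_cube)
  interpret R: pair_sigma_finite "unit_cube :: real measure" "unit_cube :: real measure"
    by (rule pair_sigma_finite_unit_cube)
  interpret Q: pair_sigma_finite "unit_cube :: real measure" "unit_cube :: 'a measure"
    by (rule pair_sigma_finite_unit_cube)
  have [measurable]: "V \<in> borel_measurable unit_cube" by (simp add: V_def)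
  have Wm [measurable (raw)]: "(\<lambda>z. W (f z) (g z)) \<in> borel_measurable M"
    if f [measurable]: "f \<in> M \<rightarrow>\<^sub>M unit_cube" and g [measurable]: "g \<in> M \<rightarrow>\<^sub>M unit_cube" for f g and M :: "'z measure"
  proof -
    have [measurable]: "f \<in> borel_measurable M" "g \<in> borel_measurable M"
      using measurable_compose[OF f id_measurable_unit_cube] measurable_compose[OF g id_measurable_unit_cube] by auto
    show ?thesis unfolding W_def by measurable
  qed
  define c where "c = (2 :: real) ^ (d + 1)"
  \<comment> \<open>The exponents add up: \<open>h\<^bsup>- d\<^esup>\<close> from the averaging and \<open>h\<^bsup>- 1 - 2 \<sigma>\<^esup>\<close> from the kernel.\<close>
  have step1: "ennreal ((slice b V x t - slice b V x t')\<^sup>2 / \<bar>t - t'\<bar> powr (1 + 2 * \<sigma>)) \<le>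
      ennreal c * (W (set_coord b x t) t' + W (set_coord b x t') t)"
    if x: "x \<in> box 0 One" and t: "t \<in> box 0 One" and t': "t' \<in> box 0 One" for x t t'
  proof (cases "t = t'")
    case False
    define h where "h = \<bar>t - t'\<bar>"
    have h: "0 < h" using False by (simp add: h_def)
    define y where "y = set_coord b x t"
    have y: "y \<in> box 0 One" unfolding y_def by (rule set_coord_in_unit_cube[OF b x t])
    have yb: "y \<bullet> b = t" by (simp add: y_def set_coord_inner b)
    have yt': "set_coord b y t' = set_coord b x t'" by (simp add: y_def b)
    have yb': "set_coord b x t' \<bullet> b = t'" by (simp add: set_coord_inner b)
    have "ennreal ((slice b V x t - slice b V x t')\<^sup>2 / h powr (1 + 2 * \<sigma>)) =
        ennreal (2 ^ d * h powr (- 1 - p)) * (ennreal ((h / 2) ^ d) * ennreal ((V y - V (set_coord b x t'))\<^sup>2))"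
    proof -
      have "h ^ d = h powr real d" using h by (simp add: powr_realpow)
      then have "h powr (- 1 - p) * h ^ d = h powr (- 1 - p + real d)"
        by (simp add: powr_add)
      also have "\<dots> = 1 / h powr (1 + 2 * \<sigma>)"
        by (simp add: p_def d_def flip: powr_minus_divide)
      finally have "2 ^ d * h powr (- 1 - p) * ((h / 2) ^ d * (V y - V (set_coord b x t'))\<^sup>2) =
          (V y - V (set_coord b x t'))\<^sup>2 / h powr (1 + 2 * \<sigma>)"
        by (simp add: power_divide, simp only: mult.assoc[symmetric], simp)
      then show ?thesis
        unfolding slice_def y_def[symmetric] using h by (subst ennreal_mult[symmetric], simp, simp)+ simp
    qed
    also have "\<dots> \<le> ennreal (2 ^ d * h powr (- 1 - p)) * (2 * (local_osc V y h + local_osc V (set_coord b x t') h))"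
      using difference_le_local_osc[OF _ b y t', of V] by (intro mult_left_mono) (simp_all add: yb yt' h_def d_def)
    also have "\<dots> = ennreal c * (ennreal (h powr (- 1 - p)) * (local_osc V y h + local_osc V (set_coord b x t') h))"
      by (simp add: c_def ennreal_mult mult_ac distrib_left)
    also have "\<dots> = ennreal c * (W y t' + W (set_coord b x t') t)"
      by (simp add: W_def yb yb' h_def distrib_left abs_minus_commute)
    finally show ?thesis by (simp add: h_def y_def)
  qed simp
  have Wx: "(\<lambda>(t, t'). W (set_coord b x t) t') \<in> borel_measurable (unit_cube \<Otimes>\<^sub>M unit_cube)"
    "(\<lambda>(t, t'). W (set_coord b x t') t) \<in> borel_measurable (unit_cube \<Otimes>\<^sub>M unit_cube)" if "x \<in> box 0 One" for x
    unfolding split_beta' using that by (intro Wm set_coord_measurable b; simp)+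
  have "(\<integral>\<^sup>+x. slice_gagliardo \<sigma> b V x \<partial>unit_cube) \<le>
      (\<integral>\<^sup>+x. \<integral>\<^sup>+t. \<integral>\<^sup>+t'. ennreal c * (W (set_coord b x t) t' + W (set_coord b x t') t) \<partial>unit_cube \<partial>unit_cube \<partial>unit_cube)"
    unfolding slice_gagliardo_def by (intro nn_integral_mono step1) simp_all
  also have "\<dots> = (\<integral>\<^sup>+x. ennreal (2 * c) * (\<integral>\<^sup>+t. \<integral>\<^sup>+t'. W (set_coord b x t) t' \<partial>unit_cube \<partial>unit_cube) \<partial>unit_cube)"
  proof (rule nn_integral_cong)
    fix x :: 'a assume "x \<in> space unit_cube"
    then have x: "x \<in> box 0 One" by simp
    note [measurable] = Wx[OF x]
    have [measurable]: "(\<lambda>t'. W (set_coord b x t) t') \<in> borel_measurable unit_cube"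
      "(\<lambda>t'. W (set_coord b x t') t) \<in> borel_measurable unit_cube" if "t \<in> box 0 One" for t
      using that x by (intro Wm set_coord_measurable b; simp)+
    have "(\<integral>\<^sup>+t. \<integral>\<^sup>+t'. ennreal c * (W (set_coord b x t) t' + W (set_coord b x t') t) \<partial>unit_cube \<partial>unit_cube) =
        (\<integral>\<^sup>+t. ennreal c * ((\<integral>\<^sup>+t'. W (set_coord b x t) t' \<partial>unit_cube) + (\<integral>\<^sup>+t'. W (set_coord b x t') t \<partial>unit_cube)) \<partial>unit_cube)"
      by (intro nn_integral_cong) (simp add: nn_integral_cmult nn_integral_add)
    also have "\<dots> = ennreal c * ((\<integral>\<^sup>+t. \<integral>\<^sup>+t'. W (set_coord b x t) t' \<partial>unit_cube \<partial>unit_cube) +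
        (\<integral>\<^sup>+t. \<integral>\<^sup>+t'. W (set_coord b x t') t \<partial>unit_cube \<partial>unit_cube))"
      by (simp add: nn_integral_cmult nn_integral_add)
    \<comment> \<open>Both summands have the same integral, by the symmetry in \<open>t\<close> and \<open>t'\<close>.\<close>
    also have "(\<integral>\<^sup>+t. \<integral>\<^sup>+t'. W (set_coord b x t') t \<partial>unit_cube \<partial>unit_cube) =
        (\<integral>\<^sup>+t'. \<integral>\<^sup>+t. W (set_coord b x t') t \<partial>unit_cube \<partial>unit_cube)"
      by (rule R.Fubini'[of "\<lambda>t' t. W (set_coord b x t') t"]) measurable
    finally show "(\<integral>\<^sup>+t. \<integral>\<^sup>+t'. ennreal c * (W (set_coord b x t) t' + W (set_coord b x t') t) \<partial>unit_cube \<partial>unit_cube) =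
        ennreal (2 * c) * (\<integral>\<^sup>+t. \<integral>\<^sup>+t'. W (set_coord b x t) t' \<partial>unit_cube \<partial>unit_cube)"
      by (simp add: mult_2[symmetric] ennreal_mult c_def mult_ac)
  qed
  also have "\<dots> = ennreal (2 * c) * (\<integral>\<^sup>+x. \<integral>\<^sup>+t. \<integral>\<^sup>+t'. W (set_coord b x t) t' \<partial>unit_cube \<partial>unit_cube \<partial>unit_cube)"
    by (rule nn_integral_cmult) (use b in measurable)
  also have "(\<integral>\<^sup>+x. \<integral>\<^sup>+t. \<integral>\<^sup>+t'. W (set_coord b x t) t' \<partial>unit_cube \<partial>unit_cube \<partial>unit_cube) =
      (\<integral>\<^sup>+x. \<integral>\<^sup>+t'. W x t' \<partial>unit_cube \<partial>unit_cube)"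
    by (rule nn_integral_set_coord[OF b, of "\<lambda>x. \<integral>\<^sup>+t'. W x t' \<partial>unit_cube"]) measurable
  also have "\<dots> \<le> (\<integral>\<^sup>+x. \<integral>\<^sup>+z. ennreal (2 / p * d powr p) *
      ennreal ((V x - V z)\<^sup>2 / norm (x - z) powr p) \<partial>unit_cube \<partial>unit_cube)"
  proof (rule nn_integral_mono)
    fix x :: 'a assume "x \<in> space unit_cube"
    then have x: "x \<in> box 0 One" by simp
    define k where "k z t = (if norm (z - x) \<le> d * \<bar>x \<bullet> b - t\<bar> then ennreal (\<bar>x \<bullet> b - t\<bar> powr (- 1 - p)) else 0)" for z t
    have km [measurable]: "(\<lambda>(z, t). k z t) \<in> borel_measurable (unit_cube \<Otimes>\<^sub>M unit_cube)"
      unfolding k_def by measurable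
    have [measurable]: "(\<lambda>t. k z t) \<in> borel_measurable unit_cube" for z
      unfolding k_def by measurable
    have "(\<integral>\<^sup>+t. W x t \<partial>unit_cube) = (\<integral>\<^sup>+t. \<integral>\<^sup>+z. ennreal ((V x - V z)\<^sup>2) * k z t \<partial>unit_cube \<partial>unit_cube)"
      unfolding W_def local_osc_def d_def[symmetric]
      by (intro nn_integral_cong, subst nn_integral_cmult[symmetric])
        (auto intro!: nn_integral_cong simp: k_def mult.commute)
    also have "\<dots> = (\<integral>\<^sup>+z. \<integral>\<^sup>+t. ennreal ((V x - V z)\<^sup>2) * k z t \<partial>unit_cube \<partial>unit_cube)"
      by (rule Q.Fubini'[symmetric]) measurable
    also have "\<dots> \<le> (\<integral>\<^sup>+z. ennreal (2 / p * d powr p) * ennreal ((V x - V z)\<^sup>2 / norm (x - z) powr p) \<partial>unit_cube)"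
    proof (rule nn_integral_mono)
      fix z :: 'a
      show "(\<integral>\<^sup>+t. ennreal ((V x - V z)\<^sup>2) * k z t \<partial>unit_cube) \<le>
          ennreal (2 / p * d powr p) * ennreal ((V x - V z)\<^sup>2 / norm (x - z) powr p)"
      \<comment> \<open>On the diagonal both sides are \<open>0\<close> because the difference of the values vanishes.\<close>
      proof (cases "z = x")
        case False
        define \<rho> where "\<rho> = norm (z - x) / d"
        have \<rho>: "0 < \<rho>" using False d by (simp add: \<rho>_def)
        have "(\<integral>\<^sup>+t. k z t \<partial>unit_cube) \<le> (\<integral>\<^sup>+t. k z t \<partial>lborel)"
          unfolding nn_integral_unit_cube by (intro nn_integral_mono) (auto simp: indicator_def)
        also have "\<dots> = (\<integral>\<^sup>+t. (if \<rho> \<le> \<bar>x \<bullet> b - t\<bar> then ennreal (\<bar>x \<bullet> b - t\<bar> powr (- 1 - p)) else 0) \<partial>lborel)"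
          using d by (intro nn_integral_cong) (simp add: k_def \<rho>_def divide_le_eq mult.commute)
        also have "\<dots> = ennreal (2 / p * \<rho> powr (- p))"
          by (rule nn_integral_powr_tail[OF p \<rho>])
        also have "\<rho> powr (- p) = d powr p / norm (x - z) powr p"
          using d False by (simp add: \<rho>_def powr_divide powr_minus norm_minus_commute field_simps)
        finally have "ennreal ((V x - V z)\<^sup>2) * (\<integral>\<^sup>+t. k z t \<partial>unit_cube) \<le>
            ennreal ((V x - V z)\<^sup>2) * ennreal (2 / p * (d powr p / norm (x - z) powr p))"
          by (rule mult_left_mono) simp
        also have "\<dots> = ennreal (2 / p * d powr p) * ennreal ((V x - V z)\<^sup>2 / norm (x - z) powr p)"
          using p by (simp add: mult_ac flip: ennreal_mult)
        finally show ?thesis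
          by (simp add: nn_integral_cmult)
      qed simp
    qed
    finally show "(\<integral>\<^sup>+t. W x t \<partial>unit_cube) \<le>
        (\<integral>\<^sup>+z. ennreal (2 / p * d powr p) * ennreal ((V x - V z)\<^sup>2 / norm (x - z) powr p) \<partial>unit_cube)" .
  qed
  also have "\<dots> = ennreal (2 / p * d powr p) * gagliardo \<sigma> v"
    unfolding gagliardo_def V_def[symmetric] p_def[symmetric]
    by (subst nn_integral_cmult[symmetric], measurable, intro nn_integral_cong, subst nn_integral_cmult) auto
  finally have "(\<integral>\<^sup>+x. slice_gagliardo \<sigma> b V x \<partial>unit_cube) \<le>
      ennreal (2 * c) * (ennreal (2 / p * d powr p) * gagliardo \<sigma> v)"
    by (simp add: mult_left_mono)
  also have "\<dots> = ennreal (2 ^ (d + 3) / p * d powr p) * gagliardo \<sigma> v"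
    using p by (simp add: c_def mult.assoc[symmetric] power_add mult.commute[of 8] flip: ennreal_mult)
  finally show ?thesis by (simp add: V_def d_def)
qed


section \<open>Slices of Sobolev functions\<close>

lemma sobolev_norm_square:
  "(sobolev_norm s u)\<^sup>2 =
     (\<Sum>j\<le>nat \<lfloor>s\<rfloor>. \<Sum>\<beta>\<in>multi_indices j. (norm (weak_deriv \<beta> u))\<^sup>2) +
     (if frac s = 0 then 0
      else \<Sum>\<beta>\<in>multi_indices (nat \<lfloor>s\<rfloor>). enn2real (gagliardo (frac s) (weak_deriv \<beta> u)))"
  unfolding sobolev_norm_def by (rule real_sqrt_pow2) (auto intro!: add_nonneg_nonneg sum_nonneg)

lemma sobolev_norm_nonneg: "0 \<le> sobolev_norm s u"
  unfolding sobolev_norm_def by (auto intro!: add_nonneg_nonneg sum_nonneg)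

lemma is_weak_deriv_weak_deriv:
  assumes "u \<in> sobolev s" "\<beta> \<in> multi_indices j" "j \<le> nat \<lfloor>s\<rfloor>"
  shows "is_weak_deriv \<beta> u (weak_deriv \<beta> u)"
proof -
  have "\<exists>v. is_weak_deriv \<beta> u v" using assms by (auto simp: sobolev_def)
  then show ?thesis unfolding weak_deriv_def by (rule someI_ex)
qed

text \<open>The summand \<open>1\<close> accounts for the derivatives of integer order, the other one is the factor in
  \<open>slice_gagliardo_le\<close>.\<close>

definition slice_const :: "nat \<Rightarrow> real \<Rightarrow> real" where
  "slice_const d s = 1 + 2 ^ (d + 3) / (d + 2 * frac s) * d powr (d + 2 * frac s)"

lemma slice_const_ge_1: "1 \<le> slice_const d s"
  by (simp add: slice_const_def frac_ge_0)

text \<open>The weak derivatives of a slice are the slices of the pure derivatives in its direction, so its norm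
  is made of quantities whose integrals over \<open>x\<close> are terms of the norm on the cube, or are bounded by
  such terms. The majorant \<open>H\<close> is the sum of these quantities; it is measurable by construction, whereas
  the norm of a slice involves an arbitrary choice of representatives.\<close>

lemma sobolev_slice:
  fixes u :: "'a::euclidean_space cube_L2"
  assumes b: "b \<in> Basis" and u: "u \<in> sobolev s"
  obtains H where "H \<in> borel_measurable unit_cube"
    and "AE x in unit_cube. abs_cube_L2 (slice b (rep u) x) \<in> sobolev s \<and>
      ennreal ((sobolev_norm s (abs_cube_L2 (slice b (rep u) x)))\<^sup>2) \<le> H x"
    and "(\<integral>\<^sup>+x. H x \<partial>unit_cube) \<le>
      ennreal (slice_const DIM('a) s) * ennreal ((sobolev_norm s u)\<^sup>2)"
proof -
  define k where "k = nat \<lfloor>s\<rfloor>"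
  define \<sigma> where "\<sigma> = frac s"
  have \<sigma>0: "0 \<le> \<sigma>" by (simp add: \<sigma>_def frac_ge_0)
  define V where "V j = weak_deriv (single_index b j) u" for j
  define U where "U x = abs_cube_L2 (slice b (rep u) x)" for x
  define VU where "VU j x = abs_cube_L2 (slice b (rep (V j)) x)" for j x
  define Q where "Q j x = (\<integral>\<^sup>+t. ennreal ((slice b (rep (V j)) x t)\<^sup>2) \<partial>unit_cube)" for j x
  define G where "G = slice_gagliardo \<sigma> b (rep (V k))"
  define C where "C = 2 ^ (DIM('a) + 3) / (DIM('a) + 2 * \<sigma>) * DIM('a) powr (DIM('a) + 2 * \<sigma>)"
  have C: "0 \<le> C" using \<sigma>0 by (simp add: C_def)
  have sc: "slice_const DIM('a) s = 1 + C"
    by (simp add: slice_const_def C_def \<sigma>_def)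
  interpret sigma_finite_measure "unit_cube :: real measure" by (rule sigma_finite_unit_cube)
  have [measurable]: "(\<lambda>(x, t). slice b (rep (V j)) x t) \<in> borel_measurable (unit_cube \<Otimes>\<^sub>M unit_cube)" for j
    by (rule slice_measurable_pair[OF b]) measurable
  have Qm [measurable]: "Q j \<in> borel_measurable unit_cube" for j
    unfolding Q_def[abs_def] by measurable
  have Gm [measurable]: "G \<in> borel_measurable unit_cube"
    unfolding G_def by (rule slice_gagliardo_measurable[OF b]) measurable
  have gag: "gagliardo \<sigma> (V k) < \<infinity>" if "\<sigma> \<noteq> 0"
    using u single_index_in_multi_indices[OF b, of k] that
    by (auto simp: sobolev_def k_def \<sigma>_def V_def)
  have Gint: "(\<integral>\<^sup>+x. G x \<partial>unit_cube) \<le> ennreal C * gagliardo \<sigma> (V k)" if "\<sigma> \<noteq> 0"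
    unfolding G_def C_def using slice_gagliardo_le[OF b, of \<sigma> "V k"] that \<sigma>0 by simp
  have Gfin: "AE x in unit_cube. \<sigma> \<noteq> 0 \<longrightarrow> G x \<noteq> \<infinity>"
  proof (cases "\<sigma> = 0")
    case False
    have "(\<integral>\<^sup>+x. G x \<partial>unit_cube) \<noteq> \<infinity>"
      using Gint[OF False] gag[OF False] by (auto simp: top_unique ennreal_mult_eq_top_iff)
    then have "AE x in unit_cube. G x \<noteq> \<infinity>"
      by (intro nn_integral_PInf_AE) auto
    then show ?thesis by eventually_elim simp
  qed simp
  have "AE x in unit_cube. \<forall>j\<in>{..k}. is_weak_deriv (single_index 1 j) (U x) (VU j x)"
  proof (rule AE_ball_countable')
    fix j assume "j \<in> {..k}"
    then have "is_weak_deriv (single_index b j) u (V j)"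
      unfolding V_def k_def
      by (intro is_weak_deriv_weak_deriv[OF u single_index_in_multi_indices[OF b]]) simp
    then show "AE x in unit_cube. is_weak_deriv (single_index 1 j) (U x) (VU j x)"
      unfolding U_def VU_def by (rule AE_slice_weak_deriv[OF b])
  qed simp
  moreover have "AE x in unit_cube. \<forall>j\<in>{..k}. square_integrable unit_cube (slice b (rep (V j)) x)"
    by (rule AE_ball_countable') (auto intro!: AE_square_integrable_slice[OF b] square_integrable_rep)
  ultimately have ae: "AE x in unit_cube. U x \<in> sobolev s \<and>
      ennreal ((sobolev_norm s (U x))\<^sup>2) \<le> (\<Sum>j\<le>k. Q j x) + (if \<sigma> = 0 then 0 else G x)"
    using Gfin
  proof eventually_elim
    case (elim x)
    have wd: "weak_deriv (single_index 1 j) (U x) = VU j x" if "j \<le> k" for j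
      using elim that by (intro weak_deriv_eqI) auto
    have gag: "gagliardo \<sigma> (VU k x) = G x"
      unfolding VU_def G_def by (rule gagliardo_abs_slice) (use elim in auto)
    have "U x \<in> sobolev s"
      unfolding sobolev_def multi_indices_real k_def[symmetric] \<sigma>_def[symmetric]
      using elim gag wd[of k] by (auto simp: less_top)
    moreover have "ennreal ((sobolev_norm s (U x))\<^sup>2) =
        (\<Sum>j\<le>k. ennreal ((norm (VU j x))\<^sup>2)) + (if \<sigma> = 0 then 0 else ennreal (enn2real (G x)))"
      unfolding sobolev_norm_square multi_indices_real k_def[symmetric] \<sigma>_def[symmetric]
      using gag by (auto simp: wd sum_nonneg ennreal_plus sum_ennreal)
    moreover have "ennreal ((norm (VU j x))\<^sup>2) = Q j x" if "j \<le> k" for j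
      unfolding VU_def Q_def by (rule norm_abs_cube_L2_nn) (use elim that in auto)
    moreover have "(if \<sigma> = 0 then 0 else ennreal (enn2real (G x))) \<le> (if \<sigma> = 0 then 0 else G x)"
      using elim by (auto simp: less_top)
    ultimately show ?case by (simp add: add_left_mono)
  qed
  define H where "H x = (\<Sum>j\<le>k. Q j x) + (if \<sigma> = 0 then 0 else G x)" for x
  have Hm: "H \<in> borel_measurable unit_cube"
    unfolding H_def[abs_def] by measurable
  have "(\<integral>\<^sup>+x. H x \<partial>unit_cube) = (\<Sum>j\<le>k. \<integral>\<^sup>+x. Q j x \<partial>unit_cube) + (if \<sigma> = 0 then 0 else \<integral>\<^sup>+x. G x \<partial>unit_cube)"
    unfolding H_def by (subst nn_integral_add) (auto simp: nn_integral_sum)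
  also have "(\<Sum>j\<le>k. \<integral>\<^sup>+x. Q j x \<partial>unit_cube) = (\<Sum>j\<le>k. ennreal ((norm (V j))\<^sup>2))"
    unfolding Q_def norm_cube_L2_nn by (intro sum.cong refl nn_integral_slice_square[OF b]) measurable
  also have "\<dots> \<le> (\<Sum>j\<le>k. ennreal (\<Sum>\<beta>\<in>multi_indices j. (norm (weak_deriv \<beta> u))\<^sup>2))"
    unfolding V_def
    by (intro sum_mono ennreal_leI member_le_sum single_index_in_multi_indices b finite_multi_indices) auto
  also have "\<dots> = ennreal (\<Sum>j\<le>k. \<Sum>\<beta>\<in>multi_indices j. (norm (weak_deriv \<beta> u))\<^sup>2)"
    by (rule sum_ennreal) (auto intro: sum_nonneg)
  also have "(if \<sigma> = 0 then 0 else \<integral>\<^sup>+x. G x \<partial>unit_cube) \<le> ennreal C *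
      ennreal (if \<sigma> = 0 then 0 else \<Sum>\<beta>\<in>multi_indices k. enn2real (gagliardo \<sigma> (weak_deriv \<beta> u)))"
  proof (cases "\<sigma> = 0")
    case False
    have "gagliardo \<sigma> (V k) = ennreal (enn2real (gagliardo \<sigma> (V k)))"
      using gag[OF False] by (simp add: less_top)
    also have "\<dots> \<le> ennreal (\<Sum>\<beta>\<in>multi_indices k. enn2real (gagliardo \<sigma> (weak_deriv \<beta> u)))"
      unfolding V_def
      by (intro ennreal_leI member_le_sum[of _ _ "\<lambda>\<beta>. enn2real (gagliardo \<sigma> (weak_deriv \<beta> u))"]
          single_index_in_multi_indices b finite_multi_indices) auto
    finally have "ennreal C * gagliardo \<sigma> (V k) \<le>
        ennreal C * ennreal (\<Sum>\<beta>\<in>multi_indices k. enn2real (gagliardo \<sigma> (weak_deriv \<beta> u)))"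
      by (rule mult_left_mono) simp
    then show ?thesis using Gint[OF False] False by simp
  qed simp
  finally have "(\<integral>\<^sup>+x. H x \<partial>unit_cube) \<le>
      ennreal (\<Sum>j\<le>k. \<Sum>\<beta>\<in>multi_indices j. (norm (weak_deriv \<beta> u))\<^sup>2) + ennreal C *
      ennreal (if \<sigma> = 0 then 0 else \<Sum>\<beta>\<in>multi_indices k. enn2real (gagliardo \<sigma> (weak_deriv \<beta> u)))"
    by (simp add: add_mono)
  also have "\<dots> \<le> ennreal (1 + C) * ennreal ((sobolev_norm s u)\<^sup>2)"
  proof -
    have combine: "ennreal A + ennreal C * ennreal B \<le> ennreal (1 + C) * ennreal (A + B)"
      if "0 \<le> A" "0 \<le> B" for A B :: real
    proof -
      have "A + C * B \<le> (1 + C) * (A + B)"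
        using that C by (simp add: algebra_simps)
      then show ?thesis
        using that C by (simp add: ennreal_leI flip: ennreal_mult ennreal_plus)
    qed
    show ?thesis
      unfolding sobolev_norm_square k_def[symmetric] \<sigma>_def[symmetric]
      by (rule combine) (auto intro!: sum_nonneg)
  qed
  finally have "(\<integral>\<^sup>+x. H x \<partial>unit_cube) \<le> ennreal (slice_const DIM('a) s) * ennreal ((sobolev_norm s u)\<^sup>2)"
    unfolding sc .
  moreover have "AE x in unit_cube. abs_cube_L2 (slice b (rep u) x) \<in> sobolev s \<and>
      ennreal ((sobolev_norm s (abs_cube_L2 (slice b (rep u) x)))\<^sup>2) \<le> H x"
    using ae by (simp add: U_def H_def)
  ultimately show ?thesis
    using that[OF Hm] by blast
qed


section \<open>Orthogonal projections in one coordinate\<close>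

definition orthonormal :: "'a::real_inner set \<Rightarrow> bool" where
  "orthonormal B \<longleftrightarrow> finite B \<and> pairwise orthogonal B \<and> (\<forall>g\<in>B. norm g = 1)"

definition proj :: "'a::real_inner set \<Rightarrow> 'a \<Rightarrow> 'a" where
  "proj B u = (\<Sum>g\<in>B. (u \<bullet> g) *\<^sub>R g)"

lemma orthonormal_basis_exists:
  fixes U :: "'a::real_inner set"
  assumes U: "subspace U" and m: "dim U = m" "1 \<le> m"
  obtains B where "orthonormal B" "card B \<le> m" "span B = U"
proof -
  obtain B0 where B0: "B0 \<subseteq> U" "independent B0" "U \<subseteq> span B0" "card B0 = dim U"
    using basis_exists by blast
  have fin: "finite B0" using B0(4) m by (metis card.infinite not_one_le_zero)
  obtain C where C: "finite C" "card C \<le> card B0" "span C = span B0" "pairwise orthogonal C"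
    using basis_orthogonal[OF fin] by blast
  define B where "B = (\<lambda>c. c /\<^sub>R norm c) ` (C - {0})"
  have "orthonormal B"
    unfolding orthonormal_def
  proof (intro conjI ballI)
    show "finite B" using C by (simp add: B_def)
    show "pairwise orthogonal B"
      using C(4) unfolding B_def pairwise_def orthogonal_def by auto
    show "norm g = 1" if g: "g \<in> B" for g
    proof -
      obtain c where "g = c /\<^sub>R norm c" "c \<noteq> 0" using g unfolding B_def by blast
      then show ?thesis by simp
    qed
  qed
  moreover have "card B \<le> m"
  proof -
    have "card B \<le> card (C - {0})" unfolding B_def by (rule card_image_le) (use C in simp)
    also have "\<dots> \<le> card C" by (rule card_mono) (use C in auto)
    finally show ?thesis using C(2) B0(4) m by simp
  qed
  moreover have "span B = U"
  proof -
    have "span B = span C"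
    proof (rule subset_antisym; rule span_minimal)
      show "B \<subseteq> span C" by (auto simp: B_def intro: span_scale span_base)
      show "C \<subseteq> span B"
      proof
        fix c assume "c \<in> C"
        show "c \<in> span B"
        proof (cases "c = 0")
          case False
          then have "c /\<^sub>R norm c \<in> span B" using \<open>c \<in> C\<close> by (auto simp: B_def intro: span_base)
          then have "norm c *\<^sub>R (c /\<^sub>R norm c) \<in> span B" by (rule span_scale)
          then show ?thesis using False by simp
        qed (simp add: span_zero)
      qed
    qed auto
    also have "\<dots> = U" using B0 U C(3) span_minimal[OF B0(1) U] by auto
    finally show ?thesis .
  qed
  ultimately show ?thesis using that by blast
qed

lemma proj_diff: "proj B (u - v) = proj B u - proj B v"
  by (simp add: proj_def inner_diff_left scaleR_left_diff_distrib sum_subtractf)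

lemma proj_in_span: "proj B u \<in> span B"
  unfolding proj_def by (intro span_sum span_scale span_base)

lemma proj_orthogonal:
  assumes B: "orthonormal B" and w: "w \<in> span B"
  shows "(u - proj B u) \<bullet> w = 0"
proof -
  have "(u - proj B u) \<bullet> g = 0" if g: "g \<in> B" for g
  proof -
    have "proj B u \<bullet> g = (\<Sum>h\<in>B. if h = g then u \<bullet> g else 0)"
      unfolding proj_def inner_sum_left
    proof (rule sum.cong)
      fix h assume "h \<in> B"
      then show "((u \<bullet> h) *\<^sub>R h) \<bullet> g = (if h = g then u \<bullet> g else 0)"
        using B g by (auto simp: orthonormal_def pairwise_def orthogonal_def dot_square_norm)
    qed simp
    then show ?thesis using B g by (simp add: orthonormal_def inner_diff_left)
  qed
  then show ?thesis
    by (intro span_induct[OF w, of "\<lambda>w. (u - proj B u) \<bullet> w = 0"])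
      (auto simp: subspace_def inner_add_right)
qed

text \<open>With \<open>w = 0\<close> this shows that the projection is a contraction, with a general \<open>w\<close> that it is the best
  approximation.\<close>

lemma proj_pythagoras:
  assumes "orthonormal B" "w \<in> span B"
  shows "(norm (u - w))\<^sup>2 = (norm (u - proj B u))\<^sup>2 + (norm (proj B u - w))\<^sup>2"
proof -
  have "(u - proj B u) \<bullet> (proj B u - w) = 0"
    by (rule proj_orthogonal[OF assms(1)]) (intro span_diff proj_in_span assms(2))
  then have "(norm ((u - proj B u) + (proj B u - w)))\<^sup>2 = (norm (u - proj B u))\<^sup>2 + (norm (proj B u - w))\<^sup>2"
    by (intro norm_add_Pythagorean) (simp add: orthogonal_def)
  then show ?thesis by simp
qed

lemma norm_proj_le: "orthonormal B \<Longrightarrow> norm (proj B u) \<le> norm u"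
  using proj_pythagoras[of B 0 u] by - (rule power2_le_imp_le, simp_all add: span_zero)

lemma norm_diff_proj_le_infdist:
  assumes "orthonormal B"
  shows "norm (u - proj B u) \<le> infdist u (span B)"
proof -
  have ne: "span B \<noteq> {}" using span_zero by blast
  show ?thesis
    unfolding infdist_notempty[OF ne]
  proof (rule cINF_greatest[OF ne])
    fix w assume "w \<in> span B"
    from proj_pythagoras[OF assms this, of u] have "(norm (u - proj B u))\<^sup>2 \<le> (norm (u - w))\<^sup>2" by simp
    then show "norm (u - proj B u) \<le> dist u w"
      unfolding dist_norm by (rule power2_le_imp_le) simp
  qed
qed

lemma l2_rel_refl: "square_integrable unit_cube f \<Longrightarrow> l2_rel f f"
  by (simp add: l2_rel_def)

lemma abs_rep [simp]: "abs_cube_L2 (rep u) = u"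
  by (rule Quotient3_abs_rep[OF Quotient3_cube_L2])

lemma abs_diff:
  "square_integrable unit_cube f \<Longrightarrow> square_integrable unit_cube g \<Longrightarrow>
    abs_cube_L2 (\<lambda>x. f x - g x) = abs_cube_L2 f - abs_cube_L2 g"
  by (simp add: minus_cube_L2.abs_eq l2_rel_refl)

lemma abs_linear_combination:
  assumes "finite J" "\<And>j. j \<in> J \<Longrightarrow> square_integrable unit_cube (F j)"
  shows "square_integrable unit_cube (\<lambda>x. \<Sum>j\<in>J. c j * F j x) \<and>
    abs_cube_L2 (\<lambda>x. \<Sum>j\<in>J. c j * F j x) = (\<Sum>j\<in>J. c j *\<^sub>R abs_cube_L2 (F j))"
  using assms
proof induction
  case empty
  then show ?case by (simp add: square_integrable_zero zero_cube_L2.abs_eq zero_cube_L2_def)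
next
  case (insert i J)
  have 1: "square_integrable unit_cube (\<lambda>x. c i * F i x)"
    using insert.prems by (intro square_integrable_scale) simp
  have "abs_cube_L2 (\<lambda>x. c i * F i x) = c i *\<^sub>R abs_cube_L2 (F i)"
    using scaleR_cube_L2.abs_eq[of "F i" "c i"] insert.prems by (simp add: l2_rel_refl)
  then show ?case
    using insert 1 plus_cube_L2.abs_eq[of "\<lambda>x. c i * F i x" "\<lambda>x. \<Sum>j\<in>J. c j * F j x"]
    by (simp add: l2_rel_refl square_integrable_add)
qed

definition coord_coeff :: "'a::euclidean_space \<Rightarrow> real cube_L2 \<Rightarrow> ('a \<Rightarrow> real) \<Rightarrow> 'a \<Rightarrow> real" where
  "coord_coeff b g f x = (\<integral>t. slice b f x t * rep g t \<partial>unit_cube)"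

definition coord_proj :: "'a::euclidean_space \<Rightarrow> real cube_L2 set \<Rightarrow> ('a \<Rightarrow> real) \<Rightarrow> 'a \<Rightarrow> real" where
  "coord_proj b B f x = (\<Sum>g\<in>B. rep g (x \<bullet> b) * coord_coeff b g f x)"

lemma coord_measurable: "b \<in> Basis \<Longrightarrow> (\<lambda>x :: 'a::euclidean_space. x \<bullet> b) \<in> unit_cube \<rightarrow>\<^sub>M unit_cube"
  by (rule measurable_into_unit_cube)
    (auto intro!: borel_measurable_unit_cube simp: in_unit_interval dest: unit_cube_coord)

lemma rep_coord_measurable:
  "b \<in> Basis \<Longrightarrow> (\<lambda>x :: 'a::euclidean_space. rep g (x \<bullet> b)) \<in> borel_measurable unit_cube"
  by (rule measurable_compose[OF coord_measurable rep_measurable])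

lemma coord_coeff_measurable:
  assumes "b \<in> Basis" "f \<in> borel_measurable unit_cube"
  shows "coord_coeff b g f \<in> borel_measurable unit_cube"
proof -
  interpret sigma_finite_measure "unit_cube :: real measure" by (rule sigma_finite_unit_cube)
  note [measurable] = slice_measurable_pair[OF assms]
  show ?thesis unfolding coord_coeff_def[abs_def] by measurable
qed

lemma coord_proj_measurable:
  assumes "b \<in> Basis" "f \<in> borel_measurable unit_cube"
  shows "coord_proj b B f \<in> borel_measurable unit_cube"
  unfolding coord_proj_def[abs_def]
  by (intro borel_measurable_sum borel_measurable_times rep_coord_measurable coord_coeff_measurable assms)

lemma coord_coeff_set_coord: "b \<in> Basis \<Longrightarrow> coord_coeff b g f (set_coord b x t) = coord_coeff b g f x"
  by (simp add: coord_coeff_def slice_def)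

lemma coord_coeff_eq_inner:
  "square_integrable unit_cube (slice b f x) \<Longrightarrow>
    coord_coeff b g f x = abs_cube_L2 (slice b f x) \<bullet> g"
  by (simp add: coord_coeff_def inner_abs_cube_L2)

lemma slice_coord_proj:
  assumes b: "b \<in> Basis" and B: "finite B" and s: "square_integrable unit_cube (slice b f x)"
  shows "square_integrable unit_cube (slice b (coord_proj b B f) x)"
    and "abs_cube_L2 (slice b (coord_proj b B f) x) = proj B (abs_cube_L2 (slice b f x))"
proof -
  have eq: "slice b (coord_proj b B f) x = (\<lambda>t. \<Sum>g\<in>B. (abs_cube_L2 (slice b f x) \<bullet> g) * rep g t)"
    using s by (simp add: slice_def coord_proj_def set_coord_inner b coord_coeff_set_coord mult.commute
        coord_coeff_eq_inner[unfolded slice_def])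
  note lin = abs_linear_combination[OF B, of rep "\<lambda>g. abs_cube_L2 (slice b f x) \<bullet> g"]
  show "square_integrable unit_cube (slice b (coord_proj b B f) x)"
    unfolding eq using lin by (simp add: square_integrable_rep)
  show "abs_cube_L2 (slice b (coord_proj b B f) x) = proj B (abs_cube_L2 (slice b f x))"
    unfolding eq proj_def using lin by (simp add: square_integrable_rep)
qed

text \<open>The \<open>L\<^sup>2\<close> norm on the cube is computed slice by slice. This reduces all estimates for coordinate
  projections to estimates for orthogonal projections in \<open>L\<^sup>2(0,1)\<close>.\<close>

lemma nn_integral_square_slicewise:
  assumes b: "b \<in> Basis" and F: "F \<in> borel_measurable unit_cube"
    and Y: "AE x in unit_cube. square_integrable unit_cube (slice b F x) \<and> abs_cube_L2 (slice b F x) = Y x"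
  shows "(\<integral>\<^sup>+x. ennreal ((F x)\<^sup>2) \<partial>unit_cube) = (\<integral>\<^sup>+x. ennreal ((norm (Y x))\<^sup>2) \<partial>unit_cube)"
proof (rule trans[OF nn_integral_slice_square[OF b F, symmetric] nn_integral_cong_AE])
  show "AE x in unit_cube. (\<integral>\<^sup>+t. ennreal ((slice b F x t)\<^sup>2) \<partial>unit_cube) = ennreal ((norm (Y x))\<^sup>2)"
    using Y by eventually_elim (metis norm_abs_cube_L2_nn)
qed

lemma coord_proj_square_integrable:
  assumes b: "b \<in> Basis" and B: "orthonormal B" and f: "square_integrable unit_cube f"
  shows "square_integrable unit_cube (coord_proj b B f)"
proof -
  have fm: "f \<in> borel_measurable unit_cube" using f by (rule square_integrable_measurable)
  have fin: "finite B" using B by (simp add: orthonormal_def)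
  have "(\<integral>\<^sup>+x. ennreal ((coord_proj b B f x)\<^sup>2) \<partial>unit_cube) =
      (\<integral>\<^sup>+x. ennreal ((norm (proj B (abs_cube_L2 (slice b f x))))\<^sup>2) \<partial>unit_cube)"
    by (rule nn_integral_square_slicewise[OF b coord_proj_measurable[OF b fm]])
      (use AE_square_integrable_slice[OF b f] in eventually_elim, simp add: slice_coord_proj[OF b fin])
  also have "\<dots> \<le> (\<integral>\<^sup>+x. ennreal ((norm (abs_cube_L2 (slice b f x)))\<^sup>2) \<partial>unit_cube)"
    by (intro nn_integral_mono ennreal_leI power_mono norm_proj_le[OF B]) simp
  also have "\<dots> < \<infinity>"
    using nn_integral_norm_slice[OF b f] f fm by (simp add: square_integrable_iff_nn)
  finally show ?thesis
    by (simp add: square_integrable_iff_nn coord_proj_measurable[OF b fm])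
qed

definition coord_proj_L2 :: "'a::euclidean_space \<Rightarrow> real cube_L2 set \<Rightarrow> 'a cube_L2 \<Rightarrow> 'a cube_L2" where
  "coord_proj_L2 b B u = abs_cube_L2 (coord_proj b B (rep u))"

lemma slice_fun_diff: "slice b (\<lambda>x. f x - g x) x = (\<lambda>t. slice b f x t - slice b g x t)"
  by (simp add: slice_def)

lemma norm_coord_proj_diff_le:
  assumes b: "b \<in> Basis" and B: "orthonormal B"
  shows "norm (coord_proj_L2 b B u - coord_proj_L2 b B v) \<le> norm (u - v)"
proof -
  have fin: "finite B" using B by (simp add: orthonormal_def)
  note su = square_integrable_rep[of u] and sv = square_integrable_rep[of v]
  note pu = coord_proj_square_integrable[OF b B su] and pv = coord_proj_square_integrable[OF b B sv]
  let ?F = "\<lambda>x. coord_proj b B (rep u) x - coord_proj b B (rep v) x"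
  let ?G = "\<lambda>x. rep u x - rep v x"
  let ?Y = "\<lambda>x. abs_cube_L2 (slice b (rep u) x) - abs_cube_L2 (slice b (rep v) x)"
  note ae = AE_square_integrable_slice[OF b su] AE_square_integrable_slice[OF b sv]
  have "ennreal ((norm (coord_proj_L2 b B u - coord_proj_L2 b B v))\<^sup>2) = (\<integral>\<^sup>+x. ennreal ((?F x)\<^sup>2) \<partial>unit_cube)"
    unfolding coord_proj_L2_def abs_diff[OF pu pv, symmetric]
    by (rule norm_abs_cube_L2_nn) (rule square_integrable_diff[OF pu pv])
  also have "\<dots> = (\<integral>\<^sup>+x. ennreal ((norm (proj B (?Y x)))\<^sup>2) \<partial>unit_cube)"
  proof (rule nn_integral_square_slicewise[OF b])
    show "?F \<in> borel_measurable unit_cube"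
      using square_integrable_measurable[OF square_integrable_diff[OF pu pv]] .
    show "AE x in unit_cube. square_integrable unit_cube (slice b ?F x) \<and> abs_cube_L2 (slice b ?F x) = proj B (?Y x)"
      using ae
      by eventually_elim
        (simp add: slice_fun_diff square_integrable_diff abs_diff slice_coord_proj[OF b fin] proj_diff)
  qed
  also have "\<dots> \<le> (\<integral>\<^sup>+x. ennreal ((norm (?Y x))\<^sup>2) \<partial>unit_cube)"
    by (intro nn_integral_mono ennreal_leI power_mono norm_proj_le[OF B]) simp
  also have "\<dots> = (\<integral>\<^sup>+x. ennreal ((?G x)\<^sup>2) \<partial>unit_cube)"
  proof (rule nn_integral_square_slicewise[OF b, symmetric])
    show "?G \<in> borel_measurable unit_cube" by measurable
    show "AE x in unit_cube. square_integrable unit_cube (slice b ?G x) \<and> abs_cube_L2 (slice b ?G x) = ?Y x"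
      using ae by eventually_elim (simp add: slice_fun_diff square_integrable_diff abs_diff)
  qed
  also have "\<dots> = ennreal ((norm (u - v))\<^sup>2)"
    using norm_abs_cube_L2_nn[OF square_integrable_diff[OF su sv]] by (simp add: abs_diff[OF su sv])
  finally show ?thesis by - (rule power2_le_imp_le, simp_all)
qed

lemma norm_diff_coord_proj:
  assumes b: "b \<in> Basis" and B: "orthonormal B"
  shows "ennreal ((norm (u - coord_proj_L2 b B u))\<^sup>2) =
    (\<integral>\<^sup>+x. ennreal ((norm (abs_cube_L2 (slice b (rep u) x) - proj B (abs_cube_L2 (slice b (rep u) x))))\<^sup>2) \<partial>unit_cube)"
proof -
  have fin: "finite B" using B by (simp add: orthonormal_def)
  note su = square_integrable_rep[of u]
  note pu = coord_proj_square_integrable[OF b B su]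
  let ?F = "\<lambda>x. rep u x - coord_proj b B (rep u) x"
  have "u - coord_proj_L2 b B u = abs_cube_L2 ?F"
    by (simp add: coord_proj_L2_def abs_diff[OF su pu])
  then have "ennreal ((norm (u - coord_proj_L2 b B u))\<^sup>2) = (\<integral>\<^sup>+x. ennreal ((?F x)\<^sup>2) \<partial>unit_cube)"
    using norm_abs_cube_L2_nn[OF square_integrable_diff[OF su pu]] by simp
  also have "\<dots> = (\<integral>\<^sup>+x. ennreal ((norm (abs_cube_L2 (slice b (rep u) x) - proj B (abs_cube_L2 (slice b (rep u) x))))\<^sup>2) \<partial>unit_cube)"
  proof (rule nn_integral_square_slicewise[OF b])
    show "?F \<in> borel_measurable unit_cube"
      using square_integrable_measurable[OF square_integrable_diff[OF su pu]] .
    show "AE x in unit_cube. square_integrable unit_cube (slice b ?F x) \<and>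
        abs_cube_L2 (slice b ?F x) = abs_cube_L2 (slice b (rep u) x) - proj B (abs_cube_L2 (slice b (rep u) x))"
      using AE_square_integrable_slice[OF b su]
      by eventually_elim (simp add: slice_fun_diff square_integrable_diff abs_diff slice_coord_proj[OF b fin])
  qed
  finally show ?thesis .
qed

text \<open>On almost every slice the hypothesis applies to the restriction of \<open>u\<close>; integrating the squares of
  these bounds gives the result by \<open>sobolev_slice\<close>.\<close>

lemma norm_diff_coord_proj_le:
  fixes u :: "'a::euclidean_space cube_L2"
  assumes b: "b \<in> Basis" and B: "orthonormal B" and u: "u \<in> sobolev s"
    and approx: "\<And>w. w \<in> sobolev s \<Longrightarrow> infdist w (span B) \<le> c * sobolev_norm s w" and c: "0 \<le> c"
  shows "norm (u - coord_proj_L2 b B u) \<le> c * sqrt (slice_const DIM('a) s) * sobolev_norm s u"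
proof -
  obtain H where H: "H \<in> borel_measurable unit_cube"
    "AE x in unit_cube. abs_cube_L2 (slice b (rep u) x) \<in> sobolev s \<and>
      ennreal ((sobolev_norm s (abs_cube_L2 (slice b (rep u) x)))\<^sup>2) \<le> H x"
    "(\<integral>\<^sup>+x. H x \<partial>unit_cube) \<le>
      ennreal (slice_const DIM('a) s) * ennreal ((sobolev_norm s u)\<^sup>2)"
    by (rule sobolev_slice[OF b u])
  have "ennreal ((norm (u - coord_proj_L2 b B u))\<^sup>2) \<le>
      (\<integral>\<^sup>+x. ennreal (c\<^sup>2) * H x \<partial>unit_cube)"
    unfolding norm_diff_coord_proj[OF b B]
  proof (rule nn_integral_mono_AE)
    show "AE x in unit_cube.
        ennreal ((norm (abs_cube_L2 (slice b (rep u) x) - proj B (abs_cube_L2 (slice b (rep u) x))))\<^sup>2) \<le>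
        ennreal (c\<^sup>2) * H x"
      using H(2)
    proof eventually_elim
      case (elim x)
      let ?w = "abs_cube_L2 (slice b (rep u) x)"
      have "norm (?w - proj B ?w) \<le> c * sobolev_norm s ?w"
        using norm_diff_proj_le_infdist[OF B] approx[OF conjunct1[OF elim]] by (rule order_trans)
      then have "(norm (?w - proj B ?w))\<^sup>2 \<le> c\<^sup>2 * (sobolev_norm s ?w)\<^sup>2"
        unfolding power_mult_distrib[symmetric] by (rule power_mono) simp
      then have "ennreal ((norm (?w - proj B ?w))\<^sup>2) \<le> ennreal (c\<^sup>2) * ennreal ((sobolev_norm s ?w)\<^sup>2)"
        by (simp add: ennreal_leI flip: ennreal_mult)
      also have "\<dots> \<le> ennreal (c\<^sup>2) * H x"
        using elim by (intro mult_left_mono) auto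
      finally show ?case .
    qed
  qed
  also have "\<dots> = ennreal (c\<^sup>2) * (\<integral>\<^sup>+x. H x \<partial>unit_cube)"
    by (rule nn_integral_cmult[OF H(1)])
  also have "\<dots> \<le> ennreal (c\<^sup>2) * (ennreal (slice_const DIM('a) s) * ennreal ((sobolev_norm s u)\<^sup>2))"
    by (intro mult_left_mono H(3)) simp
  also have "\<dots> = ennreal ((c * sqrt (slice_const DIM('a) s) * sobolev_norm s u)\<^sup>2)"
    using slice_const_ge_1[of "DIM('a)" s] by (simp add: power_mult_distrib ennreal_mult mult.assoc)
  finally show ?thesis
    using c slice_const_ge_1[of "DIM('a)" s]
    by - (rule power2_le_imp_le, simp_all add: sobolev_norm_nonneg)
qed


section \<open>Iterated coordinate projections\<close>

lemma coord_coeff_square_integrable: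
  assumes b: "b \<in> Basis" and f: "square_integrable unit_cube f"
  shows "square_integrable unit_cube (coord_coeff b g f)"
proof -
  have fm: "f \<in> borel_measurable unit_cube" using f by (rule square_integrable_measurable)
  have "(\<integral>\<^sup>+x. ennreal ((coord_coeff b g f x)\<^sup>2) \<partial>unit_cube) \<le>
      (\<integral>\<^sup>+x. ennreal ((norm g)\<^sup>2) * (\<integral>\<^sup>+t. ennreal ((slice b f x t)\<^sup>2) \<partial>unit_cube) \<partial>unit_cube)"
  proof (rule nn_integral_mono_AE)
    show "AE x in unit_cube. ennreal ((coord_coeff b g f x)\<^sup>2) \<le>
        ennreal ((norm g)\<^sup>2) * (\<integral>\<^sup>+t. ennreal ((slice b f x t)\<^sup>2) \<partial>unit_cube)"
      using AE_square_integrable_slice[OF b f]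
    proof eventually_elim
      case (elim x)
      let ?U = "abs_cube_L2 (slice b f x)"
      have "(?U \<bullet> g)\<^sup>2 \<le> (norm ?U * norm g)\<^sup>2"
        using Cauchy_Schwarz_ineq2[of ?U g] by (metis abs_ge_zero power2_abs power_mono)
      then have "ennreal ((coord_coeff b g f x)\<^sup>2) \<le> ennreal ((norm g)\<^sup>2) * ennreal ((norm ?U)\<^sup>2)"
        by (simp add: coord_coeff_eq_inner[OF elim] power_mult_distrib mult.commute ennreal_leI flip: ennreal_mult)
      then show ?case by (simp add: norm_abs_cube_L2_nn[OF elim])
    qed
  qed
  also have "\<dots> = ennreal ((norm g)\<^sup>2) * (\<integral>\<^sup>+x. \<integral>\<^sup>+t. ennreal ((slice b f x t)\<^sup>2) \<partial>unit_cube \<partial>unit_cube)"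
  proof (rule nn_integral_cmult)
    interpret sigma_finite_measure "unit_cube :: real measure" by (rule sigma_finite_unit_cube)
    note [measurable] = slice_measurable_pair[OF b fm]
    show "(\<lambda>x. \<integral>\<^sup>+t. ennreal ((slice b f x t)\<^sup>2) \<partial>unit_cube) \<in> borel_measurable unit_cube"
      by measurable
  qed
  also have "\<dots> < \<infinity>"
    using f by (simp add: nn_integral_slice_square[OF b fm] square_integrable_iff_nn[OF fm] ennreal_mult_less_top)
  finally show ?thesis
    by (simp add: square_integrable_iff_nn coord_coeff_measurable[OF b fm])
qed

text \<open>The form of a function after projections in the coordinates \<open>L\<close>: the multi-index \<open>j\<close> selects a basis
  function for each of these coordinates, and \<open>h j\<close> depends on the remaining ones only.\<close>

definition partial_tensor ::
  "('a::euclidean_space \<Rightarrow> real cube_L2 set) \<Rightarrow> 'a set \<Rightarrow> (('a \<Rightarrow> real cube_L2) \<Rightarrow> 'a \<Rightarrow> real) \<Rightarrow> 'a \<Rightarrow> real" where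
  "partial_tensor B L h x = (\<Sum>j\<in>PiE L B. (\<Prod>i\<in>L. rep (j i) (x \<bullet> i)) * h j x)"

definition has_partial_tensor ::
  "('a::euclidean_space \<Rightarrow> real cube_L2 set) \<Rightarrow> 'a set \<Rightarrow> 'a cube_L2 \<Rightarrow> bool" where
  "has_partial_tensor B L u \<longleftrightarrow> (\<exists>h.
     (\<forall>j\<in>PiE L B. square_integrable unit_cube (h j) \<and> (\<forall>b\<in>L. \<forall>x t. h j (set_coord b x t) = h j x)) \<and>
     (AE x in unit_cube. rep u x = partial_tensor B L h x))"

lemma sum_PiE_insert:
  assumes "b \<notin> L"
  shows "(\<Sum>j\<in>PiE (insert b L) B. F j) = (\<Sum>g\<in>B b. \<Sum>j\<in>PiE L B. F (j(b := g)))"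
proof -
  have "(\<Sum>j\<in>PiE (insert b L) B. F j) = (\<Sum>(g, j)\<in>B b \<times> PiE L B. F (j(b := g)))"
    unfolding PiE_insert_eq
    by (subst sum.reindex[OF inj_combinator[OF assms]]) (simp add: split_beta' o_def)
  then show ?thesis by (simp add: sum.cartesian_product)
qed

text \<open>The factors with coordinates in \<open>L\<close> are constant in the direction \<open>b\<close>, so the projection acts on the
  functions \<open>h j\<close> alone and replaces each of them by its coefficients with respect to \<open>B b\<close>. Square
  integrability of \<open>h j\<close> is carried along to exchange sum and integral on almost every slice.\<close>

lemma has_partial_tensor_coord_proj:
  fixes u :: "'a::euclidean_space cube_L2"
  assumes b: "b \<in> Basis" "b \<notin> L" and L: "L \<subseteq> Basis"
    and B: "\<And>c. c \<in> Basis \<Longrightarrow> orthonormal (B c)" and u: "has_partial_tensor B L u"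
  shows "has_partial_tensor B (insert b L) (coord_proj_L2 b (B b) u)"
proof -
  obtain h where h: "\<And>j. j \<in> PiE L B \<Longrightarrow> square_integrable unit_cube (h j)"
    "\<And>j c x t. j \<in> PiE L B \<Longrightarrow> c \<in> L \<Longrightarrow> h j (set_coord c x t) = h j x"
    "AE x in unit_cube. rep u x = partial_tensor B L h x"
    using u unfolding has_partial_tensor_def by blast
  define h' where "h' j = coord_coeff b (j b) (h (restrict j L))" for j
  have finL: "finite L" using L finite_Basis by (rule finite_subset)
  have finP: "finite (PiE L B)"
    using L B by (intro finite_PiE finL) (auto simp: orthonormal_def)
  have restr: "restrict j L \<in> PiE L B" if "j \<in> PiE (insert b L) B" for j
    using that by auto
  have coeff: "AE x in unit_cube. coord_coeff b g (rep u) x =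
      (\<Sum>j\<in>PiE L B. (\<Prod>i\<in>L. rep (j i) (x \<bullet> i)) * coord_coeff b g (h j) x)" for g
  proof -
    have "AE x in unit_cube. \<forall>j\<in>PiE L B. square_integrable unit_cube (slice b (h j) x)"
      by (rule AE_ball_countable') (auto intro!: AE_square_integrable_slice[OF b(1)] h(1) countable_finite finP)
    moreover have "AE x in unit_cube. x \<in> box 0 (One :: 'a)"
      by (rule AE_I2) simp
    ultimately show ?thesis using AE_set_coord[OF b(1) h(3)]
    proof eventually_elim
      case (elim x)
      have "coord_coeff b g (rep u) x =
          (\<integral>t. (\<Sum>j\<in>PiE L B. (\<Prod>i\<in>L. rep (j i) (x \<bullet> i)) * (slice b (h j) x t * rep g t)) \<partial>unit_cube)"
        unfolding coord_coeff_def
      proof (rule integral_cong_AE)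
        show "AE t in unit_cube. slice b (rep u) x t * rep g t =
            (\<Sum>j\<in>PiE L B. (\<Prod>i\<in>L. rep (j i) (x \<bullet> i)) * (slice b (h j) x t * rep g t))"
          using elim(3)
        proof eventually_elim
          case (elim t)
          have "set_coord b x t \<bullet> i = x \<bullet> i" if "i \<in> L" for i
            using that b L by (subst set_coord_inner) auto
          then show ?case
            using elim by (simp add: slice_def partial_tensor_def sum_distrib_right sum_distrib_left mult_ac)
        qed
        show "(\<lambda>t. slice b (rep u) x t * rep g t) \<in> borel_measurable unit_cube"
          using slice_measurable[OF b(1) rep_measurable elim(2), of u] by measurable
        show "(\<lambda>t. \<Sum>j\<in>PiE L B. (\<Prod>i\<in>L. rep (j i) (x \<bullet> i)) * (slice b (h j) x t * rep g t))
            \<in> borel_measurable unit_cube"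
          using elim(1) by (intro borel_measurable_sum borel_measurable_times borel_measurable_const rep_measurable)
            (auto intro: square_integrable_measurable)
      qed
      also have "\<dots> = (\<Sum>j\<in>PiE L B. (\<Prod>i\<in>L. rep (j i) (x \<bullet> i)) * coord_coeff b g (h j) x)"
        unfolding coord_coeff_def using elim(1)
        by (subst Bochner_Integration.integral_sum)
          (auto intro!: integrable_mult_right square_integrable_mult square_integrable_rep)
      finally show ?case .
    qed
  qed
  show ?thesis
    unfolding has_partial_tensor_def
  proof (intro exI conjI ballI allI)
    fix j assume j: "j \<in> PiE (insert b L) B"
    show "square_integrable unit_cube (h' j)"
      unfolding h'_def by (intro coord_coeff_square_integrable[OF b(1)] h(1) restr j)
    fix c x t assume c: "c \<in> insert b L"
    show "h' j (set_coord c x t) = h' j x"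
    proof (cases "c = b")
      case True
      then show ?thesis by (simp add: h'_def coord_coeff_set_coord b)
    next
      case False
      then have cL: "c \<in> L" "c \<in> Basis" using c L by auto
      have "set_coord b (set_coord c x t) s = set_coord c (set_coord b x s) t" for s
        using set_coord_commute[OF b(1) cL(2), of x t s] False by simp
      then show ?thesis
        by (simp add: h'_def coord_coeff_def slice_def h(2)[OF restr[OF j] cL(1)])
    qed
  next
    have finB: "finite (B b)" using B[OF b(1)] by (simp add: orthonormal_def)
    have "AE x in unit_cube. \<forall>g\<in>B b. coord_coeff b g (rep u) x =
        (\<Sum>j\<in>PiE L B. (\<Prod>i\<in>L. rep (j i) (x \<bullet> i)) * coord_coeff b g (h j) x)"
      by (rule AE_ball_countable'[OF coeff]) (rule countable_finite[OF finB])
    moreover have "AE x in unit_cube. rep (coord_proj_L2 b (B b) u) x = coord_proj b (B b) (rep u) x"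
      unfolding coord_proj_L2_def
      by (rule rep_abs) (rule coord_proj_square_integrable[OF b(1) B[OF b(1)] square_integrable_rep])
    ultimately show "AE x in unit_cube. rep (coord_proj_L2 b (B b) u) x = partial_tensor B (insert b L) h' x"
    proof eventually_elim
      case (elim x)
      have upd_j: "(\<Prod>i\<in>insert b L. rep ((j(b := g)) i) (x \<bullet> i)) * h' (j(b := g)) x =
          rep g (x \<bullet> b) * ((\<Prod>i\<in>L. rep (j i) (x \<bullet> i)) * coord_coeff b g (h j) x)"
        if "j \<in> PiE L B" for j g
      proof -
        have "restrict (j(b := g)) L = j"
          using that b(2) by (auto simp: restrict_def PiE_def extensional_def fun_eq_iff)
        moreover have "(\<Prod>i\<in>L. rep ((j(b := g)) i) (x \<bullet> i)) = (\<Prod>i\<in>L. rep (j i) (x \<bullet> i))"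
          by (rule prod.cong) (use b(2) in auto)
        ultimately show ?thesis
          using b(2) finL by (simp add: h'_def mult_ac)
      qed
      have "rep (coord_proj_L2 b (B b) u) x = (\<Sum>g\<in>B b. rep g (x \<bullet> b) *
          (\<Sum>j\<in>PiE L B. (\<Prod>i\<in>L. rep (j i) (x \<bullet> i)) * coord_coeff b g (h j) x))"
        using elim by (simp add: coord_proj_def)
      also have "\<dots> = partial_tensor B (insert b L) h' x"
        unfolding partial_tensor_def sum_PiE_insert[OF b(2)] sum_distrib_left
        by (intro sum.cong refl upd_j[symmetric])
      finally show ?case .
    qed
  qed
qed

definition coord_projs :: "('a::euclidean_space \<Rightarrow> real cube_L2 set) \<Rightarrow> 'a list \<Rightarrow> 'a cube_L2 \<Rightarrow> 'a cube_L2" where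
  "coord_projs B bs u = foldr (\<lambda>b. coord_proj_L2 b (B b)) bs u"

lemma has_partial_tensor_coord_projs:
  assumes "distinct bs" "set bs \<subseteq> Basis" and B: "\<And>c. c \<in> Basis \<Longrightarrow> orthonormal (B c)"
  shows "has_partial_tensor B (set bs) (coord_projs B bs u)"
  using assms(1,2)
proof (induction bs)
  case Nil
  have "\<forall>j\<in>PiE {} B. square_integrable unit_cube (rep u)" by (simp add: square_integrable_rep)
  moreover have "AE x in unit_cube. rep u x = partial_tensor B {} (\<lambda>_. rep u) x"
    by (simp add: partial_tensor_def)
  ultimately show ?case
    unfolding has_partial_tensor_def coord_projs_def by (intro exI[of _ "\<lambda>_. rep u"]) simp
next
  case (Cons b bs)
  then show ?case
    using has_partial_tensor_coord_proj[of b "set bs" B "coord_projs B bs u"] B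
    by (simp add: coord_projs_def)
qed

text \<open>Since the projections are contractions, replacing the argument of the outermost one costs
  no more than the error made by the inner ones.\<close>

lemma norm_diff_coord_projs_le:
  assumes "set bs \<subseteq> Basis" and B: "\<And>c. c \<in> Basis \<Longrightarrow> orthonormal (B c)"
  shows "norm (u - coord_projs B bs u) \<le> (\<Sum>b\<leftarrow>bs. norm (u - coord_proj_L2 b (B b) u))"
  using assms(1)
proof (induction bs)
  case (Cons b bs)
  have b: "b \<in> Basis" using Cons.prems by simp
  let ?R = "coord_projs B bs u"
  have "norm (u - coord_projs B (b # bs) u) =
      norm ((u - coord_proj_L2 b (B b) u) + (coord_proj_L2 b (B b) u - coord_proj_L2 b (B b) ?R))"
    by (simp add: coord_projs_def)
  also have "\<dots> \<le> norm (u - coord_proj_L2 b (B b) u) + norm (coord_proj_L2 b (B b) u - coord_proj_L2 b (B b) ?R)"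
    by (rule norm_triangle_ineq)
  also have "\<dots> \<le> norm (u - coord_proj_L2 b (B b) u) + norm (u - ?R)"
    by (intro add_left_mono norm_coord_proj_diff_le[OF b B[OF b]])
  also have "\<dots> \<le> (\<Sum>b\<leftarrow>b # bs. norm (u - coord_proj_L2 b (B b) u))"
    using Cons by simp
  finally show ?case .
qed (simp add: coord_projs_def)

lemma set_coord_invariant_const:
  fixes h :: "'a::euclidean_space \<Rightarrow> real"
  assumes h: "\<And>b x t. b \<in> Basis \<Longrightarrow> h (set_coord b x t) = h x"
  shows "h x = h 0"
proof -
  have "h (\<Sum>b\<in>A. (x \<bullet> b) *\<^sub>R b) = h 0" if "finite A" "A \<subseteq> Basis" for A
    using that
  proof (induction)
    case (insert b A)
    have "(\<Sum>c\<in>A. (x \<bullet> c) *\<^sub>R c) \<bullet> b = 0"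
      using insert by (auto simp: inner_sum_left inner_Basis intro!: sum.neutral)
    then have "(\<Sum>c\<in>insert b A. (x \<bullet> c) *\<^sub>R c) = set_coord b (\<Sum>c\<in>A. (x \<bullet> c) *\<^sub>R c) (x \<bullet> b)"
      using insert by (simp add: set_coord_def add.commute)
    then show ?case using insert h[of b] by simp
  qed simp
  from this[of Basis] show ?thesis by (simp add: euclidean_representation)
qed

text \<open>Once all coordinates have been projected, the remaining factors are constants.\<close>

lemma has_partial_tensor_all:
  assumes "has_partial_tensor B Basis u"
  obtains c where "AE x in unit_cube. rep u x = (\<Sum>j\<in>PiE Basis B. c j * tensor_fun (\<lambda>i. rep (j i)) x)"
proof -
  obtain h where h: "\<And>j b x t. j \<in> PiE Basis B \<Longrightarrow> b \<in> Basis \<Longrightarrow> h j (set_coord b x t) = h j x"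
    "AE x in unit_cube. rep u x = partial_tensor B Basis h x"
    using assms unfolding has_partial_tensor_def by blast
  have "h j x = h j 0" if "j \<in> PiE Basis B" for j x
    by (rule set_coord_invariant_const) (rule h(1)[OF that])
  then have "partial_tensor B Basis h x = (\<Sum>j\<in>PiE Basis B. h j 0 * tensor_fun (\<lambda>i. rep (j i)) x)" for x
    unfolding partial_tensor_def tensor_fun_def by (intro sum.cong refl) (metis mult.commute)
  then show ?thesis using that[of "\<lambda>j. h j 0"] h(2) by simp
qed

lemma nn_integral_tensor_square:
  fixes h :: "'a::euclidean_space \<Rightarrow> real \<Rightarrow> real"
  assumes h: "\<And>c. c \<in> Basis \<Longrightarrow> square_integrable unit_cube (h c)"
    and A: "finite A" "A \<subseteq> Basis"
  shows "(\<integral>\<^sup>+x. (\<Prod>c\<in>A. ennreal ((h c (x \<bullet> c))\<^sup>2)) \<partial>unit_cube) =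
    (\<Prod>c\<in>A. \<integral>\<^sup>+t. ennreal ((h c t)\<^sup>2) \<partial>unit_cube)"
  using A
proof induction
  case (insert b A)
  have b: "b \<in> Basis" using insert by simp
  have hm: "(\<lambda>x :: 'a. h c (x \<bullet> c)) \<in> borel_measurable unit_cube" if "c \<in> Basis" for c
    by (rule measurable_compose[OF coord_measurable[OF that] square_integrable_measurable[OF h[OF that]]])
  have hb [measurable]: "h b \<in> borel_measurable unit_cube"
    by (rule square_integrable_measurable[OF h[OF b]])
  have pm: "(\<lambda>x :: 'a. \<Prod>c\<in>S. ennreal ((h c (x \<bullet> c))\<^sup>2)) \<in> borel_measurable unit_cube" if "S \<subseteq> Basis" for S
    using that hm by (intro borel_measurable_prod_ennreal measurable_compose[OF _ measurable_ennreal]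
        borel_measurable_power) auto
  have "(\<integral>\<^sup>+x. (\<Prod>c\<in>insert b A. ennreal ((h c (x \<bullet> c))\<^sup>2)) \<partial>unit_cube) =
      (\<integral>\<^sup>+x. \<integral>\<^sup>+t. (\<Prod>c\<in>insert b A. ennreal ((h c (set_coord b x t \<bullet> c))\<^sup>2)) \<partial>unit_cube \<partial>unit_cube)"
    by (rule nn_integral_set_coord[OF b, symmetric]) (rule pm, use insert in auto)
  also have "\<dots> = (\<integral>\<^sup>+x. \<integral>\<^sup>+t. ennreal ((h b t)\<^sup>2) * (\<Prod>c\<in>A. ennreal ((h c (x \<bullet> c))\<^sup>2)) \<partial>unit_cube \<partial>unit_cube)"
  proof -
    have "(\<Prod>c\<in>A. ennreal ((h c (set_coord b x t \<bullet> c))\<^sup>2)) = (\<Prod>c\<in>A. ennreal ((h c (x \<bullet> c))\<^sup>2))" for x t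
      by (rule prod.cong[OF refl], subst set_coord_inner) (use insert b in auto)
    then show ?thesis using insert b by (simp add: set_coord_inner)
  qed
  also have "\<dots> = (\<integral>\<^sup>+t. ennreal ((h b t)\<^sup>2) \<partial>unit_cube) * (\<integral>\<^sup>+x. (\<Prod>c\<in>A. ennreal ((h c (x \<bullet> c))\<^sup>2)) \<partial>unit_cube)"
    using pm[of A] insert by (simp add: nn_integral_multc nn_integral_cmult)
  finally show ?case using insert by simp
qed (simp add: emeasure_unit_cube)

lemma square_integrable_tensor_fun:
  fixes h :: "'a::euclidean_space \<Rightarrow> real \<Rightarrow> real"
  assumes h: "\<And>c. c \<in> Basis \<Longrightarrow> square_integrable unit_cube (h c)"
  shows "square_integrable unit_cube (tensor_fun h)"
proof -
  have m: "tensor_fun h \<in> borel_measurable unit_cube"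
    unfolding tensor_fun_def
    by (intro borel_measurable_prod measurable_compose[OF coord_measurable square_integrable_measurable[OF h]]) auto
  have "(\<integral>\<^sup>+x. ennreal ((tensor_fun h x)\<^sup>2) \<partial>unit_cube) = (\<Prod>c\<in>Basis. \<integral>\<^sup>+t. ennreal ((h c t)\<^sup>2) \<partial>unit_cube)"
    using nn_integral_tensor_square[where A = Basis and h = h, OF h]
    by (simp add: tensor_fun_def prod_power_distrib prod_ennreal)
  also have "\<dots> < \<infinity>"
  proof -
    have "(\<integral>\<^sup>+t. ennreal ((h c t)\<^sup>2) \<partial>unit_cube) \<noteq> \<infinity>" if "c \<in> Basis" for c
      using h[OF that] square_integrable_iff_nn[OF square_integrable_measurable[OF h[OF that]]] by simp
    then show ?thesis by (auto simp: less_top[symmetric] ennreal_prod_eq_top)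
  qed
  finally show ?thesis by (simp add: square_integrable_iff_nn[OF m])
qed


section \<open>Tree tensor ranks of the approximant\<close>

lemma Basis_cart: "(Basis :: (real ^ 'n::finite) set) = range (\<lambda>\<nu>. axis \<nu> 1)"
  by (auto simp: Basis_vec_def)

lemma inj_axis_one: "inj (\<lambda>\<nu>. axis \<nu> (1 :: real) :: real ^ 'n::finite)"
  by (auto simp: inj_on_def axis_eq_axis)

lemma tensor_fun_cart:
  "tensor_fun h (x :: real ^ 'n::finite) = (\<Prod>\<nu>\<in>UNIV. h (axis \<nu> 1) (x $ \<nu>))"
  unfolding tensor_fun_def Basis_cart
  by (subst prod.reindex[OF inj_axis_one]) (simp add: inner_axis o_def)

lemma separatedI_indexed:
  fixes v :: "(real ^ 'n::finite) cube_L2"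
  assumes K: "finite K" "card K = k"
    and U: "\<And>i. i \<in> K \<Longrightarrow> square_integrable (PiM \<alpha> (\<lambda>_. unit_cube)) (U i)"
    and W: "\<And>i. i \<in> K \<Longrightarrow> square_integrable (PiM (- \<alpha>) (\<lambda>_. unit_cube)) (W i)"
    and v: "AE x in unit_cube.
      rep v x = (\<Sum>i\<in>K. U i (restrict (($) x) \<alpha>) * W i (restrict (($) x) (- \<alpha>)))"
  shows "separated \<alpha> v k"
proof -
  obtain e where "bij_betw e {0..<k} K"
    using ex_bij_betw_nat_finite[OF K(1)] K(2) by blast
  then have e: "bij_betw e {..<k} K" by (simp add: lessThan_atLeast0)
  then have eK: "e i \<in> K" if "i < k" for i
    using that bij_betwE by blast
  have "(\<Sum>i\<in>K. U i (restrict (($) x) \<alpha>) * W i (restrict (($) x) (- \<alpha>))) =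
      (\<Sum>i<k. U (e i) (restrict (($) x) \<alpha>) * W (e i) (restrict (($) x) (- \<alpha>)))" for x
    by (rule sum.reindex_bij_betw[OF e, symmetric])
  then show ?thesis
    unfolding separated_def
    using U W eK v by (intro exI[of _ "\<lambda>i. U (e i)"] exI[of _ "\<lambda>i. W (e i)"]) auto
qed

lemma separated_Compl: "separated \<alpha> v k \<Longrightarrow> separated (- \<alpha>) v k"
  unfolding separated_def by (elim exE) (rule exI, rule exI, auto simp: mult.commute)

lemma square_integrable_sum:
  "finite J \<Longrightarrow> (\<And>j. j \<in> J \<Longrightarrow> square_integrable M (F j)) \<Longrightarrow> square_integrable M (\<lambda>x. \<Sum>j\<in>J. F j x)"
  by (induction J rule: finite_induct) (auto intro: square_integrable_zero square_integrable_add)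

lemma square_integrable_PiM_prod:
  fixes \<alpha> :: "'n::finite set" and F :: "'n \<Rightarrow> real cube_L2"
  shows "square_integrable (PiM \<alpha> (\<lambda>_. unit_cube)) (\<lambda>y. \<Prod>\<nu>\<in>\<alpha>. rep (F \<nu>) (y \<nu>))"
proof -
  interpret product_sigma_finite "\<lambda>_ :: 'n. unit_cube :: real measure"
    by (intro product_sigma_finite.intro sigma_finite_unit_cube)
  have "(\<lambda>y. rep (F \<nu>) (y \<nu>)) \<in> borel_measurable (PiM \<alpha> (\<lambda>_. unit_cube))" if "\<nu> \<in> \<alpha>" for \<nu>
    by (rule measurable_compose[OF measurable_component_singleton[OF that] rep_measurable])
  moreover have "integrable (PiM \<alpha> (\<lambda>_. unit_cube)) (\<lambda>y. \<Prod>\<nu>\<in>\<alpha>. (rep (F \<nu>) (y \<nu>))\<^sup>2)"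
    using square_integrable_rep by (intro product_integrable_prod) (auto simp: square_integrable_def)
  ultimately show ?thesis
    unfolding square_integrable_def by (auto simp: prod_power_distrib)
qed

text \<open>Grouping the multi-indices by their restriction to \<open>\<alpha>\<close> leaves one product for each choice of
  basis functions in the directions of \<open>\<alpha>\<close>.\<close>

lemma separated_tensor_sum:
  fixes v :: "(real ^ 'n::finite) cube_L2" and \<alpha> :: "'n set"
  assumes B: "\<And>c. c \<in> Basis \<Longrightarrow> finite (B c)"
    and v: "AE x in unit_cube. rep v x = (\<Sum>j\<in>PiE Basis B. c j * tensor_fun (\<lambda>i. rep (j i)) x)"
  shows "separated \<alpha> v (\<Prod>\<nu>\<in>\<alpha>. card (B (axis \<nu> 1)))"
proof -
  define A :: "(real ^ 'n) set" where "A = (\<lambda>\<nu>. axis \<nu> 1) ` \<alpha>"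
  define J where "J = PiE Basis B"
  define K where "K = PiE A B"
  have A: "A \<subseteq> Basis" by (auto simp: A_def Basis_cart)
  have finA: "finite A" by (simp add: A_def)
  have finJ: "finite J" unfolding J_def by (intro finite_PiE B) auto
  have finK: "finite K" unfolding K_def by (intro finite_PiE B finA) (use A in auto)
  have card: "card K = (\<Prod>\<nu>\<in>\<alpha>. card (B (axis \<nu> 1)))"
  proof -
    have "card K = (\<Prod>i\<in>A. card (B i))" unfolding K_def by (rule card_PiE[OF finA])
    then show ?thesis
      unfolding A_def by (simp add: prod.reindex[OF inj_on_subset[OF inj_axis_one subset_UNIV]] o_def)
  qed
  define P where "P \<beta> j y = (\<Prod>\<nu>\<in>\<beta>. rep (j (axis \<nu> 1)) (y \<nu>))" for \<beta> and j :: "real ^ 'n \<Rightarrow> real cube_L2" and y :: "'n \<Rightarrow> real"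
  define W where "W i y = (\<Sum>j\<in>{j \<in> J. restrict j A = i}. c j * P (- \<alpha>) j y)" for i y
  have P: "P \<beta> j (restrict y \<beta>) = P \<beta> j y" for \<beta> j y
    unfolding P_def by (rule prod.cong) auto
  have Psq: "square_integrable (PiM \<beta> (\<lambda>_. unit_cube)) (P \<beta> j)" for \<beta> j
    unfolding P_def[abs_def] by (rule square_integrable_PiM_prod)
  show ?thesis
  proof (rule separatedI_indexed[OF finK card, of \<alpha> "P \<alpha>" W])
    show "square_integrable (PiM (- \<alpha>) (\<lambda>_. unit_cube)) (W i)" for i
      unfolding W_def[abs_def]
      by (intro square_integrable_sum square_integrable_scale Psq) (use finJ in auto)
    show "AE x in unit_cube. rep v x = (\<Sum>i\<in>K. P \<alpha> i (restrict (($) x) \<alpha>) * W i (restrict (($) x) (- \<alpha>)))"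
      using v
    proof eventually_elim
      case (elim x)
      have split: "tensor_fun (\<lambda>i. rep (j i)) x = P \<alpha> (restrict j A) (($) x) * P (- \<alpha>) j (($) x)" for j
      proof -
        have "tensor_fun (\<lambda>i. rep (j i)) x = P (\<alpha> \<union> - \<alpha>) j (($) x)"
          by (simp add: tensor_fun_cart P_def)
        also have "\<dots> = P \<alpha> j (($) x) * P (- \<alpha>) j (($) x)"
          unfolding P_def by (rule prod.union_disjoint) auto
        also have "P \<alpha> j (($) x) = P \<alpha> (restrict j A) (($) x)"
          unfolding P_def by (rule prod.cong) (auto simp: A_def)
        finally show ?thesis .
      qed
      have "rep v x = (\<Sum>j\<in>J. c j * tensor_fun (\<lambda>i. rep (j i)) x)"
        using elim by (simp add: J_def)
      also have "\<dots> = (\<Sum>i\<in>K. \<Sum>j\<in>{j \<in> J. restrict j A = i}. c j * tensor_fun (\<lambda>i. rep (j i)) x)"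
        by (rule sum.group[symmetric, OF finJ finK]) (use A in \<open>auto simp: J_def K_def\<close>)
      also have "\<dots> = (\<Sum>i\<in>K. P \<alpha> i (($) x) * W i (($) x))"
        unfolding W_def sum_distrib_left by (intro sum.cong refl) (auto simp: split mult_ac)
      also have "\<dots> = (\<Sum>i\<in>K. P \<alpha> i (restrict (($) x) \<alpha>) * W i (restrict (($) x) (- \<alpha>)))"
        by (simp add: P W_def)
      finally show ?case .
    qed
  qed (use Psq in auto)
qed

lemma tensor_rank_le: "separated \<alpha> v k \<Longrightarrow> tensor_rank \<alpha> v \<le> enat k"
  unfolding tensor_rank_def by (rule INF_lower) simp

text \<open>The sum can be grouped by the multi-indices on \<open>\<alpha>\<close> or by those on the complement, whichever are
  fewer.\<close>

lemma tensor_rank_tensor_sum: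
  fixes v :: "(real ^ 'n::finite) cube_L2" and \<alpha> :: "'n set"
  assumes B: "\<And>c. c \<in> Basis \<Longrightarrow> finite (B c) \<and> card (B c) \<le> n"
    and v: "AE x in unit_cube. rep v x = (\<Sum>j\<in>PiE Basis B. c j * tensor_fun (\<lambda>i. rep (j i)) x)"
    and n: "1 \<le> n"
  shows "tensor_rank \<alpha> v \<le> enat (n ^ min (card \<alpha>) (card (- \<alpha>)))"
proof -
  have *: "tensor_rank \<beta> v \<le> enat (n ^ card \<gamma>)" if "\<beta> = \<gamma> \<or> \<beta> = - \<gamma>" for \<beta> \<gamma>
  proof -
    have sep: "separated \<gamma> v (\<Prod>\<nu>\<in>\<gamma>. card (B (axis \<nu> 1)))"
      by (rule separated_tensor_sum[OF _ v]) (use B in auto)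
    then have "separated \<beta> v (\<Prod>\<nu>\<in>\<gamma>. card (B (axis \<nu> 1)))"
      using that separated_Compl by blast
    then have "tensor_rank \<beta> v \<le> enat (\<Prod>\<nu>\<in>\<gamma>. card (B (axis \<nu> 1)))"
      by (rule tensor_rank_le)
    also have "(\<Prod>\<nu>\<in>\<gamma>. card (B (axis \<nu> 1))) \<le> (\<Prod>\<nu>\<in>\<gamma>. n)"
      by (rule prod_mono) (use B in \<open>auto simp: Basis_cart\<close>)
    finally show ?thesis by simp
  qed
  show ?thesis
    using *[of \<alpha> \<alpha>] *[of \<alpha> "- \<alpha>"] by (simp add: min_def)
qed

lemma tensor_sum_in_tensor_space:
  fixes v :: "(real ^ 'n::finite) cube_L2"
  assumes B: "\<And>\<nu>. finite (B (axis \<nu> 1)) \<and> B (axis \<nu> 1) \<subseteq> U \<nu>"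
    and v: "AE x in unit_cube. rep v x = (\<Sum>j\<in>PiE Basis B. c j * tensor_fun (\<lambda>i. rep (j i)) x)"
  shows "v \<in> tensor_space U"
proof -
  let ?F = "\<lambda>(j :: real ^ 'n \<Rightarrow> real cube_L2) x. tensor_fun (\<lambda>i. rep (j i)) x"
  have sq: "square_integrable unit_cube (?F j)" for j
    by (rule square_integrable_tensor_fun) (rule square_integrable_rep)
  have fin: "finite (PiE Basis B)" by (intro finite_PiE) (use B in \<open>auto simp: Basis_cart\<close>)
  note lin = abs_linear_combination[of "PiE Basis B" ?F c, OF fin sq]
  have "v = abs_cube_L2 (\<lambda>x. \<Sum>j\<in>PiE Basis B. c j * ?F j x)"
    unfolding cube_L2_eq_iff using v rep_abs[OF conjunct1[OF lin]] by eventually_elim simp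
  also have "\<dots> = (\<Sum>j\<in>PiE Basis B. c j *\<^sub>R abs_cube_L2 (?F j))"
    using lin by blast
  also have "\<dots> \<in> tensor_space U"
    unfolding tensor_space_def
  proof (intro span_sum span_scale span_base CollectI exI conjI allI)
    fix j \<nu> assume "j \<in> PiE Basis B"
    then have "j (axis \<nu> 1) \<in> B (axis \<nu> 1)" by (rule PiE_mem) (simp add: Basis_cart)
    then show "j (axis \<nu> 1) \<in> U \<nu>" using B by blast
  next
    fix j assume "j \<in> PiE Basis B"
    show "AE x in unit_cube. rep (abs_cube_L2 (?F j)) x = (\<Prod>\<nu>\<in>UNIV. rep (j (axis \<nu> 1)) (x $ \<nu>))"
      using rep_abs[OF sq[of j]] by eventually_elim (simp add: tensor_fun_cart)
  qed
  finally show ?thesis .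
qed

text \<open>Upper bounds for the ranks of tensors with at most \<open>n\<close> basis functions in each coordinate. At the root the
  complement is empty, so the value is \<open>1\<close> there, as admissibility demands.\<close>

definition full_ranks :: "nat \<Rightarrow> 'n::finite set \<Rightarrow> nat" where
  "full_ranks n \<alpha> = n ^ min (card \<alpha>) (card (- \<alpha>))"

text \<open>The bounds \<open>r\<^sub>\<alpha> \<le> n\<^bsup>d - #\<alpha>\<^esup>\<close> and \<open>r\<^sub>\<beta> \<le> n\<^bsup>#\<beta>\<^esup>\<close> for the sons \<open>\<beta>\<close> of \<open>\<alpha>\<close> give
  \<open>r\<^sub>\<alpha> \<Prod>\<^sub>\<beta> r\<^sub>\<beta> \<le> n\<^sup>d\<close>, because the sons partition \<open>\<alpha>\<close>. The number of interior nodes is at most the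
  number \<open>2\<^sup>d\<close> of all subsets.\<close>

lemma complexity_full_ranks_le:
  fixes T :: "'n::finite set set"
  assumes T: "dimension_partition_tree T S" and d: "2 \<le> CARD('n)" and n: "1 \<le> n"
    and U: "\<And>\<nu>. dim (U \<nu>) = n"
  shows "complexity T S (full_ranks n) U \<le> (2 ^ CARD('n) + CARD('n)) * n ^ CARD('n)"
proof -
  have r1: "full_ranks n \<alpha> \<le> n ^ card \<alpha>" and r2: "full_ranks n \<alpha> \<le> n ^ card (- \<alpha>)" for \<alpha> :: "'n set"
    using n by (auto simp: full_ranks_def intro: power_increasing)
  have node: "full_ranks n \<alpha> * (\<Prod>\<beta>\<in>S \<alpha>. full_ranks n \<beta>) \<le> n ^ CARD('n)"
    if \<alpha>: "\<alpha> \<in> interior_nodes T S" for \<alpha>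
  proof -
    have part: "partition_on \<alpha> (S \<alpha>)"
      using T \<alpha> by (auto simp: dimension_partition_tree_def interior_nodes_def)
    have "(\<Prod>\<beta>\<in>S \<alpha>. full_ranks n \<beta>) \<le> (\<Prod>\<beta>\<in>S \<alpha>. n ^ card \<beta>)"
      by (rule prod_mono) (use r1 in auto)
    also have "\<dots> = n ^ (\<Sum>\<beta>\<in>S \<alpha>. card \<beta>)"
      by (simp add: power_sum)
    also have "(\<Sum>\<beta>\<in>S \<alpha>. card \<beta>) = card \<alpha>"
      using card_Union_disjoint[of "S \<alpha>"] part by (simp add: partition_on_def disjoint_def pairwise_def disjnt_def)
    finally have "full_ranks n \<alpha> * (\<Prod>\<beta>\<in>S \<alpha>. full_ranks n \<beta>) \<le> n ^ card (- \<alpha>) * n ^ card \<alpha>"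
      by (intro mult_mono r2) auto
    also have "\<dots> = n ^ CARD('n)"
    proof -
      have "card (- \<alpha>) + card \<alpha> = CARD('n)"
        using card_Un_disjoint[of "- \<alpha>" \<alpha>] by simp
      then show ?thesis by (simp flip: power_add)
    qed
    finally show ?thesis .
  qed
  have "(\<Sum>\<alpha>\<in>interior_nodes T S. full_ranks n \<alpha> * (\<Prod>\<beta>\<in>S \<alpha>. full_ranks n \<beta>)) \<le>
      card (interior_nodes T S) * n ^ CARD('n)"
    using sum_bounded_above[OF node] by simp
  also have "\<dots> \<le> 2 ^ CARD('n) * n ^ CARD('n)"
  proof (rule mult_right_mono)
    have "card (interior_nodes T S) \<le> card (UNIV :: 'n set set)" by (rule card_mono) auto
    then show "card (interior_nodes T S) \<le> 2 ^ CARD('n)" by (simp add: card_Pow flip: Pow_UNIV)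
  qed simp
  finally have inner: "(\<Sum>\<alpha>\<in>interior_nodes T S. full_ranks n \<alpha> * (\<Prod>\<beta>\<in>S \<alpha>. full_ranks n \<beta>)) \<le>
      2 ^ CARD('n) * n ^ CARD('n)" .
  have "full_ranks n {\<nu>} * dim (U \<nu>) \<le> n ^ CARD('n)" for \<nu> :: 'n
  proof -
    have "full_ranks n {\<nu>} * dim (U \<nu>) \<le> n ^ 2"
      using r1[of "{\<nu>}"] by (simp add: U power2_eq_square)
    also have "\<dots> \<le> n ^ CARD('n)" by (rule power_increasing[OF d n])
    finally show ?thesis .
  qed
  then have "(\<Sum>\<nu>\<in>UNIV. full_ranks n {\<nu>} * dim (U \<nu>)) \<le> CARD('n) * n ^ CARD('n)"
    using sum_bounded_above[of UNIV "\<lambda>\<nu>. full_ranks n {\<nu>} * dim (U \<nu>)" "n ^ CARD('n)"] by simp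
  with inner show ?thesis
    unfolding complexity_def by (simp add: distrib_right)
qed

section \<open>The complexity estimate\<close>

lemma coord_projs_approximation:
  fixes f :: "(real ^ 'n::finite) cube_L2" and U :: "'n \<Rightarrow> real cube_L2 set"
  assumes U: "\<And>\<nu>. subspace (U \<nu>) \<and> dim (U \<nu>) = n" and n: "1 \<le> n"
    and approx: "\<And>\<nu> w. w \<in> sobolev s \<Longrightarrow> infdist w (U \<nu>) \<le> c * sobolev_norm s w" and c: "0 \<le> c"
    and f: "f \<in> sobolev s"
  obtains v where "v \<in> tensor_space U" "\<And>\<alpha>. tensor_rank \<alpha> v \<le> enat (full_ranks n \<alpha>)"
    "norm (f - v) \<le> CARD('n) * (c * sqrt (slice_const CARD('n) s)) * sobolev_norm s f"
proof -
  have "\<exists>B. orthonormal B \<and> card B \<le> n \<and> span B = U \<nu>" for \<nu>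
    using orthonormal_basis_exists[of "U \<nu>" n] U n by metis
  then obtain B' where B': "\<And>\<nu>. orthonormal (B' \<nu>) \<and> card (B' \<nu>) \<le> n \<and> span (B' \<nu>) = U \<nu>"
    by metis
  define B :: "real ^ 'n \<Rightarrow> real cube_L2 set" where "B b = B' (inv (\<lambda>\<nu>. axis \<nu> 1) b)" for b
  have Bax: "B (axis \<nu> 1) = B' \<nu>" for \<nu>
    by (simp add: B_def inv_f_f[OF inj_axis_one])
  have B: "orthonormal (B b) \<and> card (B b) \<le> n" if "b \<in> Basis" for b
    using that B' by (auto simp: Basis_cart Bax)
  obtain bs :: "(real ^ 'n) list" where bs: "distinct bs" "set bs = Basis"
    using finite_distinct_list[OF finite_Basis] by auto
  define v where "v = coord_projs B bs f"
  have "has_partial_tensor B Basis v"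
    unfolding v_def bs(2)[symmetric]
    by (rule has_partial_tensor_coord_projs) (use bs B in auto)
  then obtain k where k: "AE x in unit_cube. rep v x = (\<Sum>j\<in>PiE Basis B. k j * tensor_fun (\<lambda>i. rep (j i)) x)"
    by (rule has_partial_tensor_all)
  show ?thesis
  proof
    show "v \<in> tensor_space U"
      by (rule tensor_sum_in_tensor_space[OF _ k])
        (use B' in \<open>auto simp: Bax orthonormal_def intro: span_base\<close>)
    show "tensor_rank \<alpha> v \<le> enat (full_ranks n \<alpha>)" for \<alpha>
      unfolding full_ranks_def
      by (rule tensor_rank_tensor_sum[OF _ k n]) (use B in \<open>auto simp: orthonormal_def\<close>)
    have "norm (f - v) \<le> (\<Sum>b\<leftarrow>bs. norm (f - coord_proj_L2 b (B b) f))"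
      unfolding v_def by (rule norm_diff_coord_projs_le) (use bs B in auto)
    also have "\<dots> = (\<Sum>b\<in>Basis. norm (f - coord_proj_L2 b (B b) f))"
      using bs by (simp add: sum_list_distinct_conv_sum_set)
    also have "\<dots> \<le> of_nat (card (Basis :: (real ^ 'n) set)) * (c * sqrt (slice_const DIM(real ^ 'n) s) * sobolev_norm s f)"
    proof (rule sum_bounded_above)
      fix b :: "real ^ 'n" assume b: "b \<in> Basis"
      then obtain \<nu> where \<nu>: "b = axis \<nu> 1" by (auto simp: Basis_cart)
      show "norm (f - coord_proj_L2 b (B b) f) \<le> c * sqrt (slice_const DIM(real ^ 'n) s) * sobolev_norm s f"
        by (rule norm_diff_coord_proj_le[OF b _ f _ c]) (use B[OF b] B' approx \<nu> in \<open>auto simp: Bax\<close>)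
    qed
    finally show "norm (f - v) \<le> CARD('n) * (c * sqrt (slice_const CARD('n) s)) * sobolev_norm s f"
      by (simp add: mult.assoc)
  qed
qed

lemma min_complexity_le:
  fixes T :: "'n::finite set set"
  assumes d: "2 \<le> CARD('n)" and T: "dimension_partition_tree T S"
    and U: "\<And>\<nu>. subspace (U \<nu> n) \<and> dim (U \<nu> n) = n" and n: "1 \<le> n"
    and approx: "\<And>\<nu> w. w \<in> sobolev s \<Longrightarrow> infdist w (U \<nu> n) \<le> c * sobolev_norm s w" and c: "0 \<le> c"
    and f: "f \<in> sobolev s"
    and \<epsilon>: "CARD('n) * (c * sqrt (slice_const CARD('n) s)) \<le> \<epsilon>"
  shows "min_complexity s T S U f \<epsilon> \<le> enat ((2 ^ CARD('n) + CARD('n)) * n ^ CARD('n))"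
proof -
  obtain v where v: "v \<in> tensor_space (\<lambda>\<nu>. U \<nu> n)" "\<And>\<alpha>. tensor_rank \<alpha> v \<le> enat (full_ranks n \<alpha>)"
    "norm (f - v) \<le> CARD('n) * (c * sqrt (slice_const CARD('n) s)) * sobolev_norm s f"
    using coord_projs_approximation[of "\<lambda>\<nu>. U \<nu> n" n s c f] U n approx c f by metis
  have mem: "v \<in> tree_tensors T (full_ranks n) V" if "v \<in> V" for V
    using that v(2) by (simp add: tree_tensors_def)
  have "admissible T (full_ranks n)"
    using mem[of UNIV] by (auto simp: admissible_def full_ranks_def)
  moreover have "infdist f (tree_tensors T (full_ranks n) (tensor_space (\<lambda>\<nu>. U \<nu> n))) \<le> \<epsilon> * sobolev_norm s f"
  proof -
    have "infdist f (tree_tensors T (full_ranks n) (tensor_space (\<lambda>\<nu>. U \<nu> n))) \<le> norm (f - v)"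
      using infdist_le[OF mem[OF v(1)], of f] by (simp add: dist_norm)
    also have "\<dots> \<le> \<epsilon> * sobolev_norm s f"
      by (rule order_trans[OF v(3) mult_right_mono[OF \<epsilon> sobolev_norm_nonneg]])
    finally show ?thesis .
  qed
  ultimately have "min_complexity s T S U f \<epsilon> \<le> enat (complexity T S (full_ranks n) (\<lambda>\<nu>. U \<nu> n))"
    unfolding min_complexity_def
    by (intro INF_lower2[of "(full_ranks n, \<lambda>_. n)"]) (use n in auto)
  also have "\<dots> \<le> enat ((2 ^ CARD('n) + CARD('n)) * n ^ CARD('n))"
    using complexity_full_ranks_le[OF T d n, of "\<lambda>\<nu>. U \<nu> n"] U by simp
  finally show ?thesis .
qed

theorem theorem3p3:
  fixes s M :: real
  assumes "2 \<le> CARD('n::finite)" and "0 < s"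
  shows "\<exists>C::real. \<forall>(T :: 'n set set) S (U :: 'n \<Rightarrow> nat \<Rightarrow> real cube_L2 set).
    dimension_partition_tree T S \<longrightarrow>
    (\<forall>\<nu>. \<forall>m\<ge>1. subspace (U \<nu> m) \<and> dim (U \<nu> m) = m) \<longrightarrow>
    (\<forall>\<nu>. \<forall>m\<ge>1. \<forall>u\<in>sobolev s.
        infdist u (U \<nu> m) \<le> M * real m powr (- s) * sobolev_norm s u) \<longrightarrow>
    (\<forall>f\<in>sobolev s. \<forall>\<epsilon>. 0 < \<epsilon> \<and> \<epsilon> < 1 \<longrightarrow>
        ereal_of_enat (min_complexity s T S U f \<epsilon>)
          \<le> ereal (C * \<epsilon> powr (- real CARD('n) / s)))"
proof -
  define d where "d = CARD('n)"
  define A where "A = real d * (\<bar>M\<bar> * sqrt (slice_const d s))"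
  define K where "K = (1 + A) powr (1 / s)"
  define C where "C = real (2 ^ d + d) * (2 * K) ^ d"
  have A: "0 \<le> A"
    using slice_const_ge_1[of d s] by (simp add: A_def)
  have K: "1 \<le> K" unfolding K_def by (rule ge_one_powr_ge_zero) (use A assms in auto)
  show ?thesis
  proof (intro exI[of _ C] allI impI ballI)
    fix T :: "'n set set" and S and U :: "'n \<Rightarrow> nat \<Rightarrow> real cube_L2 set"
      and f :: "(real ^ 'n) cube_L2" and \<epsilon> :: real
    assume T: "dimension_partition_tree T S"
      and U: "\<forall>\<nu>. \<forall>m\<ge>1. subspace (U \<nu> m) \<and> dim (U \<nu> m) = m"
      and approx: "\<forall>\<nu>. \<forall>m\<ge>1. \<forall>u\<in>sobolev s.
        infdist u (U \<nu> m) \<le> M * real m powr (- s) * sobolev_norm s u"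
      and f: "f \<in> sobolev s" and \<epsilon>: "0 < \<epsilon> \<and> \<epsilon> < 1"
    \<comment> \<open>The choice \<open>K\<^sup>s = 1 + A\<close> makes \<open>A n\<^bsup>- s\<^esup> \<le> \<epsilon>\<close> for \<open>n \<ge> t\<close>, and \<open>1 \<le> t\<close> turns the rounding of \<open>t\<close> into a
      factor \<open>2\<close>.\<close>
    define t where "t = K * \<epsilon> powr (- 1 / s)"
    have \<epsilon>1: "1 \<le> \<epsilon> powr (- 1 / s)"
      using \<epsilon> assms(2) by (simp add: powr_minus_divide powr_le_one_le le_divide_eq powr_le1)
    have t: "1 \<le> t" using mult_mono[OF K \<epsilon>1] K by (simp add: t_def)
    define n where "n = nat \<lceil>t\<rceil>"
    have n: "t \<le> real n" "real n \<le> 2 * t" "1 \<le> n"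
      using t by (simp_all add: n_def) linarith+
    have "real n powr (- s) \<le> t powr (- s)"
      using n t assms(2) by (intro powr_mono2') auto
    also have "\<dots> = \<epsilon> / (1 + A)"
    proof -
      have "t powr (- s) = K powr (- s) * (\<epsilon> powr (- 1 / s)) powr (- s)"
        unfolding t_def by (rule powr_mult)
      also have "K powr (- s) = inverse (1 + A)"
        unfolding K_def powr_powr using A assms(2) by (simp add: powr_minus)
      also have "(\<epsilon> powr (- 1 / s)) powr (- s) = \<epsilon>"
        unfolding powr_powr using \<epsilon> assms(2) by simp
      finally show ?thesis by (simp add: divide_inverse mult.commute)
    qed
    finally have "A * real n powr (- s) \<le> A * (\<epsilon> / (1 + A))"
      using A by (rule mult_left_mono)
    also have "\<dots> \<le> \<epsilon>"
    proof -
      have "A / (1 + A) * \<epsilon> \<le> 1 * \<epsilon>"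
        using A \<epsilon> by (intro mult_right_mono) (auto simp: divide_le_eq)
      then show ?thesis by simp
    qed
    finally have err: "real d * (\<bar>M\<bar> * real n powr (- s) * sqrt (slice_const d s)) \<le> \<epsilon>"
      by (simp add: A_def mult_ac)
    have approx': "infdist w (U \<nu> n) \<le> \<bar>M\<bar> * real n powr (- s) * sobolev_norm s w" if "w \<in> sobolev s" for \<nu> w
    proof -
      have "infdist w (U \<nu> n) \<le> M * real n powr (- s) * sobolev_norm s w"
        using approx n(3) that by blast
      also have "\<dots> \<le> \<bar>M\<bar> * real n powr (- s) * sobolev_norm s w"
        by (intro mult_right_mono sobolev_norm_nonneg) auto
      finally show ?thesis .
    qed
    have "min_complexity s T S U f \<epsilon> \<le> enat ((2 ^ d + d) * n ^ d)"
      unfolding d_def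
      by (rule min_complexity_le[where U = U and c = "\<bar>M\<bar> * real n powr (- s)"])
        (use assms(1) T U n(3) approx' f err in \<open>auto simp: d_def\<close>)
    then have "ereal_of_enat (min_complexity s T S U f \<epsilon>) \<le> ereal_of_enat (enat ((2 ^ d + d) * n ^ d))"
      by (simp only: ereal_of_enat_le_iff)
    also have "\<dots> = ereal (real (2 ^ d + d) * real n ^ d)"
      by simp
    also have "\<dots> \<le> ereal (C * \<epsilon> powr (- real d / s))"
    proof -
      have "real n ^ d \<le> (2 * t) ^ d" using n by (intro power_mono) auto
      also have "\<dots> = (2 * K) ^ d * (\<epsilon> powr (- 1 / s)) ^ d"
        by (simp add: t_def power_mult_distrib)
      also have "(\<epsilon> powr (- 1 / s)) ^ d = \<epsilon> powr (- real d / s)"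
        using \<epsilon> by (simp add: powr_powr flip: powr_realpow)
      finally show ?thesis
        by (simp add: C_def mult.assoc mult_left_mono)
    qed
    finally show "ereal_of_enat (min_complexity s T S U f \<epsilon>) \<le> ereal (C * \<epsilon> powr (- real CARD('n) / s))"
      by (simp add: d_def)
  qed
qed

end
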